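(* For component 3981 of $G(9)$, the nontrivial cycles in the cycle basis produce the following commutativity property, which transposes the indeterminates $\{e,g\}$: $$( a \circ b \circ c ) \bullet ( d \circ ( e \bullet f ) \circ ( g \bullet h ) \circ i ) \equiv ( a \circ b \circ c ) \bullet ( d \circ ( g \bullet f ) \circ ( e \bullet h ) \circ i ),$$ that is, in terms of geometric realizations, $$\begin{bmatrix} \begin{bmatrix} a & b & c \end{bmatrix} \\ \begin{bmatrix} d & \begin{bmatrix} e \\ f \end{bmatrix} & \begin{bmatrix} g \\ h \end{bmatrix} & i \end{bmatrix} \end{bmatrix} \equiv \begin{bmatrix} \begin{bmatrix} a & b & c \end{bmatrix} \\ \begin{bmatrix} d & \begin{bmatrix} g \\ f \end{bmatrix} & \begin{bmatrix} e \\ h \end{bmatrix} & i \end{bmatrix} \end{bmatrix}.$$ Every other association type in component 3981 produces a corresponding property; since the association types in the same component represent the same equivalence class of monomials in the free double semigroup, starting from another association type amounts to choosing a different representative of the same equivalence class. Cyclic rotation produces bijections between the four components of type 1 (components 3981, 3982, 3983, 3984), and hence there are corresponding identities in all four components.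
   Context: A double semigroup is a set $S$ with two associative binary operations $\circ,\bullet$ satisfying the interchange relation $(a\bullet b)\circ(c\bullet d)\equiv(a\circ c)\bullet(b\circ d)$ for all $a,b,c,d\in S$; no units are assumed. The symbol $\equiv$ means that the equation holds for all values of the variables. Geometric realization: $\circ$ is horizontal composition (left to right) and $\bullet$ is vertical composition (top to bottom) of boxes; row vectors denote horizontal composition and column vectors denote vertical composition. Cyclic rotation is rotation of the geometric realizations by quarter turns. Association types of degree $n$ are the possible placements of balanced parentheses and operation symbols in a monomial of degree $n$ with two associative operations $\circ,\bullet$ (the interchange relation is not imposed). A multilinear monomial of degree $n$ is an association type of degree $n$ whose positions, from left to right, are filled with a permutation of $n$ fixed indeterminates. Total order on association types: products of more than two factors by the same operation are parenthesized to the right, so each type of degree at least 2 is uniquely $t'\circ t''$ or $t'\bullet t''$. Lower degree comes first; in equal degree, $\circ$ at the root precedes $\bullet$ at the root; with the same root operation, compare $t'$ first and then $t''$, recursively. $F(n)$ is the directed graph whose vertices are the multilinear monomials of degree $n$, with an edge $m\to m'$ whenever $m$ can be converted into $m'$ by one application of the interchange relation (modulo associativity, to a submonomial $(w\bullet x)\circ(y\bullet z)$ or $(w\circ y)\bullet(x\circ z)$ with $w,x,y,z$ arbitrary monomials); every edge has a reverse edge. The symmetric group $S_n$ acts freely on $F(n)$ by permuting positions of indeterminates. $G(n)$ is the quotient graph; its vertices are the association types, and its edges are labelled by the corresponding permutations of positions, reverse edges having inverse labels. A directed cycle in $G(n)$ is nontrivial if the product of the permutations along its edges is not the identity. A commutativity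 property in degree $n$ corresponds to a nontrivial cycle: if the cycle passes through association type $t$, regarding $t$ as its first and last vertex gives a property $m\equiv m'$ in which both monomials have association type $t$ but different permutations of the indeterminates. $G(9)$ has 4001 connected components that are not isolated vertices. They are sorted first by number of vertices and then by minimal vertex in the total order; "component $N$" is the $N$-th in this list. Cycle basis: a set of cycles generating all cycles of the component by repeated symmetric differences; its size is the circuit rank $r$. The cycle basis used for each component is chosen as follows: take the basis computed by the command CycleBasis of the Maple package GraphTheory; convert it to an $r\times e$ matrix over $\mathbb{F}_2$, where $e$ is the number of edges of the component (a pair of mutually reverse edges counted once) and the $(i,j)$ entry is 1 if and only if cycle $i$ contains edge $j$; compute the row canonical form; and use the cycles represented by its rows. Component 3981 has 107 vertices, 144 edges and circuit rank 38, and 2 of the cycles in this basis are nontrivial. The four components of type 1 contain the following representative association types (positions indicated by alphabetical order of the indeterminates): 3981: $( a \circ b \circ c ) \bullet ( d \circ ( e \bullet f ) \circ ( g \bullet h ) \circ i )$; 3982: $( a \circ ( b \bullet c ) \circ ( d \bullet e ) \circ f ) \bullet ( g \circ h \circ i )$; 3983: $( a \bullet b \bullet c ) \circ ( d \bullet ( e \circ f ) \bullet ( g \circ h ) \bullet i )$; 3984: $( a \bullet ( b \circ c ) \bullet ( d \circ e ) \bullet f ) \circ ( g \bullet h \bullet i )$. *)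

theory Defs
  imports
    Main
    "HOL-Library.Z2"
    "HOL-Combinatorics.Permutations"
    "Jordan_Normal_Form.Gauss_Jordan_Elimination"
begin

section \<open>Double semigroups\<close>

locale double_semigroup =
  fixes S :: "'a set"
    and hop :: "'a \<Rightarrow> 'a \<Rightarrow> 'a" (infixl "\<circ>\<^sub>H" 70)
    and vop :: "'a \<Rightarrow> 'a \<Rightarrow> 'a" (infixl "\<bullet>\<^sub>V" 70)
  assumes hop_closed: "a \<in> S \<Longrightarrow> b \<in> S \<Longrightarrow> a \<circ>\<^sub>H b \<in> S"
    and vop_closed: "a \<in> S \<Longrightarrow> b \<in> S \<Longrightarrow> a \<bullet>\<^sub>V b \<in> S"
    and hop_assoc: "a \<in> S \<Longrightarrow> b \<in> S \<Longrightarrow> c \<in> S \<Longrightarrow> (a \<circ>\<^sub>H b) \<circ>\<^sub>H c = a \<circ>\<^sub>H (b \<circ>\<^sub>H c)"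
    and vop_assoc: "a \<in> S \<Longrightarrow> b \<in> S \<Longrightarrow> c \<in> S \<Longrightarrow> (a \<bullet>\<^sub>V b) \<bullet>\<^sub>V c = a \<bullet>\<^sub>V (b \<bullet>\<^sub>V c)"
    and interchange_law:
      "a \<in> S \<Longrightarrow> b \<in> S \<Longrightarrow> c \<in> S \<Longrightarrow> d \<in> S \<Longrightarrow>
        (a \<bullet>\<^sub>V b) \<circ>\<^sub>H (c \<bullet>\<^sub>V d) = (a \<circ>\<^sub>H c) \<bullet>\<^sub>V (b \<circ>\<^sub>H d)"

section \<open>Monomials and association types\<close>

text \<open>
  \<open>H\<close> is horizontal and \<open>V\<close> is vertical composition. A monomial modulo the two associative laws is
  represented by its right-parenthesized tree (\<open>normal\<close>); the compositions \<open>hcomp\<close>, \<open>vcomp\<close>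
  keep trees in this form.
\<close>

datatype 'a mono =
    Ind 'a
  | is_H: H "'a mono" "'a mono"
  | is_V: V "'a mono" "'a mono"

primrec normal :: "'a mono \<Rightarrow> bool" where
  "normal (Ind x) \<longleftrightarrow> True"
| "normal (H s t) \<longleftrightarrow> \<not> is_H s \<and> normal s \<and> normal t"
| "normal (V s t) \<longleftrightarrow> \<not> is_V s \<and> normal s \<and> normal t"

fun hcomp :: "'a mono \<Rightarrow> 'a mono \<Rightarrow> 'a mono" where
  "hcomp (H s t) u = H s (hcomp t u)"
| "hcomp s u = H s u"

fun vcomp :: "'a mono \<Rightarrow> 'a mono \<Rightarrow> 'a mono" where
  "vcomp (V s t) u = V s (vcomp t u)"
| "vcomp s u = V s u"

text \<open>Row and column vectors of the geometric realization (nonempty lists only).\<close>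

fun hrow :: "'a mono list \<Rightarrow> 'a mono" where
  "hrow [] = undefined"
| "hrow [s] = s"
| "hrow (s # t # ts) = hcomp s (hrow (t # ts))"

fun vcol :: "'a mono list \<Rightarrow> 'a mono" where
  "vcol [] = undefined"
| "vcol [s] = s"
| "vcol (s # t # ts) = vcomp s (vcol (t # ts))"

primrec indets :: "'a mono \<Rightarrow> 'a list" where
  "indets (Ind x) = [x]"
| "indets (H s t) = indets s @ indets t"
| "indets (V s t) = indets s @ indets t"

definition deg :: "'a mono \<Rightarrow> nat" where
  "deg s = length (indets s)"

definition type_of :: "'a mono \<Rightarrow> unit mono" where
  "type_of = map_mono (\<lambda>_. ())"

definition assoc_types :: "nat \<Rightarrow> unit mono set" where
  "assoc_types n = {t. normal t \<and> deg t = n}"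

definition multilinear :: "nat \<Rightarrow> nat mono set" where
  "multilinear n = {m. normal m \<and> distinct (indets m) \<and> set (indets m) = {..<n}}"

primrec eval :: "('b \<Rightarrow> 'b \<Rightarrow> 'b) \<Rightarrow> ('b \<Rightarrow> 'b \<Rightarrow> 'b) \<Rightarrow> ('a \<Rightarrow> 'b) \<Rightarrow> 'a mono \<Rightarrow> 'b" where
  "eval h v \<rho> (Ind x) = \<rho> x"
| "eval h v \<rho> (H s t) = h (eval h v \<rho> s) (eval h v \<rho> t)"
| "eval h v \<rho> (V s t) = v (eval h v \<rho> s) (eval h v \<rho> t)"

definition swap_indets :: "'a \<Rightarrow> 'a \<Rightarrow> 'a mono \<Rightarrow> 'a mono" where
  "swap_indets x y = map_mono (transpose x y)"

text \<open>
  Clockwise quarter turn of the geometric realization: left becomes top, and top becomes right.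
\<close>

primrec rot :: "'a mono \<Rightarrow> 'a mono" where
  "rot (Ind x) = Ind x"
| "rot (H s t) = vcomp (rot s) (rot t)"
| "rot (V s t) = hcomp (rot t) (rot s)"

fun type_less :: "unit mono \<Rightarrow> unit mono \<Rightarrow> bool" where
  "type_less (H s s') (H t t') \<longleftrightarrow>
     deg (H s s') < deg (H t t') \<or>
     deg (H s s') = deg (H t t') \<and> (type_less s t \<or> s = t \<and> type_less s' t')"
| "type_less (V s s') (V t t') \<longleftrightarrow>
     deg (V s s') < deg (V t t') \<or>
     deg (V s s') = deg (V t t') \<and> (type_less s t \<or> s = t \<and> type_less s' t')"
| "type_less (H s s') (V t t') \<longleftrightarrow> deg (H s s') \<le> deg (V t t')"
| "type_less s t \<longleftrightarrow> deg s < deg t"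

section \<open>The graphs \<open>F(n)\<close> and \<open>G(n)\<close>\<close>

text \<open>One application of the interchange relation to a submonomial, modulo associativity.\<close>

inductive interchange :: "'a mono \<Rightarrow> 'a mono \<Rightarrow> bool" where
  hv: "normal w \<Longrightarrow> normal x \<Longrightarrow> normal y \<Longrightarrow> normal z \<Longrightarrow>
    interchange (hcomp (vcomp w x) (vcomp y z)) (vcomp (hcomp w y) (hcomp x z))"
| vh: "normal w \<Longrightarrow> normal x \<Longrightarrow> normal y \<Longrightarrow> normal z \<Longrightarrow>
    interchange (vcomp (hcomp w y) (hcomp x z)) (hcomp (vcomp w x) (vcomp y z))"
| h_left: "interchange s s' \<Longrightarrow> normal t \<Longrightarrow> interchange (hcomp s t) (hcomp s' t)"
| h_right: "normal s \<Longrightarrow> interchange t t' \<Longrightarrow> interchange (hcomp s t) (hcomp s t')"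
| v_left: "interchange s s' \<Longrightarrow> normal t \<Longrightarrow> interchange (vcomp s t) (vcomp s' t)"
| v_right: "normal s \<Longrightarrow> interchange t t' \<Longrightarrow> interchange (vcomp s t) (vcomp s t')"

definition F_edges :: "nat \<Rightarrow> (nat mono \<times> nat mono) set" where
  "F_edges n = {(m, m'). m \<in> multilinear n \<and> m' \<in> multilinear n \<and> interchange m m'}"

text \<open>
  An arc \<open>(t, \<sigma>, t')\<close> of \<open>G(n)\<close> leads from \<open>t\<close> to \<open>t'\<close> and has label \<open>\<sigma>\<close>, a permutation of the
  positions \<open>0, \<dots>, n - 1\<close>: position \<open>i\<close> of the target holds the indeterminate at position \<open>\<sigma> i\<close>
  of the source. The arcs are the orbits of the edges of \<open>F(n)\<close> under renaming of the
  indeterminates, which leaves the label unchanged.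
\<close>

type_synonym arc = "unit mono \<times> (nat \<Rightarrow> nat) \<times> unit mono"

definition G_arcs :: "nat \<Rightarrow> arc set" where
  "G_arcs n = {(type_of m, \<sigma>, type_of m') | m m' \<sigma>.
     (m, m') \<in> F_edges n \<and> \<sigma> permutes {..<n} \<and> indets m' = permute_list \<sigma> (indets m)}"

definition src :: "arc \<Rightarrow> unit mono" where "src a = fst a"
definition lbl :: "arc \<Rightarrow> nat \<Rightarrow> nat" where "lbl a = fst (snd a)"
definition tgt :: "arc \<Rightarrow> unit mono" where "tgt a = snd (snd a)"

definition rev_arc :: "arc \<Rightarrow> arc" where
  "rev_arc a = (tgt a, inv_into UNIV (lbl a), src a)"

definition G_adj :: "nat \<Rightarrow> (unit mono \<times> unit mono) set" where
  "G_adj n = {(src a, tgt a) | a. a \<in> G_arcs n}"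

definition components :: "nat \<Rightarrow> unit mono set set" where
  "components n = {(G_adj n)\<^sup>* `` {t} | t. t \<in> assoc_types n \<and> t \<in> Domain (G_adj n)}"

definition min_vertex :: "unit mono set \<Rightarrow> unit mono" where
  "min_vertex C = (THE t. t \<in> C \<and> (\<forall>u\<in>C. u = t \<or> type_less t u))"

definition component_less :: "unit mono set \<Rightarrow> unit mono set \<Rightarrow> bool" where
  "component_less C D \<longleftrightarrow>
     card C < card D \<or> card C = card D \<and> type_less (min_vertex C) (min_vertex D)"

definition component_list :: "nat \<Rightarrow> unit mono set list" where
  "component_list n = (THE Cs. set Cs = components n \<and> sorted_wrt component_less Cs)"

text \<open>Components are numbered from 1; isolated vertices are not numbered.\<close>

definition component :: "nat \<Rightarrow> nat \<Rightarrow> unit mono set" where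
  "component n N = component_list n ! (N - 1)"

section \<open>Cycles and cycle bases\<close>

fun walk :: "nat \<Rightarrow> unit mono \<Rightarrow> arc list \<Rightarrow> unit mono \<Rightarrow> bool" where
  "walk n s [] t \<longleftrightarrow> s = t"
| "walk n s (a # as) t \<longleftrightarrow> a \<in> G_arcs n \<and> src a = s \<and> walk n (tgt a) as t"

text \<open>
  The product of the labels: \<open>permute_list (\<sigma> \<circ> \<tau>) xs = permute_list \<tau> (permute_list \<sigma> xs)\<close>,
  so the label of the first arc is the leftmost factor.
\<close>

primrec perm_of :: "arc list \<Rightarrow> nat \<Rightarrow> nat" where
  "perm_of [] = id"
| "perm_of (a # as) = lbl a \<circ> perm_of as"

definition edge_of :: "arc \<Rightarrow> arc set" where
  "edge_of a = {a, rev_arc a}"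

definition edges :: "nat \<Rightarrow> unit mono set \<Rightarrow> arc set set" where
  "edges n C = edge_of ` {a \<in> G_arcs n. src a \<in> C}"

definition circuit_rank :: "nat \<Rightarrow> unit mono set \<Rightarrow> nat" where
  "circuit_rank n C = card (edges n C) + 1 - card C"

text \<open>Directed cycles as closed walks, with \<open>s\<close> as the first and last vertex.\<close>

definition cycle :: "nat \<Rightarrow> unit mono set \<Rightarrow> unit mono \<Rightarrow> arc list \<Rightarrow> bool" where
  "cycle n C s c \<longleftrightarrow> c \<noteq> [] \<and> s \<in> C \<and> walk n s c s \<and>
     distinct (map src c) \<and> distinct (map edge_of c)"

definition cycle_edges :: "arc list \<Rightarrow> arc set set" where
  "cycle_edges c = edge_of ` set c"

definition nontrivial :: "arc list \<Rightarrow> bool" where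
  "nontrivial c \<longleftrightarrow> perm_of c \<noteq> id"

text \<open>Every cycle is the symmetric difference of the basis members with index in some \<open>A\<close>.\<close>

definition cycle_basis :: "nat \<Rightarrow> unit mono set \<Rightarrow> arc set set list \<Rightarrow> bool" where
  "cycle_basis n C B \<longleftrightarrow>
     length B = circuit_rank n C \<and>
     (\<forall>X\<in>set B. \<exists>s c. cycle n C s c \<and> X = cycle_edges c) \<and>
     (\<forall>s c. cycle n C s c \<longrightarrow>
        (\<exists>A\<subseteq>{..<length B}. cycle_edges c = {x. odd (card {i \<in> A. x \<in> B ! i})}))"

definition cycle_matrix :: "arc set set list \<Rightarrow> arc set list \<Rightarrow> bit mat" where
  "cycle_matrix B es = mat (length B) (length es) (\<lambda>(i, j). if es ! j \<in> B ! i then 1 else 0)"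

text \<open>The edge sets represented by the rows of the row canonical form.\<close>

definition reduced_basis :: "arc set set list \<Rightarrow> arc set list \<Rightarrow> arc set set set" where
  "reduced_basis B es =
     (let R = gauss_jordan_single (cycle_matrix B es)
      in {{es ! j | j. j < length es \<and> R $$ (i, j) = 1} | i. i < length B})"

text \<open>
  The monomial \<open>m'\<close> arises from \<open>m\<close> by going from the type of \<open>m\<close> along a walk \<open>p\<close> to the first
  vertex \<open>s\<close> of the closed walk \<open>c\<close>, around \<open>c\<close>, and back along \<open>p\<close>. If \<open>c\<close> passes through the type
  of \<open>m\<close>, then \<open>c\<close> can be started there and \<open>p\<close> can be empty.
\<close>

definition produces :: "nat \<Rightarrow> unit mono \<Rightarrow> arc list \<Rightarrow> nat mono \<Rightarrow> nat mono \<Rightarrow> bool" where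
  "produces n s c m m' \<longleftrightarrow>
     (\<exists>p. walk n (type_of m) p s \<and> type_of m' = type_of m \<and>
          indets m' = permute_list (perm_of (p @ c @ rev (map rev_arc p))) (indets m))"

text \<open>
  The nontrivial cycles in the chosen cycle basis of \<open>C\<close> produce the property \<open>m \<equiv> m'\<close>. The row
  canonical form depends only on the order \<open>es\<close> of the columns, not on the initial basis \<open>B\<close>.
  Neither is fixed by the mathematics, so the property is required for all of them.
\<close>

definition basis_produces :: "nat \<Rightarrow> unit mono set \<Rightarrow> nat mono \<Rightarrow> nat mono \<Rightarrow> bool" where
  "basis_produces n C m m' \<longleftrightarrow>
     (\<forall>es B. distinct es \<and> set es = edges n C \<and> cycle_basis n C B \<longrightarrow>
        (\<exists>s c. cycle n C s c \<and> cycle_edges c \<in> reduced_basis B es \<and> nontrivial c) \<and>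
        (\<forall>s c. cycle n C s c \<and> cycle_edges c \<in> reduced_basis B es \<and> nontrivial c \<longrightarrow>
           (\<forall>m''. produces n s c m m'' \<longleftrightarrow> m'' = m')))"

end

theory Submission
  imports Defs "HOL-Library.Tree"
begin

text \<open>
  An indeterminate that is a top-level horizontal factor of a monomial never takes part in an
  interchange, so the class of \<open>s \<circ> x \<circ> t\<close> is the product of the classes of \<open>s\<close> and \<open>t\<close>. This gives
  recurrences for the numbers of classes, isolated types and all types in each degree, up to the mixed
  types, which have no indeterminate among their top-level factors in either direction. The classes of
  mixed types are found by search, and counting shows that none is missing. Exactly 3980 components
  of \<open>G(9)\<close> have fewer than 107 vertices and exactly four have 107, and the latter are the quarter
  turns of one another.

  The class of the given monomial in \<open>F(9)\<close> has 214 elements and contains the monomial with \<open>e\<close> and \<open>g\<close>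
  exchanged. Hence it is a connected twofold covering of the component, and every nontrivial closed
  walk exchanges the two sheets. Whether it does is a homomorphism to \<open>\<int>/2\<close> on the cycle space. As the
  covering is connected, this homomorphism is nonzero, hence nonzero on some row of the row canonical
  form, and such a row is a cycle.
\<close>

section \<open>Interchange on normal trees\<close>

text \<open>A component number is a position in a sorted list, hence a count of smaller components:
  3980 = 2 * 1787 + 406. Here 1787 = 8816 - 7029 is the number of classes of degree 9, not counting
  isolated types, that have an indeterminate among their top-level factors in one fixed direction,
  and 406 is the number of mixed classes with fewer than 107 types. The former have at most 38 types
  each, so the size 107 occurs only among mixed classes. The obstacle in the second half is that the
  row canonical form depends on the order of the edges, which is arbitrary, so no basis cycle can be
  written down. What holds for every order is that a nontrivial closed walk has only one place to
  lead to. The renaming that exchanges \<open>e\<close> and \<open>g\<close> commutes with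
  interchange and moves every monomial of the class, and 214 = 2 * 107 leaves room for exactly one
  pair above each type. Therefore the result depends neither on the cycle nor on the walk that joins
  it to the starting monomial.\<close>

lemma hcomp_assoc: "hcomp (hcomp s t) u = hcomp s (hcomp t u)"
  by (induction s t rule: hcomp.induct) auto
lemma vcomp_assoc: "vcomp (vcomp s t) u = vcomp s (vcomp t u)"
  by (induction s t rule: vcomp.induct) auto
lemma hcomp_not_H: "\<not> is_H s \<Longrightarrow> hcomp s t = H s t" by (cases s) auto
lemma vcomp_not_V: "\<not> is_V s \<Longrightarrow> vcomp s t = V s t" by (cases s) auto
lemma is_H_hcomp [simp]: "is_H (hcomp s t)" by (cases s) auto
lemma is_V_vcomp [simp]: "is_V (vcomp s t)" by (cases s) auto
lemma not_is_V_hcomp [simp]: "\<not> is_V (hcomp s t)" by (cases s) auto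
lemma not_is_H_vcomp [simp]: "\<not> is_H (vcomp s t)" by (cases s) auto
lemma hcomp_neq_vcomp [simp]: "hcomp s t \<noteq> vcomp u v" by (metis is_V_vcomp not_is_V_hcomp)
lemma vcomp_neq_hcomp [simp]: "vcomp u v \<noteq> hcomp s t" by (metis is_V_vcomp not_is_V_hcomp)
lemma normal_hcomp [simp]: "normal (hcomp s t) \<longleftrightarrow> normal s \<and> normal t"
  by (induction s t rule: hcomp.induct) auto
lemma normal_vcomp [simp]: "normal (vcomp s t) \<longleftrightarrow> normal s \<and> normal t"
  by (induction s t rule: vcomp.induct) auto
lemma indets_hcomp [simp]: "indets (hcomp s t) = indets s @ indets t"
  by (induction s t rule: hcomp.induct) auto
lemma indets_vcomp [simp]: "indets (vcomp s t) = indets s @ indets t"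
  by (induction s t rule: vcomp.induct) auto
lemma map_mono_hcomp: "map_mono f (hcomp s t) = hcomp (map_mono f s) (map_mono f t)"
  by (induction s t rule: hcomp.induct) auto
lemma map_mono_vcomp: "map_mono f (vcomp s t) = vcomp (map_mono f s) (map_mono f t)"
  by (induction s t rule: vcomp.induct) auto
lemma is_H_map_mono [simp]: "is_H (map_mono f s) = is_H s" by (cases s) auto
lemma is_V_map_mono [simp]: "is_V (map_mono f s) = is_V s" by (cases s) auto
lemma normal_map_mono [simp]: "normal (map_mono f s) = normal s" by (induction s) auto
lemma indets_map_mono: "indets (map_mono f s) = map f (indets s)" by (induction s) auto
lemma deg_simps [simp]: "deg (Ind x) = 1" "deg (H s t) = deg s + deg t" "deg (V s t) = deg s + deg t"
  "deg (hcomp s t) = deg s + deg t" "deg (vcomp s t) = deg s + deg t" "deg (map_mono f s) = deg s"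
  by (auto simp: deg_def indets_map_mono)
lemma deg_pos [simp]: "deg s > 0" by (induction s) auto

section \<open>Invariants and symmetries of the interchange relation\<close>

lemma interchange_normal: "interchange s t \<Longrightarrow> normal s \<and> normal t"
  by (induction rule: interchange.induct) auto
lemma interchange_mset: "interchange s t \<Longrightarrow> mset (indets s) = mset (indets t)"
  by (induction rule: interchange.induct) auto
lemma interchange_deg: "interchange s t \<Longrightarrow> deg s = deg t"
  by (metis interchange_mset deg_def size_mset)
lemma interchange_sym: "interchange s t \<Longrightarrow> interchange t s"
  by (induction rule: interchange.induct) (auto intro: interchange.intros)
lemma interchange_map: "interchange s t \<Longrightarrow> interchange (map_mono f s) (map_mono f t)"
  by (induction rule: interchange.induct)
    (auto simp: map_mono_hcomp map_mono_vcomp intro: interchange.intros)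

text \<open>Reflection of the realization in its main diagonal. It exchanges the roles of rows and
  columns; unlike the quarter turn it keeps the left-to-right order of the indeterminates and is an
  involution on all trees, normal or not.\<close>

primrec tr :: "'a mono \<Rightarrow> 'a mono" where
  "tr (Ind x) = Ind x"
| "tr (H s t) = V (tr s) (tr t)"
| "tr (V s t) = H (tr s) (tr t)"

lemma tr_tr [simp]: "tr (tr s) = s" by (induction s) auto
lemma tr_hcomp: "tr (hcomp s t) = vcomp (tr s) (tr t)"
  by (induction s t rule: hcomp.induct) auto
lemma tr_vcomp: "tr (vcomp s t) = hcomp (tr s) (tr t)"
  by (induction s t rule: vcomp.induct) auto
lemma is_H_tr [simp]: "is_H (tr s) = is_V s" by (cases s) auto
lemma is_V_tr [simp]: "is_V (tr s) = is_H s" by (cases s) auto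
lemma normal_tr [simp]: "normal (tr s) = normal s" by (induction s) auto
lemma deg_tr [simp]: "deg (tr s) = deg s" by (induction s) auto
lemma interchange_tr: "interchange s t \<Longrightarrow> interchange (tr s) (tr t)"
  by (induction rule: interchange.induct) (auto simp: tr_hcomp tr_vcomp intro: interchange.intros)
lemma rot_hcomp: "rot (hcomp s t) = vcomp (rot s) (rot t)"
  by (induction s t rule: hcomp.induct) (auto simp: vcomp_assoc)
lemma rot_vcomp: "rot (vcomp s t) = hcomp (rot t) (rot s)"
  by (induction s t rule: vcomp.induct) (auto simp: hcomp_assoc)
lemma normal_rot [simp]: "normal s \<Longrightarrow> normal (rot s)" by (induction s) auto
lemma deg_rot [simp]: "deg (rot s) = deg s" by (induction s) auto
lemma rot_map_mono: "rot (map_mono f s) = map_mono f (rot s)"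
  by (induction s) (auto simp: map_mono_hcomp map_mono_vcomp)
lemma mset_indets_rot: "mset (indets (rot s)) = mset (indets s)"
  by (induction s) auto
text \<open>\<open>rot\<close> builds its result with \<open>hcomp\<close> and \<open>vcomp\<close>,
  so four turns also parenthesize to the right; a normal tree is unaffected by this.\<close>

lemma rot4: "normal s \<Longrightarrow> rot (rot (rot (rot s))) = s"
  by (induction s) (auto simp: rot_hcomp rot_vcomp hcomp_not_H vcomp_not_V)
lemma interchange_rot: "interchange s t \<Longrightarrow> interchange (rot s) (rot t)"
  by (induction rule: interchange.induct) (auto simp: rot_hcomp rot_vcomp intro: interchange.intros)

section \<open>Enumeration of all single interchanges of a tree\<close>

fun hsplits :: "'a mono \<Rightarrow> ('a mono \<times> 'a mono) list" where
  "hsplits (H a b) = (a, b) # map (\<lambda>(c, d). (H a c, d)) (hsplits b)"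
| "hsplits _ = []"
fun vsplits :: "'a mono \<Rightarrow> ('a mono \<times> 'a mono) list" where
  "vsplits (V a b) = (a, b) # map (\<lambda>(c, d). (V a c, d)) (vsplits b)"
| "vsplits _ = []"

text \<open>All interchanges that use the whole of \<open>s\<close> as left half and the whole of
  \<open>t\<close> as right half of the square: \<open>s\<close> and \<open>t\<close> are cut
  horizontally in every possible way. The root may be a plain \<open>V\<close> because a value of
  \<open>hcomp\<close> is never a column.\<close>

definition hmerge :: "'a mono \<Rightarrow> 'a mono \<Rightarrow> 'a mono list" where
  "hmerge s t = concat (map (\<lambda>(w, x). map (\<lambda>(y, z). V (hcomp w y) (hcomp x z)) (vsplits t)) (vsplits s))"
definition vmerge :: "'a mono \<Rightarrow> 'a mono \<Rightarrow> 'a mono list" where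
  "vmerge s t = concat (map (\<lambda>(w, x). map (\<lambda>(y, z). H (vcomp w y) (vcomp x z)) (hsplits t)) (hsplits s))"
text \<open>Each half of a square is a vertical product, hence a single factor of a row. So only the
  first two factors of a row need to be tried here; later pairs are found by the recursive call of
  \<open>neighbours\<close>.\<close>

fun hmerge_first :: "'a mono \<Rightarrow> 'a mono \<Rightarrow> 'a mono list" where
  "hmerge_first s (H t u) = map (\<lambda>r. hcomp r u) (hmerge s t)"
| "hmerge_first s t = hmerge s t"
fun vmerge_first :: "'a mono \<Rightarrow> 'a mono \<Rightarrow> 'a mono list" where
  "vmerge_first s (V t u) = map (\<lambda>r. vcomp r u) (vmerge s t)"
| "vmerge_first s t = vmerge s t"

text \<open>A changed first factor can become a row itself, which \<open>hcomp\<close> must merge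
  with the rest. The unchanged first factor of a normal row is not a row, so a plain
  \<open>H\<close> suffices in the second part.\<close>

primrec neighbours :: "'a mono \<Rightarrow> 'a mono list" where
  "neighbours (Ind x) = []"
| "neighbours (H s t) =
     map (\<lambda>r. hcomp r t) (neighbours s) @ map (H s) (neighbours t) @ hmerge_first s t"
| "neighbours (V s t) =
     map (\<lambda>r. vcomp r t) (neighbours s) @ map (V s) (neighbours t) @ vmerge_first s t"

lemma vsplits_vcomp: "normal w \<Longrightarrow> (w, x) \<in> set (vsplits (vcomp w x))"
  by (induction w x rule: vcomp.induct) force+
lemma hsplits_hcomp: "normal w \<Longrightarrow> (w, x) \<in> set (hsplits (hcomp w x))"
  by (induction w x rule: hcomp.induct) force+
lemma in_vsplits:
  "normal s \<Longrightarrow> (w, x) \<in> set (vsplits s) \<Longrightarrow> s = vcomp w x \<and> normal w \<and> normal x"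
proof (induction s arbitrary: w)
  case (V a b)
  from V.prems(2) consider "w = a" "x = b" | c where "(c, x) \<in> set (vsplits b)" "w = V a c" by auto
  then show ?case
  proof cases
    case 1
    with V.prems(1) show ?thesis by (simp add: vcomp_not_V)
  next
    case 2
    have "b = vcomp c x \<and> normal c \<and> normal x" by (rule V.IH(2)) (use 2 V.prems(1) in simp_all)
    with 2 V.prems(1) show ?thesis by simp
  qed
next
  case (Ind y)
  from Ind.prems(2) show ?case by simp
next
  case (H a b)
  from H.prems(2) show ?case by simp
qed
lemma in_hsplits:
  "normal s \<Longrightarrow> (w, x) \<in> set (hsplits s) \<Longrightarrow> s = hcomp w x \<and> normal w \<and> normal x"
proof (induction s arbitrary: w)
  case (H a b)
  from H.prems(2) consider "w = a" "x = b" | c where "(c, x) \<in> set (hsplits b)" "w = H a c" by auto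
  then show ?case
  proof cases
    case 1
    with H.prems(1) show ?thesis by (simp add: hcomp_not_H)
  next
    case 2
    have "b = hcomp c x \<and> normal c \<and> normal x" by (rule H.IH(2)) (use 2 H.prems(1) in simp_all)
    with 2 H.prems(1) show ?thesis by simp
  qed
next
  case (Ind y)
  from Ind.prems(2) show ?case by simp
next
  case (V a b)
  from V.prems(2) show ?case by simp
qed
lemma in_hmergeI: "(w, x) \<in> set (vsplits s) \<Longrightarrow> (y, z) \<in> set (vsplits t) \<Longrightarrow>
   V (hcomp w y) (hcomp x z) \<in> set (hmerge s t)"
  unfolding hmerge_def by force
lemma in_vmergeI: "(w, x) \<in> set (hsplits s) \<Longrightarrow> (y, z) \<in> set (hsplits t) \<Longrightarrow>
   H (vcomp w y) (vcomp x z) \<in> set (vmerge s t)"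
  unfolding vmerge_def by force
lemma in_hmergeE:
  assumes "r \<in> set (hmerge s t)" 
  obtains w x y z where "(w, x) \<in> set (vsplits s)" "(y, z) \<in> set (vsplits t)" "r = V (hcomp w y) (hcomp x z)"
  using assms unfolding hmerge_def by auto
lemma in_vmergeE:
  assumes "r \<in> set (vmerge s t)" 
  obtains w x y z where "(w, x) \<in> set (hsplits s)" "(y, z) \<in> set (hsplits t)" "r = H (vcomp w y) (vcomp x z)"
  using assms unfolding vmerge_def by auto

lemma hmerge_interchange:
  "normal s \<Longrightarrow> normal t \<Longrightarrow> r \<in> set (hmerge s t) \<Longrightarrow> interchange (hcomp s t) r"
proof (erule in_hmergeE)
  fix w x y z assume n: "normal s" "normal t" and s: "(w, x) \<in> set (vsplits s)" "(y, z) \<in> set (vsplits t)"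
    and r: "r = V (hcomp w y) (hcomp x z)"
  have "interchange (hcomp (vcomp w x) (vcomp y z)) (vcomp (hcomp w y) (hcomp x z))"
    using n s by (intro interchange.hv) (auto dest: in_vsplits)
  then show ?thesis using in_vsplits[OF n(1) s(1)] in_vsplits[OF n(2) s(2)] r by (simp add: vcomp_not_V)
qed
lemma vmerge_interchange:
  "normal s \<Longrightarrow> normal t \<Longrightarrow> r \<in> set (vmerge s t) \<Longrightarrow> interchange (vcomp s t) r"
proof (erule in_vmergeE)
  fix w x y z assume n: "normal s" "normal t" and s: "(w, x) \<in> set (hsplits s)" "(y, z) \<in> set (hsplits t)"
    and r: "r = H (vcomp w y) (vcomp x z)"
  have "interchange (vcomp (hcomp w x) (hcomp y z)) (hcomp (vcomp w y) (vcomp x z))"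
    using n s by (intro interchange.vh) (auto dest: in_hsplits)
  then show ?thesis using in_hsplits[OF n(1) s(1)] in_hsplits[OF n(2) s(2)] r by (simp add: hcomp_not_H)
qed

lemma neighbours_interchange: "normal s \<Longrightarrow> t \<in> set (neighbours s) \<Longrightarrow> interchange s t"
proof (induction s arbitrary: t)
  case (H a b)
  then have n: "\<not> is_H a" "normal a" "normal b" by auto
  from H.prems(2) consider (l) r where "r \<in> set (neighbours a)" "t = hcomp r b"
    | (r) r where "r \<in> set (neighbours b)" "t = H a r" | (m) "t \<in> set (hmerge_first a b)" by auto
  then show ?case
  proof cases
    case l then show ?thesis using H.IH(1)[of r] n interchange.h_left[of a r b] by (simp add: hcomp_not_H)
  next
    case r then show ?thesis using H.IH(2)[of r] n interchange.h_right[of a b r] by (simp add: hcomp_not_H)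
  next
    case m
    show ?thesis
    proof (cases b)
      case (H c d)
      then obtain r where r: "r \<in> set (hmerge a c)" "t = hcomp r d" using m by auto
      then have "interchange (hcomp a c) r" using n H by (auto intro: hmerge_interchange)
      then have "interchange (hcomp (hcomp a c) d) t" using n H r by (auto intro: interchange.h_left)
      then show ?thesis using n H by (simp add: hcomp_assoc hcomp_not_H)
    qed (use m n hmerge_interchange[of a b t] in \<open>auto simp: hcomp_not_H\<close>)
  qed
next
  case (V a b)
  then have n: "\<not> is_V a" "normal a" "normal b" by auto
  from V.prems(2) consider (l) r where "r \<in> set (neighbours a)" "t = vcomp r b"
    | (r) r where "r \<in> set (neighbours b)" "t = V a r" | (m) "t \<in> set (vmerge_first a b)" by auto
  then show ?case
  proof cases
    case l then show ?thesis using V.IH(1)[of r] n interchange.v_left[of a r b] by (simp add: vcomp_not_V)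
  next
    case r then show ?thesis using V.IH(2)[of r] n interchange.v_right[of a b r] by (simp add: vcomp_not_V)
  next
    case m
    show ?thesis
    proof (cases b)
      case (V c d)
      then obtain r where r: "r \<in> set (vmerge a c)" "t = vcomp r d" using m by auto
      then have "interchange (vcomp a c) r" using n V by (auto intro: vmerge_interchange)
      then have "interchange (vcomp (vcomp a c) d) t" using n V r by (auto intro: interchange.v_left)
      then show ?thesis using n V by (simp add: vcomp_assoc vcomp_not_V)
    qed (use m n vmerge_interchange[of a b t] in \<open>auto simp: vcomp_not_V\<close>)
  qed
qed auto

lemma hmerge_first_hcomp:
  "r \<in> set (hmerge_first s t) \<Longrightarrow> hcomp r u \<in> set (hmerge_first s (hcomp t u))"
  by (cases t) (auto simp: hcomp_assoc)
lemma vmerge_first_vcomp: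
  "r \<in> set (vmerge_first s t) \<Longrightarrow> vcomp r u \<in> set (vmerge_first s (vcomp t u))"
  by (cases t) (auto simp: vcomp_assoc)

lemma neighbours_hcomp_right:
  "t' \<in> set (neighbours t) \<Longrightarrow> hcomp s t' \<in> set (neighbours (hcomp s t))"
  by (induction s t rule: hcomp.induct) auto
lemma neighbours_vcomp_right:
  "t' \<in> set (neighbours t) \<Longrightarrow> vcomp s t' \<in> set (neighbours (vcomp s t))"
  by (induction s t rule: vcomp.induct) auto
lemma neighbours_hcomp_left:
  "s' \<in> set (neighbours s) \<Longrightarrow> hcomp s' t \<in> set (neighbours (hcomp s t))"
proof (induction s arbitrary: s')
  case (H a b)
  then consider (l) r where "r \<in> set (neighbours a)" "s' = hcomp r b"
    | (r) r where "r \<in> set (neighbours b)" "s' = H a r" | (m) "s' \<in> set (hmerge_first a b)" by auto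
  then show ?case
  proof cases
    case m then show ?thesis by (auto dest: hmerge_first_hcomp)
  qed (use H.IH in \<open>auto simp: hcomp_assoc\<close>)
qed auto
lemma neighbours_vcomp_left:
  "s' \<in> set (neighbours s) \<Longrightarrow> vcomp s' t \<in> set (neighbours (vcomp s t))"
proof (induction s arbitrary: s')
  case (V a b)
  then consider (l) r where "r \<in> set (neighbours a)" "s' = vcomp r b"
    | (r) r where "r \<in> set (neighbours b)" "s' = V a r" | (m) "s' \<in> set (vmerge_first a b)" by auto
  then show ?case
  proof cases
    case m then show ?thesis by (auto dest: vmerge_first_vcomp)
  qed (use V.IH in \<open>auto simp: vcomp_assoc\<close>)
qed auto

lemma hmerge_first_not_H: "\<not> is_H t \<Longrightarrow> hmerge_first s t = hmerge s t" by (cases t) auto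
lemma vmerge_first_not_V: "\<not> is_V t \<Longrightarrow> vmerge_first s t = vmerge s t" by (cases t) auto

text \<open>The rules of \<open>interchange\<close> cut a row at an arbitrary place, whereas
  \<open>neighbours\<close> recurses on first factor and rest. Stability of
  \<open>neighbours\<close> under composition on either side bridges the two views.\<close>

lemma interchange_neighbours: "interchange s t \<Longrightarrow> t \<in> set (neighbours s)"
proof (induction rule: interchange.induct)
  case (hv w x y z)
  then show ?case
    using in_hmergeI[OF vsplits_vcomp[of w x] vsplits_vcomp[of y z]]
    by (auto simp: hcomp_not_H vcomp_not_V hmerge_first_not_H)
next
  case (vh w x y z)
  then show ?case
    using in_vmergeI[OF hsplits_hcomp[of w y] hsplits_hcomp[of x z]]
    by (auto simp: hcomp_not_H vcomp_not_V vmerge_first_not_V)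
qed (auto intro: neighbours_hcomp_left neighbours_hcomp_right neighbours_vcomp_left neighbours_vcomp_right)

lemma neighbours_iff: "normal s \<Longrightarrow> t \<in> set (neighbours s) \<longleftrightarrow> interchange s t"
  using neighbours_interchange interchange_neighbours by blast

lemma deg_neq_0 [simp]: "deg s \<noteq> 0" using deg_pos by (metis less_irrefl)

section \<open>Equivalence classes\<close>

definition reach :: "'a mono \<Rightarrow> 'a mono set" where
  "reach t = {u. interchange\<^sup>*\<^sup>* t u}"

lemma reach_refl [simp]: "t \<in> reach t" by (simp add: reach_def)
lemma interchange_rtrancl_sym: "interchange\<^sup>*\<^sup>* s t \<Longrightarrow> interchange\<^sup>*\<^sup>* t s"
  by (rule sympD[OF symp_rtranclp]) (auto intro: sympI interchange_sym)
lemma reach_eq_iff: "reach s = reach t \<longleftrightarrow> t \<in> reach s"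
  unfolding reach_def using interchange_rtrancl_sym by (auto intro: rtranclp_trans)
lemma reach_eq: "u \<in> reach s \<Longrightarrow> reach u = reach s"
  using reach_eq_iff by metis
lemma interchange_invariant:
  assumes "u \<in> reach t" "\<And>s s'. interchange s s' \<Longrightarrow> f s = f s'"
  shows "f u = f t"
proof -
  have "interchange\<^sup>*\<^sup>* t u" using assms(1) by (simp add: reach_def)
  then show ?thesis by (induction rule: rtranclp_induct) (auto dest: assms(2))
qed
lemma reach_map:
  assumes "u \<in> reach t" "\<And>s s'. interchange s s' \<Longrightarrow> interchange (f s) (f s')"
  shows "f u \<in> reach (f t)"
proof -
  have "interchange\<^sup>*\<^sup>* t u" using assms(1) by (simp add: reach_def)
  then have "interchange\<^sup>*\<^sup>* (f t) (f u)"
    by (induction rule: rtranclp_induct) (auto intro: rtranclp.rtrancl_into_rtrancl assms(2))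
  then show ?thesis by (simp add: reach_def)
qed
lemma reach_normal: "u \<in> reach t \<Longrightarrow> normal u \<longleftrightarrow> normal t"
  by (rule interchange_invariant[where f = normal]) (auto dest: interchange_normal)
lemma reach_deg: "u \<in> reach t \<Longrightarrow> deg u = deg t"
  by (rule interchange_invariant) (auto dest: interchange_deg)
lemma reach_mset: "u \<in> reach t \<Longrightarrow> mset (indets u) = mset (indets t)"
  by (rule interchange_invariant) (auto dest: interchange_mset)
text \<open>Inverses are asked for on normal trees only, since this is where four quarter turns give
  the identity.\<close>

lemma reach_image:
  assumes "\<And>s s'. interchange s s' \<Longrightarrow> interchange (f s) (f s')"
    and "\<And>s s'. interchange s s' \<Longrightarrow> interchange (g s) (g s')"
    and "\<And>s. normal s \<Longrightarrow> f (g s) = s" "\<And>s. normal s \<Longrightarrow> g (f s) = s" "normal t" 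
    and nf: "\<And>s. normal s \<Longrightarrow> normal (f s)"
  shows "reach (f t) = f ` reach t"
proof -
  have 1: "f u \<in> reach (f t)" if "u \<in> reach t" for u t
    using that assms(1) by (rule reach_map)
  have 2: "g u \<in> reach (g t)" if "u \<in> reach t" for u t
    using that assms(2) by (rule reach_map)
  have "u \<in> f ` reach t" if "u \<in> reach (f t)" for u
    using 2[OF that] assms(3)[of u] assms(4)[of t] reach_normal[OF that] nf \<open>normal t\<close> by force
  then show ?thesis using 1 by auto
qed

lemma reach_tr: "reach (tr t) = tr ` reach t"
proof -
  have 1: "tr u \<in> reach (tr t)" if "u \<in> reach t" for u and t :: "'a mono"
    using that interchange_tr by (rule reach_map)
  show ?thesis
  proof (intro equalityI subsetI)
    fix u assume "u \<in> reach (tr t)"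
    then have "tr u \<in> reach t" using 1[of u "tr t"] by simp
    then show "u \<in> tr ` reach t" by (metis image_eqI tr_tr)
  qed (use 1 in blast)
qed
lemma reach_rot:
  assumes "normal t"
  shows "reach (rot t) = rot ` reach t"
  by (rule reach_image[where g = "rot \<circ> rot \<circ> rot"]) (auto simp: rot4 assms interchange_rot)

lemma finite_assoc_types: "finite (assoc_types n)"
proof -
  \<comment> \<open>With a bound on the degree instead of a fixed degree, the induction hypothesis
    covers both factors of a product.\<close>
  have fin: "finite {t :: unit mono. deg t \<le> n}" for n
  proof (induction n)
    case 0
    then show ?case by simp
  next
    case (Suc n)
    let ?D = "{t :: unit mono. deg t \<le> n}"
    have "t \<in> insert (Ind ()) (case_prod H ` (?D \<times> ?D) \<union> case_prod V ` (?D \<times> ?D))"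
      if "deg t \<le> Suc n" for t
    proof (cases t)
      case (H a b)
      then show ?thesis using that deg_pos[of a] deg_pos[of b] by (auto simp del: deg_pos)
    next
      case (V a b)
      then show ?thesis using that deg_pos[of a] deg_pos[of b] by (auto simp del: deg_pos)
    qed simp
    then have "{t :: unit mono. deg t \<le> Suc n} \<subseteq>
        insert (Ind ()) (case_prod H ` (?D \<times> ?D) \<union> case_prod V ` (?D \<times> ?D))" by blast
    then show ?case using Suc by (auto intro: finite_subset)
  qed
  show ?thesis by (rule finite_subset[OF _ fin[of n]]) (auto simp: assoc_types_def)
qed

lemma reach_subset_assoc_types: "t \<in> assoc_types n \<Longrightarrow> reach t \<subseteq> assoc_types n"
  using reach_normal reach_deg by (auto simp: assoc_types_def)

section \<open>Products around an indeterminate\<close>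

text \<open>On normal trees: no factor of the horizontal factorization is an indeterminate.\<close>
primrec solid :: "'a mono \<Rightarrow> bool" where
  "solid (Ind x) = False"
| "solid (H s t) = (solid s \<and> solid t)"
| "solid (V s t) = True"

lemma solid_hcomp [simp]: "solid (hcomp s t) = (solid s \<and> solid t)"
  by (induction s t rule: hcomp.induct) auto
lemma solid_vcomp [simp]: "solid (vcomp s t)"
  by (induction s t rule: vcomp.induct) auto
lemma solid_interchange: "interchange s t \<Longrightarrow> solid s = solid t"
  by (induction rule: interchange.induct) auto
lemma solid_reach: "u \<in> reach t \<Longrightarrow> solid u = solid t"
  by (rule interchange_invariant) (auto dest: solid_interchange)

text \<open>\<open>None\<close> is the empty product, so \<open>glue s t\<close> is the product of \<open>s\<close>, an indeterminate and \<open>t\<close>.\<close>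

definition hprepend :: "'a mono option \<Rightarrow> 'a mono \<Rightarrow> 'a mono" where
  "hprepend s t = (case s of None \<Rightarrow> t | Some s \<Rightarrow> hcomp s t)"
definition glue_tail :: "unit mono option \<Rightarrow> unit mono" where
  "glue_tail t = (case t of None \<Rightarrow> Ind () | Some t \<Rightarrow> H (Ind ()) t)"
definition glue :: "unit mono option \<Rightarrow> unit mono option \<Rightarrow> unit mono" where
  "glue s t = hprepend s (glue_tail t)"

lemma glue_tail_inject: "glue_tail s = glue_tail t \<longleftrightarrow> s = t"
  by (auto simp: glue_tail_def split: option.splits)

definition solid_opt :: "'a mono option \<Rightarrow> bool" where
  "solid_opt s = (case s of None \<Rightarrow> True | Some s \<Rightarrow> solid s)"
definition normal_opt :: "'a mono option \<Rightarrow> bool" where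
  "normal_opt s = (case s of None \<Rightarrow> True | Some s \<Rightarrow> normal s)"
definition deg_opt :: "'a mono option \<Rightarrow> nat" where
  "deg_opt s = (case s of None \<Rightarrow> 0 | Some s \<Rightarrow> deg s)"
definition neighbours_opt :: "'a mono option \<Rightarrow> 'a mono option set" where
  "neighbours_opt s = (case s of None \<Rightarrow> {} | Some s \<Rightarrow> Some ` set (neighbours s))"
definition reach_opt :: "'a mono option \<Rightarrow> 'a mono option set" where
  "reach_opt s = (case s of None \<Rightarrow> {None} | Some s \<Rightarrow> Some ` reach s)"
lemmas opt_defs = solid_opt_def normal_opt_def deg_opt_def neighbours_opt_def reach_opt_def

lemma glue_normal: "normal (glue s t) \<longleftrightarrow> normal_opt s \<and> normal_opt t"
  by (auto simp: glue_def hprepend_def glue_tail_def opt_defs split: option.splits)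
lemma glue_deg: "deg (glue s t) = Suc (deg_opt s + deg_opt t)"
  by (auto simp: glue_def hprepend_def glue_tail_def opt_defs split: option.splits)
lemma glue_not_solid: "\<not> solid (glue s t)"
  by (auto simp: glue_def hprepend_def glue_tail_def opt_defs split: option.splits)

text \<open>The leftmost factor decides: it is an indeterminate on the right-hand side and a column
  on the left.\<close>

lemma solid_hcomp_tail_neq: "solid s \<Longrightarrow> hcomp s r \<noteq> glue_tail t"
  by (induction s r rule: hcomp.induct) (auto simp: glue_tail_def split: option.splits)
lemma hcomp_glue_tail_inject:
  "solid s \<Longrightarrow> solid s' \<Longrightarrow> normal s \<Longrightarrow> normal s' \<Longrightarrow> hcomp s (glue_tail t) = hcomp s' (glue_tail t') \<Longrightarrow> s = s' \<and> t = t'"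
proof (induction s arbitrary: s')
  case (H a b)
  show ?case
  proof (cases s')
    case (H a' b')
    then show ?thesis using H.prems H.IH(2)[of b'] by simp
  next
    case (V a' b')
    then show ?thesis using H.prems solid_hcomp_tail_neq[of b "glue_tail t" t'] by auto
  qed (use H.prems in auto)
next
  case (V a b)
  show ?case
  proof (cases s')
    case (H a' b')
    then show ?thesis using V.prems solid_hcomp_tail_neq[of b' "glue_tail t'" t] by (metis hcomp.simps(1,3) mono.inject(2) solid.simps(2))
  next
    case (V a' b')
    then show ?thesis using V.prems by (simp add: glue_tail_inject)
  qed (use V.prems in auto)
qed auto
text \<open>The marked indeterminate is the first one among the top-level factors because
  \<open>s\<close> is solid, so \<open>s\<close> and \<open>t\<close> can be read off the
  product.\<close>

lemma glue_inject:
  assumes "solid_opt s" "solid_opt s'" "normal_opt s" "normal_opt s'" "glue s t = glue s' t'"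
  shows "s = s' \<and> t = t'"
  using assms hcomp_glue_tail_inject solid_hcomp_tail_neq[of "the s" "glue_tail t" t']
    solid_hcomp_tail_neq[of "the s'" "glue_tail t'" t]
  by (auto simp: glue_def hprepend_def glue_tail_inject opt_defs split: option.splits)

lemma glue_surj:
  "normal u \<Longrightarrow> \<not> solid u \<Longrightarrow> \<exists>s t. solid_opt s \<and> normal_opt s \<and> normal_opt t \<and> u = glue s t"
proof (induction u)
  case (Ind x)
  have "Ind x = glue None None" by (simp add: glue_def hprepend_def glue_tail_def)
  then show ?case by (metis normal_opt_def option.simps(4) solid_opt_def)
next
  case (H a b)
  show ?case
  proof (cases a)
    case (Ind x)
    then have "H a b = glue None (Some b)" by (simp add: glue_def hprepend_def glue_tail_def)
    moreover have "solid_opt (None :: unit mono option)" "normal_opt (None :: unit mono option)" "normal_opt (Some b)"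
      using H.prems by (auto simp: opt_defs)
    ultimately show ?thesis by blast
  next
    case (V a1 a2)
    then obtain s t where st: "solid_opt s" "normal_opt s" "normal_opt t" "b = glue s t" using H by auto
    have "H a b = glue (Some (case s of None \<Rightarrow> a | Some s \<Rightarrow> H a s)) t"
      using st V by (auto simp: glue_def hprepend_def split: option.splits)
    moreover have "solid_opt (Some (case s of None \<Rightarrow> a | Some s \<Rightarrow> H a s))"
      "normal_opt (Some (case s of None \<Rightarrow> a | Some s \<Rightarrow> H a s))"
      using st V H.prems(1) by (auto simp: opt_defs split: option.splits)
    ultimately show ?thesis using st(3) by blast
  qed (use H in auto)
qed auto

text \<open>An indeterminate is not a vertical product, so it cannot be half of a square.\<close>

lemma hmerge_tail: "\<And>t. hmerge_first s (glue_tail t) = []"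
  by (auto simp: glue_tail_def hmerge_def split: option.splits)

lemma neighbours_glue_tail: "set (neighbours (glue_tail t)) = glue_tail ` neighbours_opt t"
proof (cases t)
  case (Some u)
  have "hmerge_first (Ind ()) u = []" by (cases u) (auto simp: hmerge_def)
  then show ?thesis using Some by (auto simp: glue_tail_def opt_defs image_image)
qed (simp add: glue_tail_def opt_defs)

lemma hmerge_first_hcomp_tail:
  "hmerge_first a (hcomp b (glue_tail t)) = map (\<lambda>r. hcomp r (glue_tail t)) (hmerge_first a b)"
proof (cases b)
  case (Ind x) then show ?thesis by (simp add: hmerge_def)
next
  case (H b1 b2) then show ?thesis by (simp add: hcomp_assoc)
qed simp

lemma neighbours_hcomp_tail:
  "set (neighbours (hcomp s (glue_tail t))) =
     (\<lambda>s'. hcomp s' (glue_tail t)) ` set (neighbours s) \<union> (\<lambda>t'. hcomp s (glue_tail t')) ` neighbours_opt t"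
proof (induction s)
  case (H a b)
  then show ?case by (auto simp: hmerge_first_hcomp_tail image_Un image_image hcomp_assoc)
next
  case (V a b)
  show ?case by (simp del: neighbours.simps(3) add: hmerge_tail neighbours_glue_tail image_image)
qed (auto simp: hmerge_tail neighbours_glue_tail image_image)

text \<open>Every single step happens on one side of the marked indeterminate. Iterating this gives
  the product structure of classes in \<open>reach_glue\<close>.\<close>

lemma neighbours_glue:
  "set (neighbours (glue s t)) = (\<lambda>s'. glue s' t) ` neighbours_opt s \<union> glue s ` neighbours_opt t"
  by (cases s) (auto simp: glue_def hprepend_def neighbours_hcomp_tail neighbours_glue_tail opt_defs image_image)

lemma neighbours_opt_reach:
  assumes "s' \<in> reach_opt s" "s'' \<in> neighbours_opt s'" "normal_opt s"
  shows "s'' \<in> reach_opt s"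
proof (cases s)
  case (Some a)
  then obtain b where b: "s' = Some b" "b \<in> reach a" using assms(1) by (auto simp: opt_defs)
  then obtain c where c: "s'' = Some c" "c \<in> set (neighbours b)" using assms(2) by (auto simp: opt_defs)
  have "interchange b c" using c neighbours_iff reach_normal[OF b(2)] assms(3) Some by (auto simp: opt_defs)
  then have "c \<in> reach a" using b(2) unfolding reach_def by (simp add: rtranclp.rtrancl_into_rtrancl)
  then show ?thesis using Some c by (simp add: opt_defs)
qed (use assms in \<open>auto simp: opt_defs\<close>)
lemma reach_opt_refl [simp]: "s \<in> reach_opt s" by (auto simp: opt_defs split: option.splits)
lemma reach_opt_normal: "s' \<in> reach_opt s \<Longrightarrow> normal_opt s' = normal_opt s"
  using reach_normal by (auto simp: opt_defs split: option.splits)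

lemma reach_glue:
  assumes "normal_opt s" "normal_opt t"
  shows "reach (glue s t) = case_prod glue ` (reach_opt s \<times> reach_opt t)"
proof (intro equalityI subsetI)
  fix u assume "u \<in> reach (glue s t)"
  then have "interchange\<^sup>*\<^sup>* (glue s t) u" by (simp add: reach_def)
  then show "u \<in> case_prod glue ` (reach_opt s \<times> reach_opt t)"
  proof (induction rule: rtranclp_induct)
    case base
    have "(s, t) \<in> reach_opt s \<times> reach_opt t" by simp
    then show ?case by (metis case_prod_conv image_eqI)
  next
    case (step u v)
    then obtain s' t' where u: "u = glue s' t'" "s' \<in> reach_opt s" "t' \<in> reach_opt t" by auto
    have "v \<in> set (neighbours u)" using step interchange_neighbours by auto
    then obtain s'' t'' where v: "v = glue s'' t''" "s'' \<in> neighbours_opt s' \<and> t'' = t' \<or> s'' = s' \<and> t'' \<in> neighbours_opt t'"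
      unfolding u neighbours_glue by auto
    then have "s'' \<in> reach_opt s" "t'' \<in> reach_opt t"
      using u neighbours_opt_reach assms by auto
    then show ?case using v by force
  qed
next
  fix u assume "u \<in> case_prod glue ` (reach_opt s \<times> reach_opt t)"
  then obtain s' t' where u: "u = glue s' t'" "s' \<in> reach_opt s" "t' \<in> reach_opt t" by auto
  have left: "interchange (glue a t) (glue b t)" if "b \<in> neighbours_opt a" "normal_opt a" "normal_opt t" for a b t
    using that neighbours_iff[of "glue a t" "glue b t"] by (auto simp: glue_normal neighbours_glue)
  have right: "interchange (glue a t) (glue a u)" if "u \<in> neighbours_opt t" "normal_opt a" "normal_opt t" for a t u
    using that neighbours_iff[of "glue a t" "glue a u"] by (auto simp: glue_normal neighbours_glue)
  have L: "glue s' t \<in> reach (glue s t)"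
  proof (cases s)
    case None
    then show ?thesis using u by (simp add: opt_defs)
  next
    case (Some a)
    then obtain b where b: "s' = Some b" "interchange\<^sup>*\<^sup>* a b" using u by (auto simp: opt_defs reach_def)
    from b(2) have "glue (Some b) t \<in> reach (glue s t)"
    proof (induction rule: rtranclp_induct)
      case (step c d)
      then have "interchange (glue (Some c) t) (glue (Some d) t)"
        using left[of "Some d" "Some c" t] assms interchange_neighbours[of c d] interchange_normal[of c d]
        by (auto simp: opt_defs)
      then show ?case using step by (auto simp: reach_def)
    qed (use Some in auto)
    then show ?thesis using b by simp
  qed
  have s': "normal_opt s'" using u assms reach_opt_normal by metis
  have R: "glue s' t' \<in> reach (glue s' t)"
  proof (cases t)
    case None
    then show ?thesis using u by (simp add: opt_defs)
  next
    case (Some a)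
    then obtain b where b: "t' = Some b" "interchange\<^sup>*\<^sup>* a b" using u by (auto simp: opt_defs reach_def)
    from b(2) have "glue s' (Some b) \<in> reach (glue s' t)"
    proof (induction rule: rtranclp_induct)
      case (step c d)
      then have "interchange (glue s' (Some c)) (glue s' (Some d))"
        using right[of "Some d" "Some c" s'] s' interchange_neighbours[of c d] interchange_normal[of c d]
        by (auto simp: opt_defs)
      then show ?case using step by (auto simp: reach_def)
    qed (use Some in auto)
    then show ?thesis using b by simp
  qed
  show "u \<in> reach (glue s t)" using L R reach_eq u by metis
qed

section \<open>Counting classes\<close>

text \<open>Both images are projections of the set of pairs \<open>(f x, g x)\<close>, and both
  projections are injective there.\<close>

lemma card_image_eq_card_image:
  assumes "\<And>x y. x \<in> X \<Longrightarrow> y \<in> X \<Longrightarrow> f x = f y \<longleftrightarrow> g x = g y"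
  shows "card (f ` X) = card (g ` X)"
proof -
  let ?h = "\<lambda>x. (f x, g x)"
  have "card (fst ` ?h ` X) = card (?h ` X)" by (rule card_image) (auto simp: inj_on_def assms)
  moreover have "card (snd ` ?h ` X) = card (?h ` X)"
    by (rule card_image) (auto simp: inj_on_def assms)
  ultimately show ?thesis by (simp add: image_image)
qed

lemma card_image_Un:
  assumes "finite X" "finite Y" "\<And>x y. x \<in> X \<Longrightarrow> y \<in> Y \<Longrightarrow> f x \<noteq> f y"
  shows "card (f ` (X \<union> Y)) = card (f ` X) + card (f ` Y)"
proof -
  have "f ` X \<inter> f ` Y = {}" using assms(3) by blast
  then show ?thesis using assms(1,2) by (simp add: image_Un card_Un_disjoint)
qed

text \<open>One recurrence for three counts: \<open>P\<close> selects the types and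
  \<open>\<kappa>\<close> is what is counted. The instances are classes (\<open>reach\<close>, no
  restriction), isolated types (identity, no neighbours) and all types (identity, no restriction).
  Each is compatible with products around an indeterminate and with transposition.\<close>

locale class_count =
  fixes \<kappa> :: "unit mono \<Rightarrow> 'k" and P :: "unit mono \<Rightarrow> bool"
  assumes \<kappa>_glue: "\<And>s t s' t'. solid_opt s \<Longrightarrow> solid_opt s' \<Longrightarrow> normal_opt s \<Longrightarrow> normal_opt s' \<Longrightarrow>
      normal_opt t \<Longrightarrow> normal_opt t' \<Longrightarrow>
      \<kappa> (glue s t) = \<kappa> (glue s' t') \<longleftrightarrow> map_option \<kappa> s = map_option \<kappa> s' \<and> map_option \<kappa> t = map_option \<kappa> t'"
    and P_glue: "\<And>s t. P (glue s t) \<longleftrightarrow> pred_option P s \<and> pred_option P t"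
    and \<kappa>_tr: "\<And>s t. \<kappa> (tr s) = \<kappa> (tr t) \<longleftrightarrow> \<kappa> s = \<kappa> t"
    and P_tr: "\<And>t. P (tr t) = P t"
    and \<kappa>_solid: "\<And>s t. \<kappa> s = \<kappa> t \<Longrightarrow> solid s = solid t"
    and \<kappa>_deg: "\<And>s t. \<kappa> s = \<kappa> t \<Longrightarrow> deg s = deg t"
begin

text \<open>Degree 0 contains just the empty product, so the counts start with 1 and the recurrences
  need no boundary terms.\<close>

definition all_opt :: "nat \<Rightarrow> unit mono option set" where
  "all_opt n = {s. normal_opt s \<and> deg_opt s = n \<and> pred_option P s}"
definition all_count :: "nat \<Rightarrow> nat" where
  "all_count n = card (map_option \<kappa> ` all_opt n)"
definition solid_count :: "nat \<Rightarrow> nat" where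
  "solid_count n = card (map_option \<kappa> ` {s \<in> all_opt n. solid_opt s})"
definition nonsolid_count :: "nat \<Rightarrow> nat" where
  "nonsolid_count n = card (\<kappa> ` {t \<in> assoc_types n. P t \<and> \<not> solid t})"
definition mixed_count :: "nat \<Rightarrow> nat" where
  "mixed_count n = card (\<kappa> ` {t \<in> assoc_types n. P t \<and> solid t \<and> solid (tr t)})"

lemma all_opt_0: "all_opt 0 = {None}"
  by (auto simp: all_opt_def opt_defs split: option.splits)
lemma all_opt_Some: "n > 0 \<Longrightarrow> all_opt n = Some ` {t \<in> assoc_types n. P t}"
  by (auto simp: all_opt_def opt_defs assoc_types_def image_iff split: option.splits)

lemma finite_all_opt: "finite (all_opt n)"
  using finite_assoc_types[of n] by (cases "n = 0") (auto simp: all_opt_0 all_opt_Some)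

lemma counts_0: "all_count 0 = 1" "solid_count 0 = 1"
proof -
  have "{s \<in> all_opt 0. solid_opt s} = {None}" by (auto simp: all_opt_0 opt_defs)
  then show "all_count 0 = 1" "solid_count 0 = 1"
    by (simp_all add: all_count_def solid_count_def all_opt_0)
qed

lemma deg_opt_eqI:
  assumes "map_option f a = map_option f b" and deg: "\<And>s t. f s = f t \<Longrightarrow> deg s = deg t"
  shows "deg_opt a = deg_opt b"
proof (cases a)
  case None
  with assms(1) have "b = None" by simp
  with None show ?thesis by simp
next
  case (Some u)
  show ?thesis
  proof (cases b)
    case None
    with Some assms(1) show ?thesis by simp
  next
    case (Some v)
    with \<open>a = Some u\<close> assms(1) have "f u = f v" by simp
    from deg[OF this] show ?thesis by (simp only: \<open>a = Some u\<close> Some deg_opt_def option.case)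
  qed
qed

lemma all_count_pos: "n > 0 \<Longrightarrow> all_count n = card (\<kappa> ` {t \<in> assoc_types n. P t})"
proof -
  assume "n > 0"
  then have "map_option \<kappa> ` all_opt n = Some ` \<kappa> ` {t \<in> assoc_types n. P t}"
    by (simp add: image_image all_opt_Some)
  then show ?thesis unfolding all_count_def by (simp add: card_image)
qed

lemma solid_count_pos: "n > 0 \<Longrightarrow> solid_count n = card (\<kappa> ` {t \<in> assoc_types n. P t \<and> solid t})"
proof -
  assume "n > 0"
  then have "{s \<in> all_opt n. solid_opt s} = Some ` {t \<in> assoc_types n. P t \<and> solid t}"
    by (auto simp: all_opt_Some opt_defs)
  then have "map_option \<kappa> ` {s \<in> all_opt n. solid_opt s} = Some ` \<kappa> ` {t \<in> assoc_types n. P t \<and> solid t}"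
    by (simp add: image_image)
  then show ?thesis unfolding solid_count_def by (simp add: card_image)
qed

text \<open>The type is cut at its first top-level indeterminate. That indeterminate has degree 1,
  so a solid part of degree \<open>i\<close> leaves \<open>n - 1 - i\<close> for the rest.\<close>

lemma nonsolid_eq:
  "{t \<in> assoc_types n. P t \<and> \<not> solid t} =
     (\<Union>i<n. case_prod glue ` ({s \<in> all_opt i. solid_opt s} \<times> all_opt (n - 1 - i)))" (is "?L = ?R")
proof (intro equalityI subsetI)
  fix u assume u: "u \<in> ?L"
  then obtain s t where st: "solid_opt s" "normal_opt s" "normal_opt t" "u = glue s t"
    using glue_surj[of u] by (auto simp: assoc_types_def)
  with u have "n = Suc (deg_opt s + deg_opt t)" by (simp add: assoc_types_def glue_deg)
  moreover have "s \<in> all_opt (deg_opt s)" "t \<in> all_opt (deg_opt t)"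
    using st u by (auto simp: all_opt_def P_glue)
  ultimately show "u \<in> ?R" using st by (auto intro!: bexI[of _ "deg_opt s"])
next
  fix u assume "u \<in> ?R"
  then show "u \<in> ?L"
    by (auto simp: assoc_types_def glue_deg glue_normal glue_not_solid all_opt_def P_glue)
qed

lemma nonsolid_count_rec:
  "nonsolid_count n = (\<Sum>i<n. solid_count i * all_count (n - 1 - i))"
proof -
  let ?X = "\<lambda>i. {s \<in> all_opt i. solid_opt s} \<times> all_opt (n - 1 - i)"
  have *: "\<kappa> (case_prod glue x) = \<kappa> (case_prod glue y) \<longleftrightarrow>
      map_prod (map_option \<kappa>) (map_option \<kappa>) x = map_prod (map_option \<kappa>) (map_option \<kappa>) y"
    if "x \<in> ?X i" "y \<in> ?X j" for x y i j
    using that by (cases x; cases y) (auto simp: all_opt_def \<kappa>_glue)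
  have card: "card ((\<lambda>x. \<kappa> (case_prod glue x)) ` ?X i) = solid_count i * all_count (n - 1 - i)" for i
  proof -
    have "card ((\<lambda>x. \<kappa> (case_prod glue x)) ` ?X i) = card (map_prod (map_option \<kappa>) (map_option \<kappa>) ` ?X i)"
      by (rule card_image_eq_card_image) (rule *)
    also have "map_prod (map_option \<kappa>) (map_option \<kappa>) ` ?X i =
        (map_option \<kappa> ` {s \<in> all_opt i. solid_opt s}) \<times> (map_option \<kappa> ` all_opt (n - 1 - i))"
      by (rule map_prod_surj_on) auto
    finally show ?thesis by (simp add: card_cartesian_product all_count_def solid_count_def)
  qed
  have disj: "(\<lambda>x. \<kappa> (case_prod glue x)) ` ?X i \<inter> (\<lambda>x. \<kappa> (case_prod glue x)) ` ?X j = {}" if "i \<noteq> j" for i j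
  proof -
    have neq: False if x: "x \<in> ?X i" and y: "y \<in> ?X j" and e: "\<kappa> (case_prod glue x) = \<kappa> (case_prod glue y)" for x y
    proof -
      have m: "map_option \<kappa> (fst x) = map_option \<kappa> (fst y)"
        using iffD1[OF *[OF x y] e] by (metis fst_map_prod)
      have "deg_opt (fst x) = deg_opt (fst y)" by (rule deg_opt_eqI[OF m \<kappa>_deg])
      moreover have "deg_opt (fst x) = i" "deg_opt (fst y) = j" using x y by (auto simp: all_opt_def)
      ultimately show False using \<open>i \<noteq> j\<close> by simp
    qed
    show ?thesis
    proof (rule equals0I)
      fix k assume "k \<in> (\<lambda>x. \<kappa> (case_prod glue x)) ` ?X i \<inter> (\<lambda>x. \<kappa> (case_prod glue x)) ` ?X j"
      then obtain x y where "x \<in> ?X i" "k = \<kappa> (case_prod glue x)" "y \<in> ?X j" "k = \<kappa> (case_prod glue y)"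
        by blast
      then show False using neq[of x y] by simp
    qed
  qed
  have "\<kappa> ` {t \<in> assoc_types n. P t \<and> \<not> solid t} = (\<Union>i<n. (\<lambda>x. \<kappa> (case_prod glue x)) ` ?X i)"
    unfolding nonsolid_eq by (simp add: image_UN image_image)
  then have "nonsolid_count n = (\<Sum>i<n. card ((\<lambda>x. \<kappa> (case_prod glue x)) ` ?X i))"
    unfolding nonsolid_count_def
    by (simp only:) (rule card_UN_disjoint, use finite_all_opt disj in auto)
  then show ?thesis by (simp only: card)
qed

lemma all_count_rec:
  assumes "n > 0" shows "all_count n = nonsolid_count n + solid_count n"
proof -
  have "{t \<in> assoc_types n. P t} = {t \<in> assoc_types n. P t \<and> \<not> solid t} \<union> {t \<in> assoc_types n. P t \<and> solid t}"
    by auto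
  then show ?thesis
    unfolding nonsolid_count_def solid_count_pos[OF assms] all_count_pos[OF assms]
    by (simp only:) (rule card_image_Un, use finite_assoc_types[of n] in simp_all, metis \<kappa>_solid)
qed

text \<open>A row is a single factor of a column and vice versa, and a single composite factor is
  solid.\<close>

lemma solid_or_solid_tr: "deg t \<ge> 2 \<Longrightarrow> solid t \<or> solid (tr t)"
  by (cases t) auto

lemma card_nonsolid_tr:
  "card (\<kappa> ` {t \<in> assoc_types n. P t \<and> \<not> solid (tr t)}) = nonsolid_count n"
proof -
  have e: "{t \<in> assoc_types n. P t \<and> \<not> solid (tr t)} = tr ` {t \<in> assoc_types n. P t \<and> \<not> solid t}" (is "?A = ?B")
  proof (intro equalityI subsetI)
    fix t assume "t \<in> ?A"
    then have "tr t \<in> {t \<in> assoc_types n. P t \<and> \<not> solid t}" by (auto simp: assoc_types_def P_tr)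
    then show "t \<in> ?B" by (metis image_eqI tr_tr)
  qed (auto simp: assoc_types_def P_tr)
  show ?thesis unfolding e nonsolid_count_def image_image
    by (rule card_image_eq_card_image) (auto simp: \<kappa>_tr)
qed

lemma \<kappa>_solid_tr: "\<kappa> s = \<kappa> t \<Longrightarrow> solid (tr s) = solid (tr t)"
  using \<kappa>_solid \<kappa>_tr by blast

text \<open>A type that fails to be solid in the other direction is solid in this one. Transposition
  counts these types as nonsolid ones, and the mixed types remain.\<close>

lemma solid_count_rec:
  assumes "n \<ge> 2" shows "solid_count n = nonsolid_count n + mixed_count n"
proof -
  have n: "n > 0" using assms by simp
  have "{t \<in> assoc_types n. P t \<and> solid t} =
      {t \<in> assoc_types n. P t \<and> \<not> solid (tr t)} \<union> {t \<in> assoc_types n. P t \<and> solid t \<and> solid (tr t)}"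
    using solid_or_solid_tr assms by (auto simp: assoc_types_def)
  then show ?thesis
    unfolding card_nonsolid_tr[symmetric] mixed_count_def solid_count_pos[OF n]
    by (simp only:) (rule card_image_Un, use finite_assoc_types[of n] in simp_all, metis \<kappa>_solid_tr)
qed

lemma solid_count_1: "solid_count 1 = 0"
proof -
  have "\<not> solid t" if "deg t = 1" for t :: "unit mono"
  proof (cases t)
    case (V a b) then show ?thesis using that deg_pos[of a] deg_pos[of b] by (simp del: deg_pos)
  next
    case (H a b) then show ?thesis using that deg_pos[of a] deg_pos[of b] by (simp del: deg_pos)
  qed auto
  then have "{t \<in> assoc_types 1. P t \<and> solid t} = {}" by (auto simp: assoc_types_def)
  then show ?thesis using solid_count_pos[of 1]
    by (simp only: zero_less_one image_empty card.empty simp_thms)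
qed

end

lemma reach_opt_solid: "s' \<in> reach_opt s \<Longrightarrow> solid_opt s' = solid_opt s"
  using solid_reach by (auto simp: opt_defs split: option.splits)
lemma reach_opt_iff: "s' \<in> reach_opt s \<longleftrightarrow> map_option reach s = map_option reach s'"
  using reach_eq_iff by (cases s; cases s') (auto simp: opt_defs)

interpretation classes: class_count reach "\<lambda>_. True"
proof
  fix s t s' t' :: "unit mono option"
  assume a: "solid_opt s" "solid_opt s'" "normal_opt s" "normal_opt s'" "normal_opt t" "normal_opt t'"
  have "reach (glue s t) = reach (glue s' t') \<longleftrightarrow> glue s' t' \<in> case_prod glue ` (reach_opt s \<times> reach_opt t)"
    unfolding reach_glue[OF a(3,5), symmetric] by (rule reach_eq_iff)
  also have "\<dots> \<longleftrightarrow> s' \<in> reach_opt s \<and> t' \<in> reach_opt t"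
  proof
    assume "glue s' t' \<in> case_prod glue ` (reach_opt s \<times> reach_opt t)"
    then obtain u v where uv: "u \<in> reach_opt s" "v \<in> reach_opt t" "glue s' t' = glue u v" by auto
    have "s' = u \<and> t' = v"
      by (rule glue_inject) (use uv a reach_opt_solid[OF uv(1)] reach_opt_normal[OF uv(1)] in auto)
    then show "s' \<in> reach_opt s \<and> t' \<in> reach_opt t" using uv by simp
  qed force
  finally show "reach (glue s t) = reach (glue s' t') \<longleftrightarrow> map_option reach s = map_option reach s' \<and> map_option reach t = map_option reach t'"
    by (simp only: reach_opt_iff)
next
  fix s t :: "unit mono"
  show "reach (tr s) = reach (tr t) \<longleftrightarrow> reach s = reach t"
    by (simp add: reach_eq_iff) (metis image_iff reach_tr tr_tr)
  assume "reach s = reach t"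
  then have "t \<in> reach s" by (simp only: reach_refl)
  from solid_reach[OF this] reach_deg[OF this] show "solid s = solid t" "deg s = deg t" by (simp_all only:)
qed (auto simp: option.pred_True)

section \<open>The enumeration of neighbours commutes with transposition\<close>

lemma vsplits_tr: "vsplits (tr s) = map (map_prod tr tr) (hsplits s)"
  by (induction s) auto
lemma hsplits_tr: "hsplits (tr s) = map (map_prod tr tr) (vsplits s)"
  by (induction s) auto
lemma hmerge_tr: "hmerge (tr s) (tr t) = map tr (vmerge s t)"
  by (simp add: hmerge_def vmerge_def vsplits_tr map_concat comp_def case_prod_unfold tr_vcomp)
lemma vmerge_tr: "vmerge (tr s) (tr t) = map tr (hmerge s t)"
  by (simp add: hmerge_def vmerge_def hsplits_tr map_concat comp_def case_prod_unfold tr_hcomp)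
lemma hmerge_first_tr: "hmerge_first (tr s) (tr t) = map tr (vmerge_first s t)"
  using hmerge_tr[of s t] by (cases t) (simp_all add: hmerge_tr tr_vcomp)
lemma vmerge_first_tr: "vmerge_first (tr s) (tr t) = map tr (hmerge_first s t)"
  using vmerge_tr[of s t] by (cases t) (simp_all add: vmerge_tr tr_hcomp)
lemma neighbours_tr: "neighbours (tr t) = map tr (neighbours t)"
  by (induction t) (simp_all add: hmerge_first_tr vmerge_first_tr tr_hcomp tr_vcomp)
lemma isolated_tr: "neighbours (tr t) = [] \<longleftrightarrow> neighbours t = []"
  by (simp add: neighbours_tr)

interpretation isolated: class_count "\<lambda>t. t" "\<lambda>t. neighbours t = []"
proof
  fix s t :: "unit mono option"
  have "neighbours (glue s t) = [] \<longleftrightarrow> set (neighbours (glue s t)) = {}" by simp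
  also have "\<dots> \<longleftrightarrow> neighbours_opt s = {} \<and> neighbours_opt t = {}" unfolding neighbours_glue by auto
  finally show "neighbours (glue s t) = [] \<longleftrightarrow> pred_option (\<lambda>t. neighbours t = []) s \<and> pred_option (\<lambda>t. neighbours t = []) t"
    by (auto simp: opt_defs split: option.splits)
next
  fix s t s' t' :: "unit mono option"
  assume "solid_opt s" "solid_opt s'" "normal_opt s" "normal_opt s'"
  then show "glue s t = glue s' t' \<longleftrightarrow>
      map_option (\<lambda>t. t) s = map_option (\<lambda>t. t) s' \<and> map_option (\<lambda>t. t) t = map_option (\<lambda>t. t) t'"
    using glue_inject[of s s' t t'] by (auto simp: option.map_ident)
next
  fix s t :: "unit mono"
  show "tr s = tr t \<longleftrightarrow> s = t" by (metis tr_tr)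
qed (auto simp: isolated_tr)

interpretation types: class_count "\<lambda>t. t" "\<lambda>_. True"
proof
  fix s t s' t' :: "unit mono option"
  assume "solid_opt s" "solid_opt s'" "normal_opt s" "normal_opt s'"
  then show "glue s t = glue s' t' \<longleftrightarrow>
      map_option (\<lambda>t. t) s = map_option (\<lambda>t. t) s' \<and> map_option (\<lambda>t. t) t = map_option (\<lambda>t. t) t'"
    using glue_inject[of s s' t t'] by (auto simp: option.map_ident)
next
  fix s t :: "unit mono"
  show "tr s = tr t \<longleftrightarrow> s = t" by (metis tr_tr)
qed (auto simp: option.pred_True)

text \<open>From degree 2 on these are the little Schroeder numbers 1, 3, 11, 45, ...; doubled, they
  become the large Schroeder numbers 2, 6, 22, 90, ..., which count all association types.\<close>

definition H_count :: "nat \<Rightarrow> nat" where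
  "H_count n = card {t \<in> assoc_types n. is_H t}"

lemma V_count: "card {t \<in> assoc_types n. is_V t} = H_count n"
proof -
  have "{t \<in> assoc_types n. is_V t} = tr ` {t \<in> assoc_types n. is_H t}" (is "?A = ?B")
  proof (intro equalityI subsetI)
    fix t assume "t \<in> ?A"
    then have "tr t \<in> {t \<in> assoc_types n. is_H t}" by (auto simp: assoc_types_def)
    then show "t \<in> ?B" by (metis image_eqI tr_tr)
  qed (auto simp: assoc_types_def)
  moreover have "inj_on tr X" for X :: "unit mono set" by (metis inj_onI tr_tr)
  ultimately show ?thesis by (simp add: H_count_def card_image)
qed

lemma deg_eq_1_iff:
  fixes t :: "unit mono" shows "deg t = 1 \<longleftrightarrow> t = Ind ()"
proof (cases t)
  case (V a b) then show ?thesis using deg_pos[of a] deg_pos[of b] by (simp del: deg_pos)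
next
  case (H a b) then show ?thesis using deg_pos[of a] deg_pos[of b] by (simp del: deg_pos)
qed simp

lemma assoc_types_1: "assoc_types 1 = {Ind ()}"
proof (rule Set.set_eqI)
  fix t
  show "t \<in> assoc_types 1 \<longleftrightarrow> t \<in> {Ind ()}"
    using deg_eq_1_iff[of t] by (cases "t = Ind ()") (simp_all add: assoc_types_def)
qed

lemma card_assoc_types: "n \<ge> 2 \<Longrightarrow> card (assoc_types n) = 2 * H_count n"
proof -
  assume n: "n \<ge> 2"
  have "assoc_types n = {t \<in> assoc_types n. is_H t} \<union> {t \<in> assoc_types n. is_V t}"
  proof (intro equalityI subsetI)
    fix t assume "t \<in> assoc_types n"
    with n show "t \<in> {t \<in> assoc_types n. is_H t} \<union> {t \<in> assoc_types n. is_V t}"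
      by (cases t) (auto simp: assoc_types_def)
  qed auto
  moreover have "card ({t \<in> assoc_types n. is_H t} \<union> {t \<in> assoc_types n. is_V t}) = H_count n + H_count n"
  proof (subst card_Un_disjoint)
    show "{t \<in> assoc_types n. is_H t} \<inter> {t \<in> assoc_types n. is_V t} = {}"
      by (auto simp: is_H_def is_V_def)
  qed (simp_all only: V_count H_count_def finite_assoc_types finite_Collect_conjI simp_thms Collect_mem_eq)
  ultimately show ?thesis by simp
qed

text \<open>The first factor of a normal row is the indeterminate, which gives the 1 at
  \<open>i = 1\<close>, or a column; by transposition there are as many columns as rows of degree
  \<open>i\<close>.\<close>

lemma H_count_rec:
  "H_count n = (\<Sum>i\<in>{1..<n}. (if i = 1 then 1 else H_count i) * card (assoc_types (n - i)))"
proof -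
  let ?N = "\<lambda>i. {t \<in> assoc_types i. \<not> is_H t}"
  have eq: "{t \<in> assoc_types n. is_H t} = (\<Union>i\<in>{1..<n}. case_prod H ` (?N i \<times> assoc_types (n - i)))" (is "?L = ?R")
  proof (intro equalityI subsetI)
    fix t assume "t \<in> ?L"
    then obtain a b where t: "t = H a b" "normal a" "normal b" "\<not> is_H a" "deg a + deg b = n"
      by (cases t) (auto simp: assoc_types_def)
    moreover have "deg a \<in> {1..<n}" using t(5) deg_pos[of a] deg_pos[of b] by (simp del: deg_pos)
    ultimately show "t \<in> ?R" by (force simp: assoc_types_def)
  qed (auto simp: assoc_types_def)
  have N: "card (?N i) = (if i = 1 then 1 else H_count i)" if "i \<ge> 1" for i
  proof (cases "i = 1")
    case True
    then show ?thesis by (simp only: assoc_types_1) (simp add: Collect_conv_if)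
  next
    case False
    have "\<not> is_H t \<longleftrightarrow> is_V t" if "t \<in> assoc_types i" for t
      using that False by (cases t) (auto simp: assoc_types_def)
    then have "?N i = {t \<in> assoc_types i. is_V t}" by auto
    then show ?thesis using False by (simp add: V_count)
  qed
  have card_H: "card (case_prod H ` X) = card X" for X :: "(unit mono \<times> unit mono) set"
    by (rule card_image) (auto simp: inj_on_def)
  have "H_count n = (\<Sum>i\<in>{1..<n}. card (case_prod H ` (?N i \<times> assoc_types (n - i))))"
    unfolding H_count_def eq
  proof (rule card_UN_disjoint)
    show "\<forall>i\<in>{1..<n}. finite (case_prod H ` (?N i \<times> assoc_types (n - i)))"
      by (simp add: finite_assoc_types)
  qed (auto simp: assoc_types_def)
  also have "\<dots> = (\<Sum>i\<in>{1..<n}. card (?N i) * card (assoc_types (n - i)))"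
    by (simp only: card_H card_cartesian_product)
  also have "\<dots> = (\<Sum>i\<in>{1..<n}. (if i = 1 then 1 else H_count i) * card (assoc_types (n - i)))"
  proof (rule sum.cong[OF refl])
    fix i assume "i \<in> {1..<n}"
    then have "i \<ge> 1" by simp
    from N[OF this] show "card (?N i) * card (assoc_types (n - i)) =
        (if i = 1 then 1 else H_count i) * card (assoc_types (n - i))" by (rule arg_cong)
  qed
  finally show ?thesis .
qed

section \<open>Searching the class of a monomial\<close>

datatype comparison = LT | EQ | GT

text \<open>Lexicographic with \<open>Ind\<close> before \<open>H\<close> before \<open>V\<close>.
  It needs no degrees and so is not \<open>type_less\<close>; it only serves to organize search
  trees and to pick representatives. In \<open>cmp_then\<close> the first verdict is an argument, so
  the second factors are compared only after a tie.\<close>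

fun cmp :: "('a \<Rightarrow> 'a \<Rightarrow> comparison) \<Rightarrow> 'a mono \<Rightarrow> 'a mono \<Rightarrow> comparison"
  and cmp_then :: "('a \<Rightarrow> 'a \<Rightarrow> comparison) \<Rightarrow> comparison \<Rightarrow> 'a mono \<Rightarrow> 'a mono \<Rightarrow> comparison" where
  "cmp f (Ind x) (Ind y) = f x y"
| "cmp f (Ind x) (H c d) = LT"
| "cmp f (Ind x) (V c d) = LT"
| "cmp f (H a b) (Ind y) = GT"
| "cmp f (H a b) (H c d) = cmp_then f (cmp f a c) b d"
| "cmp f (H a b) (V c d) = LT"
| "cmp f (V a b) (Ind y) = GT"
| "cmp f (V a b) (H c d) = GT"
| "cmp f (V a b) (V c d) = cmp_then f (cmp f a c) b d"
| "cmp_then f LT b d = LT"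
| "cmp_then f EQ b d = cmp f b d"
| "cmp_then f GT b d = GT"

fun member :: "('a \<Rightarrow> 'a \<Rightarrow> comparison) \<Rightarrow> 'a mono \<Rightarrow> 'a mono tree \<Rightarrow> bool" where
  "member f x Leaf = False"
| "member f x (Node l a r) = (case cmp f x a of LT \<Rightarrow> member f x l | EQ \<Rightarrow> True | GT \<Rightarrow> member f x r)"

fun insert_tree :: "('a \<Rightarrow> 'a \<Rightarrow> comparison) \<Rightarrow> 'a mono \<Rightarrow> 'a mono tree \<Rightarrow> 'a mono tree" where
  "insert_tree f x Leaf = Node Leaf x Leaf"
| "insert_tree f x (Node l a r) = (case cmp f x a of
     LT \<Rightarrow> Node (insert_tree f x l) a r | EQ \<Rightarrow> Node l a r | GT \<Rightarrow> Node l a (insert_tree f x r))"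

text \<open>Termination is not established in advance: a run that ends with \<open>Some\<close> is
  its own certificate.\<close>

partial_function (option) dfs ::
  "('a \<Rightarrow> 'a \<Rightarrow> comparison) \<Rightarrow> 'a mono list \<Rightarrow> 'a mono tree \<Rightarrow> 'a mono tree option" where
  "dfs f ts S = (case ts of [] \<Rightarrow> Some S
     | t # ts \<Rightarrow> if member f t S then dfs f ts S else dfs f (neighbours t @ ts) (insert_tree f t S))"

text \<open>
  In the equations below the results of tests are arguments, so that rewriting decides a test before
  it unfolds a recursive call, and never revisits the search tree.
\<close>

definition member_branch where
  "member_branch c f x l r = (case c of LT \<Rightarrow> member f x l | EQ \<Rightarrow> True | GT \<Rightarrow> member f x r)"
definition insert_branch where
  "insert_branch c f x l a r = (case c of
     LT \<Rightarrow> Node (insert_tree f x l) a r | EQ \<Rightarrow> Node l a r | GT \<Rightarrow> Node l a (insert_tree f x r))"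
definition dfs_branch where
  "dfs_branch b f t ts S = (if b then dfs f ts S else dfs f (neighbours t @ ts) (insert_tree f t S))"

lemma member_eval:
  "member f x Leaf = False"
  "member f x (Node l a r) = member_branch (cmp f x a) f x l r"
  "member_branch LT f x l r = member f x l"
  "member_branch EQ f x l r = True"
  "member_branch GT f x l r = member f x r"
  by (simp_all add: member_branch_def)
lemma insert_eval:
  "insert_tree f x Leaf = Node Leaf x Leaf"
  "insert_tree f x (Node l a r) = insert_branch (cmp f x a) f x l a r"
  "insert_branch LT f x l a r = Node (insert_tree f x l) a r"
  "insert_branch EQ f x l a r = Node l a r"
  "insert_branch GT f x l a r = Node l a (insert_tree f x r)"
  by (simp_all add: insert_branch_def)
lemma dfs_eval:
  "dfs f [] S = Some S"
  "dfs f (t # ts) S = dfs_branch (member f t S) f t ts S"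
  "dfs_branch True f t ts S = dfs f ts S"
  "dfs_branch False f t ts S = dfs f (neighbours t @ ts) (insert_tree f t S)"
  by (subst dfs.simps; simp add: dfs_branch_def)+

lemma cmp_EQ:
  assumes "\<And>x y. f x y = EQ \<Longrightarrow> x = y"
  shows "cmp f s t = EQ \<Longrightarrow> s = t"
proof -
  have "(\<forall>x y. f x y = EQ \<longrightarrow> x = y) \<longrightarrow> cmp f s t = EQ \<longrightarrow> s = t"
    and "(\<forall>x y. f x y = EQ \<longrightarrow> x = y) \<longrightarrow> cmp_then f c b d = EQ \<longrightarrow> c = EQ \<and> b = d" for c b d
    by (induction f s t and f c b d rule: cmp_cmp_then.induct) auto
  then show "cmp f s t = EQ \<Longrightarrow> s = t" using assms by blast
qed

text \<open>The verdict \<open>EQ\<close> is trusted only in the direction of equality, and no order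
  is assumed in the tree. A badly chosen order could only overlook members and cause
  repetitions.\<close>

lemma member_set:
  assumes "\<And>x y. f x y = EQ \<Longrightarrow> x = y"
  shows "member f x S \<Longrightarrow> x \<in> set_tree S"
proof (induction S)
  case (Node l a r)
  then show ?case using cmp_EQ[of f x a] assms by (cases "cmp f x a") auto
qed simp

lemma set_insert_tree:
  assumes "\<And>x y. f x y = EQ \<Longrightarrow> x = y"
  shows "set_tree (insert_tree f x S) = insert x (set_tree S)"
proof (induction S)
  case (Node l a r)
  then show ?case using cmp_EQ[of f x a] assms by (cases "cmp f x a") auto
qed simp

text \<open>Invariant of the search: neighbours of visited trees are visited or pending. At the end
  nothing is pending, so the visited set is closed under neighbours; conversely every addition is
  reachable from a tree that was pending.\<close>

lemma dfs_correct:
  assumes sound: "\<And>x y. f x y = EQ \<Longrightarrow> x = y" and "dfs f ts S = Some S'"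
    and "\<And>t. t \<in> set ts \<Longrightarrow> normal t"
    and "\<And>s. s \<in> set_tree S \<Longrightarrow> set (neighbours s) \<subseteq> set_tree S \<union> set ts"
  shows "set_tree S \<union> set ts \<subseteq> set_tree S' \<and> (\<forall>s\<in>set_tree S'. set (neighbours s) \<subseteq> set_tree S') \<and>
    set_tree S' \<subseteq> set_tree S \<union> (\<Union>t\<in>set ts. reach t)"
proof -
  define Q where "Q ts S S' \<longleftrightarrow> (\<forall>t\<in>set ts. normal t) \<longrightarrow>
      (\<forall>s\<in>set_tree S. set (neighbours s) \<subseteq> set_tree S \<union> set ts) \<longrightarrow>
      set_tree S \<union> set ts \<subseteq> set_tree S' \<and> (\<forall>s\<in>set_tree S'. set (neighbours s) \<subseteq> set_tree S') \<and>
      set_tree S' \<subseteq> set_tree S \<union> (\<Union>t\<in>set ts. reach t)"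
    for ts :: "'a mono list" and S S' :: "'a mono tree"
  \<comment> \<open>\<open>dfs.raw_induct\<close> also varies the comparison function; this premise
    ties it to the \<open>f\<close> that is assumed sound.\<close>
  have "f = f \<longrightarrow> Q ts S S'"
  proof (rule dfs.raw_induct[OF _ assms(2), of "\<lambda>g ts S S'. g = f \<longrightarrow> Q ts S S'"], rule impI)
    fix dfs' f' ts S S'
    assume IH: "\<And>g ts S S'. dfs' g ts S = Some S' \<Longrightarrow> g = f \<longrightarrow> Q ts S S'" and "f' = f"
      and eq: "(case ts of [] \<Rightarrow> Some S | t # ts \<Rightarrow>
        if member f' t S then dfs' f' ts S else dfs' f' (neighbours t @ ts) (insert_tree f' t S)) = Some S'"
    show "Q ts S S'"
    proof (cases ts)
      case Nil
      with eq have "S' = S" by simp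
      with Nil show ?thesis by (simp add: Q_def)
    next
      case (Cons t us)
      show ?thesis
      proof (cases "member f t S")
        case True
        with Cons eq have "Q us S S'" using IH \<open>f' = f\<close> by simp
        moreover have "t \<in> set_tree S" by (rule member_set[OF sound True])
        ultimately show ?thesis unfolding Q_def Cons by (simp add: insert_absorb) blast
      next
        case False
        with Cons eq have q: "Q (neighbours t @ us) (insert_tree f t S) S'" using IH \<open>f' = f\<close> by simp
        have ins: "set_tree (insert_tree f t S) = insert t (set_tree S)" by (rule set_insert_tree[OF sound])
        show ?thesis
          unfolding Q_def
        proof (intro impI)
          assume n: "\<forall>t\<in>set ts. normal t"
            and c: "\<forall>s\<in>set_tree S. set (neighbours s) \<subseteq> set_tree S \<union> set ts"
          have nt: "normal t" using n Cons by simp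
          then have nb: "interchange t u" if "u \<in> set (neighbours t)" for u
            using that neighbours_iff by blast
          have r: "reach u \<subseteq> reach t" if "u \<in> set (neighbours t)" for u
            using nb[OF that] unfolding reach_def by (auto intro: converse_rtranclp_into_rtranclp)
          have "\<forall>t\<in>set (neighbours t @ us). normal t"
            using n Cons nb interchange_normal by auto
          moreover have "\<forall>s\<in>set_tree (insert_tree f t S). set (neighbours s) \<subseteq>
              set_tree (insert_tree f t S) \<union> set (neighbours t @ us)"
            using c unfolding ins Cons by auto
          ultimately have *: "set_tree (insert_tree f t S) \<union> set (neighbours t @ us) \<subseteq> set_tree S' \<and>
              (\<forall>s\<in>set_tree S'. set (neighbours s) \<subseteq> set_tree S') \<and>
              set_tree S' \<subseteq> set_tree (insert_tree f t S) \<union> (\<Union>t\<in>set (neighbours t @ us). reach t)"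
            using q unfolding Q_def by blast
          moreover have "set_tree S' \<subseteq> set_tree S \<union> (\<Union>t\<in>set ts. reach t)"
          proof
            fix u assume "u \<in> set_tree S'"
            then consider "u = t" | "u \<in> set_tree S" | v where "v \<in> set (neighbours t)" "u \<in> reach v"
              | v where "v \<in> set us" "u \<in> reach v" using * unfolding ins by auto
            then show "u \<in> set_tree S \<union> (\<Union>t\<in>set ts. reach t)"
              using r unfolding Cons by cases auto
          qed
          ultimately show "set_tree S \<union> set ts \<subseteq> set_tree S' \<and>
              (\<forall>s\<in>set_tree S'. set (neighbours s) \<subseteq> set_tree S') \<and>
              set_tree S' \<subseteq> set_tree S \<union> (\<Union>t\<in>set ts. reach t)"
            unfolding ins Cons by auto
        qed
      qed
    qed
  qed
  then show ?thesis using assms(3,4) unfolding Q_def by blast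
qed

lemma dfs_reach:
  assumes sound: "\<And>x y. f x y = EQ \<Longrightarrow> x = y" and "dfs f [t] Leaf = Some S" and t: "normal t"
  shows "set_tree S = reach t"
proof -
  have *: "t \<in> set_tree S" "\<forall>s\<in>set_tree S. set (neighbours s) \<subseteq> set_tree S" "set_tree S \<subseteq> reach t"
    using dfs_correct[OF assms(1,2)] t by auto
  have "u \<in> set_tree S" if "interchange\<^sup>*\<^sup>* t u" for u
    using that by (induction rule: rtranclp_induct) (use * interchange_neighbours in blast)+
  then show ?thesis using *(3) by (auto simp: reach_def)
qed

text \<open>Length by incrementing a binary numeral, which is cheap for rewriting. Started at
  \<open>num.One\<close> it yields one more than the length: \<open>check_list\<close> applies it to
  the tail only, elsewhere the expected value is larger by one.\<close>

fun count :: "'a list \<Rightarrow> num \<Rightarrow> nat" where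
  "count [] k = numeral k"
| "count (x # xs) k = count xs (Num.inc k)"

lemma count: "count xs k = numeral k + length xs"
  by (induction xs k rule: count.induct) (auto simp: numeral_inc)

abbreviation cmp_unit :: "unit mono \<Rightarrow> unit mono \<Rightarrow> comparison" where
  "cmp_unit \<equiv> cmp (\<lambda>_ _. EQ)"

fun ascending :: "unit mono list \<Rightarrow> bool" where
  "ascending [] = True"
| "ascending [x] = True"
| "ascending (x # y # zs) = (cmp_unit x y = LT \<and> ascending (y # zs))"

lemma cmp_unit_EQ: "cmp_unit s t = EQ \<longleftrightarrow> s = t"
proof
  show "cmp_unit s t = EQ \<Longrightarrow> s = t" by (rule cmp_EQ) simp_all
  show "s = t \<Longrightarrow> cmp_unit s t = EQ" by (induction s arbitrary: t) auto
qed

lemma cmp_then_LT: "cmp_then f c b d = LT \<longleftrightarrow> c = LT \<or> c = EQ \<and> cmp f b d = LT"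
  by (cases c) auto

lemma cmp_unit_trans: "cmp_unit s t = LT \<Longrightarrow> cmp_unit t u = LT \<Longrightarrow> cmp_unit s u = LT"
proof (induction s arbitrary: t u)
  case (Ind x)
  then show ?case by (cases t; cases u) auto
next
  case (H a b)
  then show ?case by (cases t; cases u) (auto simp: cmp_then_LT cmp_unit_EQ)
next
  case (V a b)
  then show ?case by (cases t; cases u) (auto simp: cmp_then_LT cmp_unit_EQ)
qed

lemma ascending_sorted_wrt: "ascending xs \<longleftrightarrow> sorted_wrt (\<lambda>s t. cmp_unit s t = LT) xs"
proof -
  have "transp (\<lambda>s t. cmp_unit s t = LT)" by (auto intro!: transpI dest: cmp_unit_trans)
  then show ?thesis
    by (induction xs rule: ascending.induct) (auto simp: sorted_wrt2 dest: cmp_unit_trans)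
qed
lemma cmp_unit_irrefl: "cmp_unit s s \<noteq> LT" using cmp_unit_EQ[of s s] by simp
lemma ascending_distinct: "ascending xs \<Longrightarrow> distinct xs"
  unfolding ascending_sorted_wrt
  by (induction xs) (auto simp: cmp_unit_irrefl)

text \<open>The start \<open>r\<close> of the search must head the ascending list, so it is the
  least element of its class. This makes representatives canonical and different table entries stand
  for different classes.\<close>

fun check_list :: "unit mono \<Rightarrow> nat \<Rightarrow> unit mono list \<Rightarrow> bool" where
  "check_list r k [] = False"
| "check_list r k (x # xs) = (r = x \<and> count xs num.One = k \<and> ascending (x # xs))"
fun check_tree :: "unit mono \<Rightarrow> nat \<Rightarrow> unit mono tree option \<Rightarrow> bool" where
  "check_tree r k None = False"
| "check_tree r k (Some S) = check_list r k (inorder2 S [])"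

lemma check_tree:
  assumes "check_tree r k (dfs (\<lambda>_ _. EQ) [r] Leaf)" "normal r"
  shows "card (reach r) = k" and "u \<in> reach r \<Longrightarrow> u = r \<or> cmp_unit r u = LT"
proof -
  obtain S where S: "dfs (\<lambda>_ _. EQ) [r] Leaf = Some S"
    using assms(1) by (cases "dfs (\<lambda>_ _. EQ) [r] Leaf") auto
  obtain xs where xs: "inorder S = r # xs" "1 + length xs = k" "ascending (r # xs)"
    using assms(1) unfolding S by (cases "inorder S") (auto simp: inorder2_inorder count)
  have "reach r = set (r # xs)"
    using dfs_reach[OF _ S assms(2)] xs(1) by (simp flip: set_inorder)
  moreover have "\<forall>x\<in>set xs. cmp_unit r x = LT" using xs(3) by (simp add: ascending_sorted_wrt)
  moreover have "card (set (r # xs)) = k" using distinct_card[OF ascending_distinct[OF xs(3)]] xs(2) by simp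
  ultimately show "card (reach r) = k" "u \<in> reach r \<Longrightarrow> u = r \<or> cmp_unit r u = LT"
    by auto
qed

section \<open>Tables of mixed classes and their completeness\<close>

definition mixed :: "nat \<Rightarrow> unit mono set" where
  "mixed n = {t \<in> assoc_types n. solid t \<and> solid (tr t)}"

lemma mixed_reach:
  assumes "t \<in> mixed n" shows "reach t \<subseteq> mixed n"
proof
  fix u assume u: "u \<in> reach t"
  then have "tr u \<in> reach (tr t)" by (simp add: reach_tr)
  then have "solid (tr u) = solid (tr t)" by (rule solid_reach)
  moreover have "u \<in> assoc_types n"
    using reach_subset_assoc_types[of t n] u assms by (auto simp: mixed_def)
  ultimately show "u \<in> mixed n" using solid_reach[OF u] assms by (simp add: mixed_def)
qed

lemma finite_mixed: "finite (mixed n)"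
  by (simp add: mixed_def finite_assoc_types)

definition class_table :: "nat \<Rightarrow> (nat \<times> unit mono list) list \<Rightarrow> bool" where
  "class_table n T \<longleftrightarrow> distinct (map fst T) \<and>
     (\<forall>(k, rs)\<in>set T. ascending rs \<and> (\<forall>r\<in>set rs. r \<in> mixed n \<and> check_tree r k (dfs (\<lambda>_ _. EQ) [r] Leaf))) \<and>
     (\<Sum>(k, rs)\<leftarrow>T. k * length rs) = card (mixed n)"

text \<open>Different least elements have disjoint classes, so the sizes in the table add up to the
  cardinality of a subset of \<open>mixed n\<close>. As the sum is the full cardinality, that subset
  is everything and no class is missing.\<close>

lemma class_table:
  assumes T: "class_table n T"
  shows "card {C \<in> reach ` mixed n. Q (card C)} = (\<Sum>(k, rs)\<leftarrow>T. if Q k then length rs else 0)" (is ?count)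
    and "t \<in> mixed n \<Longrightarrow> \<exists>(k, rs)\<in>set T. \<exists>r\<in>set rs. reach t = reach r \<and> card (reach t) = k"
proof -
  define R where "R = (\<Union>(k, rs)\<in>set T. set rs)"
  have d: "distinct (map fst T)" and s: "(\<Sum>(k, rs)\<leftarrow>T. k * length rs) = card (mixed n)"
    and a: "\<And>k rs. (k, rs) \<in> set T \<Longrightarrow> ascending rs"
    and m: "\<And>k rs r. (k, rs) \<in> set T \<Longrightarrow> r \<in> set rs \<Longrightarrow> r \<in> mixed n"
    and c: "\<And>k rs r. (k, rs) \<in> set T \<Longrightarrow> r \<in> set rs \<Longrightarrow> check_tree r k (dfs (\<lambda>_ _. EQ) [r] Leaf)"
    using T unfolding class_table_def by auto
  have normal: "normal r" if "r \<in> mixed n" for r using that by (simp add: mixed_def assoc_types_def)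
  have k: "card (reach r) = k" if "(k, rs) \<in> set T" "r \<in> set rs" for k rs r
    by (rule check_tree(1)[OF c[OF that] normal[OF m[OF that]]])
  have inj: "inj_on reach R"
  proof (rule inj_onI)
    fix r r' assume "r \<in> R" "r' \<in> R" and e: "reach r = reach r'"
    then obtain k rs k' rs' where r: "(k, rs) \<in> set T" "r \<in> set rs" and r': "(k', rs') \<in> set T" "r' \<in> set rs'"
      unfolding R_def by auto
    have "r' \<in> reach r" "r \<in> reach r'" using e reach_eq_iff by blast+
    \<comment> \<open>Otherwise each of the two least elements of the common class would precede the
      other.\<close>
    then show "r = r'"
      using check_tree(2)[OF c[OF r] normal[OF m[OF r]], of r']
        check_tree(2)[OF c[OF r'] normal[OF m[OF r']], of r] cmp_unit_trans[of r r' r] cmp_unit_irrefl[of r]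
      by auto
  qed
  \<comment> \<open>Used twice: with the identity for exhaustiveness of the table, and with the
    indicator of \<open>Q\<close> for the count.\<close>
  have sum: "(\<Sum>r\<in>R. g (card (reach r))) = (\<Sum>(k, rs)\<leftarrow>T. g k * length rs)" for g :: "nat \<Rightarrow> nat"
  proof -
    have "distinct T" using d by (rule distinct_map[THEN iffD1, THEN conjunct1])
    have disj: "set rs \<inter> set rs' = {}" if "(k, rs) \<in> set T" "(k', rs') \<in> set T" "(k, rs) \<noteq> (k', rs')" for k rs k' rs'
    proof -
      have "k \<noteq> k'" using that d by (metis eq_key_imp_eq_value)
      then show ?thesis using k[OF that(1)] k[OF that(2)] by blast
    qed
    have "(\<Sum>r\<in>R. g (card (reach r))) = (\<Sum>(k, rs)\<in>set T. \<Sum>r\<in>set rs. g (card (reach r)))"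
      unfolding R_def
    proof (subst sum.UNION_disjoint)
      show "\<forall>p\<in>set T. \<forall>q\<in>set T. p \<noteq> q \<longrightarrow> (case p of (k, rs) \<Rightarrow> set rs) \<inter> (case q of (k, rs) \<Rightarrow> set rs) = {}"
      proof (intro ballI impI)
        fix p q assume "p \<in> set T" "q \<in> set T" "p \<noteq> q"
        then show "(case p of (k, rs) \<Rightarrow> set rs) \<inter> (case q of (k, rs) \<Rightarrow> set rs) = {}"
          using disj[of "fst p" "snd p" "fst q" "snd q"] by (simp add: split_beta)
      qed
    qed (auto intro: sum.cong)
    also have "\<dots> = (\<Sum>(k, rs)\<in>set T. g k * length rs)"
    proof (rule sum.cong[OF refl], clarify)
      fix k' rs assume T': "(k', rs) \<in> set T"
      have "(\<Sum>r\<in>set rs. g (card (reach r))) = (\<Sum>r\<in>set rs. g k')"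
        by (rule sum.cong) (simp_all add: k[OF T'])
      then show "(\<Sum>r\<in>set rs. g (card (reach r))) = g k' * length rs"
        using distinct_card[OF ascending_distinct[OF a[OF T']]] by simp
    qed
    also have "\<dots> = (\<Sum>(k, rs)\<leftarrow>T. g k * length rs)"
      using \<open>distinct T\<close> by (simp add: sum_list_distinct_conv_sum_set)
    finally show ?thesis .
  qed
  have R: "R \<subseteq> mixed n" using m by (auto simp: R_def)
  then have finR: "finite R" using finite_mixed finite_subset by blast
  have sub: "reach r \<subseteq> mixed n" if "r \<in> R" for r by (rule mixed_reach[OF subsetD[OF R that]])
  have U: "(\<Union>r\<in>R. reach r) = mixed n"
  proof (rule card_subset_eq[OF finite_mixed])
    show "(\<Union>r\<in>R. reach r) \<subseteq> mixed n" by (rule UN_least) (rule sub)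
    have "card (\<Union>r\<in>R. reach r) = (\<Sum>r\<in>R. card (reach r))"
    proof (rule card_UN_disjoint[OF finR])
      show "\<forall>r\<in>R. finite (reach r)" by (intro ballI finite_subset[OF sub finite_mixed])
      show "\<forall>r\<in>R. \<forall>r'\<in>R. r \<noteq> r' \<longrightarrow> reach r \<inter> reach r' = {}"
      proof (intro ballI impI)
        fix r r' assume r: "r \<in> R" "r' \<in> R" "r \<noteq> r'"
        show "reach r \<inter> reach r' = {}"
        proof (rule equals0I)
          fix u assume "u \<in> reach r \<inter> reach r'"
          then have "reach r = reach r'" using reach_eq[of u r] reach_eq[of u r'] by simp
          then show False using r inj_onD[OF inj] by blast
        qed
      qed
    qed
    also have "\<dots> = card (mixed n)" using sum[of "\<lambda>k. k"] s by simp
    finally show "card (\<Union>r\<in>R. reach r) = card (mixed n)" .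
  qed
  have ex: "\<exists>r\<in>R. reach t = reach r" if t: "t \<in> mixed n" for t
  proof -
    obtain r where "r \<in> R" "t \<in> reach r" using t U by blast
    then show ?thesis using reach_eq[of t r] by blast
  qed
  show "\<exists>(k, rs)\<in>set T. \<exists>r\<in>set rs. reach t = reach r \<and> card (reach t) = k" if t: "t \<in> mixed n"
  proof -
    obtain r where r: "r \<in> R" "reach t = reach r" using ex[OF t] by blast
    then obtain k' rs where "(k', rs) \<in> set T" "r \<in> set rs" unfolding R_def by auto
    with k[OF this] r(2) show ?thesis by (intro bexI[of _ "(k', rs)"]) auto
  qed
  have "{C \<in> reach ` mixed n. Q (card C)} = reach ` {r \<in> R. Q (card (reach r))}"
  proof (intro equalityI subsetI)
    fix C assume "C \<in> {C \<in> reach ` mixed n. Q (card C)}"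
    then obtain t where t: "t \<in> mixed n" "C = reach t" "Q (card C)" by blast
    obtain r where "r \<in> R" "reach t = reach r" using ex[OF t(1)] by blast
    then show "C \<in> reach ` {r \<in> R. Q (card (reach r))}" using t(2,3) by simp
  qed (use R in auto)
  then have "card {C \<in> reach ` mixed n. Q (card C)} = card {r \<in> R. Q (card (reach r))}"
    using inj by (simp add: card_image inj_on_subset)
  also have "\<dots> = (\<Sum>r\<in>R. if Q (card (reach r)) then 1 else 0)"
    using finR by (simp add: sum.If_cases Int_def)
  also have "\<dots> = (\<Sum>(k, rs)\<leftarrow>T. (if Q k then 1 else 0) * length rs)"
    by (rule sum[of "\<lambda>k. if Q k then 1 else 0"])
  also have "\<dots> = (\<Sum>(k, rs)\<leftarrow>T. if Q k then length rs else 0)"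
    by (intro arg_cong[where f = sum_list] map_cong) auto
  finally show ?count .
qed

section \<open>Recurrences for the numbers of classes\<close>

lemma sum_lessThan_upt: "(\<Sum>i<n. f i) = (\<Sum>i\<leftarrow>[0..<n]. f i)" for f :: "nat \<Rightarrow> nat"
  by (simp add: interv_sum_list_conv_sum_set_nat atLeast0LessThan)
lemma H_count_upt:
  "H_count n = (\<Sum>i\<leftarrow>[1..<n]. (if i = 1 then 1 else H_count i) * card (assoc_types (n - i)))"
  by (subst H_count_rec) (simp add: interv_sum_list_conv_sum_set_nat)

lemma card_assoc_types_values:
  "card (assoc_types 1) = 1" "card (assoc_types 2) = 2" "card (assoc_types 3) = 6"
  "card (assoc_types 4) = 22" "card (assoc_types 5) = 90" "card (assoc_types 6) = 394"
  "card (assoc_types 7) = 1806" "card (assoc_types 8) = 8558" "card (assoc_types 9) = 41586"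
proof -
  show 1: "card (assoc_types 1) = 1" by (simp only: assoc_types_1) simp
  have H2: "H_count 2 = 1" using 1 by (simp add: upt_rec numeral_2_eq_2[symmetric] H_count_upt[of 2])
  show 2: "card (assoc_types 2) = 2" by (simp add: card_assoc_types H2)
  have H3: "H_count 3 = 3" using 1 by (simp add: upt_rec numeral_2_eq_2[symmetric] H_count_upt[of 3] H2 2)
  show 3: "card (assoc_types 3) = 6" by (simp add: card_assoc_types H3)
  have H4: "H_count 4 = 11" using 1 by (simp add: upt_rec numeral_2_eq_2[symmetric] H_count_upt[of 4] H2 H3 2 3)
  show 4: "card (assoc_types 4) = 22" by (simp add: card_assoc_types H4)
  have H5: "H_count 5 = 45" using 1 by (simp add: upt_rec numeral_2_eq_2[symmetric] H_count_upt[of 5] H2 H3 H4 2 3 4)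
  show 5: "card (assoc_types 5) = 90" by (simp add: card_assoc_types H5)
  have H6: "H_count 6 = 197" using 1 by (simp add: upt_rec numeral_2_eq_2[symmetric] H_count_upt[of 6] H2 H3 H4 H5 2 3 4 5)
  show 6: "card (assoc_types 6) = 394" by (simp add: card_assoc_types H6)
  have H7: "H_count 7 = 903" using 1 by (simp add: upt_rec numeral_2_eq_2[symmetric] H_count_upt[of 7] H2 H3 H4 H5 H6 2 3 4 5 6)
  show 7: "card (assoc_types 7) = 1806" by (simp add: card_assoc_types H7)
  have H8: "H_count 8 = 4279" using 1 by (simp add: upt_rec numeral_2_eq_2[symmetric] H_count_upt[of 8] H2 H3 H4 H5 H6 H7 2 3 4 5 6 7)
  show 8: "card (assoc_types 8) = 8558" by (simp add: card_assoc_types H8)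
  have H9: "H_count 9 = 20793" using 1 by (simp add: upt_rec numeral_2_eq_2[symmetric] H_count_upt[of 9] H2 H3 H4 H5 H6 H7 H8 2 3 4 5 6 7 8)
  show "card (assoc_types 9) = 41586" by (simp add: card_assoc_types H9)
qed

context class_count begin

lemma nonsolid_count_upt: "nonsolid_count n = (\<Sum>i\<leftarrow>[0..<n]. solid_count i * all_count (n - 1 - i))"
  by (simp only: nonsolid_count_rec sum_lessThan_upt)
lemma counts_1: "solid_count 1 = 0" "nonsolid_count 1 = 1" "all_count 1 = 1"
  using solid_count_1 all_count_rec[of 1] nonsolid_count_upt[of 1] by (simp_all add: counts_0)

lemma nonsolid_count_1: "nonsolid_count (Suc 0) = 1" "all_count (Suc 0) = 1" "solid_count (Suc 0) = 0"
  using counts_1 by simp_all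

end

lemma types_all_count: "n > 0 \<Longrightarrow> types.all_count n = card (assoc_types n)"
  by (simp add: types.all_count_pos)
lemma types_mixed_count: "types.mixed_count n = card (mixed n)"
  by (simp add: types.mixed_count_def mixed_def)

text \<open>The recurrences run backwards here: all types are counted already, so the solid ones and
  then the mixed ones follow by subtraction. These values are the totals against which the tables
  are checked.\<close>

lemma card_mixed_values:
  "card (mixed 2) = 0" "card (mixed 3) = 0" "card (mixed 4) = 2" "card (mixed 5) = 12"
  "card (mixed 6) = 64" "card (mixed 7) = 330" "card (mixed 8) = 1692" "card (mixed 9) = 8700"
proof -
  note r = types_all_count card_assoc_types_values types.nonsolid_count_upt types.counts_0 types.nonsolid_count_1
  have *: "types.solid_count n = types.all_count n - types.nonsolid_count n"
    "card (mixed n) = types.solid_count n - types.nonsolid_count n" if "n \<ge> 2" for n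
    using types.all_count_rec[of n] types.solid_count_rec[of n] that by (simp_all add: types_mixed_count)
  have N2: "types.nonsolid_count 2 = 1" using card_assoc_types_values(1) by (simp add: r upt_rec numeral_2_eq_2[symmetric])
  have S2: "types.solid_count 2 = 1" by (simp add: * r(1,2) card_assoc_types_values N2)
  show "card (mixed 2) = 0" by (simp add: * N2 S2)
  have N3: "types.nonsolid_count 3 = 3" using card_assoc_types_values(1) by (simp add: r upt_rec numeral_2_eq_2[symmetric] S2)
  have S3: "types.solid_count 3 = 3" by (simp add: *(1) r(1) card_assoc_types_values N3)
  show "card (mixed 3) = 0" by (simp add: * N3 S3)
  have N4: "types.nonsolid_count 4 = 10" by (simp add: r upt_rec numeral_2_eq_2[symmetric] S2 S3)
  have S4: "types.solid_count 4 = 12" by (simp add: *(1) r(1) card_assoc_types_values N4)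
  show "card (mixed 4) = 2" by (simp add: *(2) N4 S4)
  have N5: "types.nonsolid_count 5 = 39" by (simp add: r upt_rec numeral_2_eq_2[symmetric] S2 S3 S4)
  have S5: "types.solid_count 5 = 51" by (simp add: *(1) r(1) card_assoc_types_values N5)
  show "card (mixed 5) = 12" by (simp add: *(2) N5 S5)
  have N6: "types.nonsolid_count 6 = 165" by (simp add: r upt_rec numeral_2_eq_2[symmetric] S2 S3 S4 S5)
  have S6: "types.solid_count 6 = 229" by (simp add: *(1) r(1) card_assoc_types_values N6)
  show "card (mixed 6) = 64" by (simp add: *(2) N6 S6)
  have N7: "types.nonsolid_count 7 = 738" by (simp add: r upt_rec numeral_2_eq_2[symmetric] S2 S3 S4 S5 S6)
  have S7: "types.solid_count 7 = 1068" by (simp add: *(1) r(1) card_assoc_types_values N7)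
  show "card (mixed 7) = 330" by (simp add: *(2) N7 S7)
  have N8: "types.nonsolid_count 8 = 3433" by (simp add: r upt_rec numeral_2_eq_2[symmetric] S2 S3 S4 S5 S6 S7)
  have S8: "types.solid_count 8 = 5125" by (simp add: *(1) r(1) card_assoc_types_values N8)
  show "card (mixed 8) = 1692" by (simp add: *(2) N8 S8)
  have N9: "types.nonsolid_count 9 = 16443" by (simp add: r upt_rec numeral_2_eq_2[symmetric] S2 S3 S4 S5 S6 S7 S8)
  have S9: "types.solid_count 9 = 25143" by (simp add: *(1) r(1) card_assoc_types_values N9)
  show "card (mixed 9) = 8700" by (simp add: *(2) N9 S9)
qed

text \<open>In a mixed row every factor is a column, so the first two factors admit an interchange;
  transposition treats mixed columns.\<close>

lemma mixed_not_isolated: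
  assumes "t \<in> mixed n" shows "neighbours t \<noteq> []"
proof -
  have root_H: "neighbours u \<noteq> []" if n: "normal u" "solid u" and h: "is_H u" for u :: "unit mono"
  proof -
    obtain a b where u: "u = H a b" using h by (auto simp: is_H_def)
    obtain a1 a2 where a: "a = V a1 a2" using n u by (cases a) auto
    have "hmerge_first a b \<noteq> []"
    proof (cases b)
      case (H c d)
      then obtain c1 c2 where "c = V c1 c2" using n u by (cases c) auto
      then show ?thesis using a H by (simp add: hmerge_def)
    qed (use n u a in \<open>auto simp: hmerge_def\<close>)
    then show ?thesis by (simp add: u)
  qed
  have t: "normal t" "solid t" "solid (tr t)" using assms by (auto simp: mixed_def assoc_types_def)
  show ?thesis
  proof (cases t)
    case (H a b) then show ?thesis using root_H[of t] t by simp
  next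
    case (V a b) then show ?thesis using root_H[of "tr t"] t by (simp only: isolated_tr) simp
  qed (use t in simp)
qed

lemma isolated_nonsolid_count: "isolated.nonsolid_count 9 = 7029"
proof -
  note r = isolated.nonsolid_count_upt isolated.counts_0 isolated.nonsolid_count_1
  \<comment> \<open>With this the recurrences for isolated types close up without any
    search.\<close>
  have m: "isolated.mixed_count n = 0" for n
    using mixed_not_isolated[of _ n] unfolding isolated.mixed_count_def mixed_def by (simp add: card_eq_0_iff) blast
  have N2: "isolated.nonsolid_count 2 = 1" by (simp add: r upt_rec numeral_2_eq_2[symmetric])
  have S2: "isolated.solid_count 2 = 1" by (simp add: isolated.solid_count_rec N2 m)
  have Q2: "isolated.all_count 2 = 2" by (simp add: isolated.all_count_rec N2 S2)
  have N3: "isolated.nonsolid_count 3 = 3" by (simp add: r upt_rec numeral_2_eq_2[symmetric] S2 Q2)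
  have S3: "isolated.solid_count 3 = 3" by (simp add: isolated.solid_count_rec N3 m)
  have Q3: "isolated.all_count 3 = 6" by (simp add: isolated.all_count_rec N3 S3)
  have N4: "isolated.nonsolid_count 4 = 10" by (simp add: r upt_rec numeral_2_eq_2[symmetric] S2 Q2 S3 Q3)
  have S4: "isolated.solid_count 4 = 10" by (simp add: isolated.solid_count_rec N4 m)
  have Q4: "isolated.all_count 4 = 20" by (simp add: isolated.all_count_rec N4 S4)
  have N5: "isolated.nonsolid_count 5 = 35" by (simp add: r upt_rec numeral_2_eq_2[symmetric] S2 Q2 S3 Q3 S4 Q4)
  have S5: "isolated.solid_count 5 = 35" by (simp add: isolated.solid_count_rec N5 m)
  have Q5: "isolated.all_count 5 = 70" by (simp add: isolated.all_count_rec N5 S5)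
  have N6: "isolated.nonsolid_count 6 = 127" by (simp add: r upt_rec numeral_2_eq_2[symmetric] S2 Q2 S3 Q3 S4 Q4 S5 Q5)
  have S6: "isolated.solid_count 6 = 127" by (simp add: isolated.solid_count_rec N6 m)
  have Q6: "isolated.all_count 6 = 254" by (simp add: isolated.all_count_rec N6 S6)
  have N7: "isolated.nonsolid_count 7 = 474" by (simp add: r upt_rec numeral_2_eq_2[symmetric] S2 Q2 S3 Q3 S4 Q4 S5 Q5 S6 Q6)
  have S7: "isolated.solid_count 7 = 474" by (simp add: isolated.solid_count_rec N7 m)
  have Q7: "isolated.all_count 7 = 948" by (simp add: isolated.all_count_rec N7 S7)
  have N8: "isolated.nonsolid_count 8 = 1809" by (simp add: r upt_rec numeral_2_eq_2[symmetric] S2 Q2 S3 Q3 S4 Q4 S5 Q5 S6 Q6 S7 Q7)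
  have S8: "isolated.solid_count 8 = 1809" by (simp add: isolated.solid_count_rec N8 m)
  have Q8: "isolated.all_count 8 = 3618" by (simp add: isolated.all_count_rec N8 S8)
  show ?thesis by (simp add: r upt_rec numeral_2_eq_2[symmetric] S2 Q2 S3 Q3 S4 Q4 S5 Q5 S6 Q6 S7 Q7 S8 Q8)
qed

lemma classes_mixed_count: "classes.mixed_count n = card (reach ` mixed n)"
  by (simp add: classes.mixed_count_def mixed_def)

text \<open>The hypotheses are the numbers of entries in the tables of degrees 4 to 8. Nonsolid
  classes of degree 9 are products of classes of degree at most 8, so the mixed classes of degree 9
  do not enter.\<close>

lemma classes_nonsolid_count:
  assumes "card (reach ` mixed 4) = 1" "card (reach ` mixed 5) = 4" "card (reach ` mixed 6) = 14"
    "card (reach ` mixed 7) = 46" "card (reach ` mixed 8) = 139"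
  shows "classes.nonsolid_count 9 = 8816"
proof -
  note r = classes.nonsolid_count_upt classes.counts_0 classes.nonsolid_count_1
  have "mixed 2 = {}" "mixed 3 = {}" using card_mixed_values(1,2) finite_mixed by simp_all
  then have m: "classes.mixed_count 2 = 0" "classes.mixed_count 3 = 0" "classes.mixed_count 4 = 1"
    "classes.mixed_count 5 = 4" "classes.mixed_count 6 = 14" "classes.mixed_count 7 = 46" "classes.mixed_count 8 = 139"
    using assms by (simp_all add: classes_mixed_count)
  have N2: "classes.nonsolid_count 2 = 1" by (simp add: r upt_rec numeral_2_eq_2[symmetric])
  have S2: "classes.solid_count 2 = 1" by (simp add: classes.solid_count_rec N2 m)
  have Q2: "classes.all_count 2 = 2" by (simp add: classes.all_count_rec N2 S2)
  have N3: "classes.nonsolid_count 3 = 3" by (simp add: r upt_rec numeral_2_eq_2[symmetric] S2 Q2)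
  have S3: "classes.solid_count 3 = 3" by (simp add: classes.solid_count_rec N3 m)
  have Q3: "classes.all_count 3 = 6" by (simp add: classes.all_count_rec N3 S3)
  have N4: "classes.nonsolid_count 4 = 10" by (simp add: r upt_rec numeral_2_eq_2[symmetric] S2 Q2 S3 Q3)
  have S4: "classes.solid_count 4 = 11" by (simp add: classes.solid_count_rec N4 m)
  have Q4: "classes.all_count 4 = 21" by (simp add: classes.all_count_rec N4 S4)
  have N5: "classes.nonsolid_count 5 = 37" by (simp add: r upt_rec numeral_2_eq_2[symmetric] S2 Q2 S3 Q3 S4 Q4)
  have S5: "classes.solid_count 5 = 41" by (simp add: classes.solid_count_rec N5 m)
  have Q5: "classes.all_count 5 = 78" by (simp add: classes.all_count_rec N5 S5)
  have N6: "classes.nonsolid_count 6 = 142" by (simp add: r upt_rec numeral_2_eq_2[symmetric] S2 Q2 S3 Q3 S4 Q4 S5 Q5)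
  have S6: "classes.solid_count 6 = 156" by (simp add: classes.solid_count_rec N6 m)
  have Q6: "classes.all_count 6 = 298" by (simp add: classes.all_count_rec N6 S6)
  have N7: "classes.nonsolid_count 7 = 556" by (simp add: r upt_rec numeral_2_eq_2[symmetric] S2 Q2 S3 Q3 S4 Q4 S5 Q5 S6 Q6)
  have S7: "classes.solid_count 7 = 602" by (simp add: classes.solid_count_rec N7 m)
  have Q7: "classes.all_count 7 = 1158" by (simp add: classes.all_count_rec N7 S7)
  have N8: "classes.nonsolid_count 8 = 2205" by (simp add: r upt_rec numeral_2_eq_2[symmetric] S2 Q2 S3 Q3 S4 Q4 S5 Q5 S6 Q6 S7 Q7)
  have S8: "classes.solid_count 8 = 2344" by (simp add: classes.solid_count_rec N8 m)
  have Q8: "classes.all_count 8 = 4549" by (simp add: classes.all_count_rec N8 S8)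
  show ?thesis by (simp add: r upt_rec numeral_2_eq_2[symmetric] S2 Q2 S3 Q3 S4 Q4 S5 Q5 S6 Q6 S7 Q7 S8 Q8)
qed

lemma isolated_reach: "normal t \<Longrightarrow> neighbours t = [] \<Longrightarrow> reach t = {t}"
proof -
  assume t: "normal t" "neighbours t = []"
  have "u = t" if "interchange\<^sup>*\<^sup>* t u" for u
    using that by (induction rule: rtranclp_induct) (use t interchange_neighbours in force)+
  then show ?thesis by (auto simp: reach_def)
qed

text \<open>An isolated type is a class by itself, and these classes are exactly the components that
  receive no number.\<close>

lemma card_connected_classes:
  assumes "finite X" "\<And>t. t \<in> X \<Longrightarrow> normal t"
  shows "card (reach ` {t \<in> X. neighbours t \<noteq> []}) = card (reach ` X) - card {t \<in> X. neighbours t = []}"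
proof -
  let ?A = "{t \<in> X. neighbours t \<noteq> []}" and ?B = "{t \<in> X. neighbours t = []}"
  have single: "reach t = {t}" if "t \<in> ?B" for t
    by (rule isolated_reach) (use that assms(2) in auto)
  have "card (reach ` (?A \<union> ?B)) = card (reach ` ?A) + card (reach ` ?B)"
  proof (rule card_image_Un)
    fix s t assume s: "s \<in> ?A" and t: "t \<in> ?B"
    show "reach s \<noteq> reach t"
    proof
      assume "reach s = reach t"
      then have "s \<in> {t}" using reach_refl[of s] by (simp only: single[OF t])
      then show False using s t by simp
    qed
  qed (use assms(1) in simp_all)
  moreover have "?A \<union> ?B = X" by auto
  moreover have "card (reach ` ?B) = card ?B"
  proof (rule card_image, rule inj_onI)
    fix s t assume "s \<in> ?B" "t \<in> ?B" "reach s = reach t"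
    then show "s = t" using single by (metis singleton_inject)
  qed
  ultimately show ?thesis by simp
qed

lemma card_reach_glue:
  assumes "normal_opt s" "normal_opt t" "solid_opt s"
  shows "card (reach (glue s t)) = card (reach_opt s) * card (reach_opt t)"
proof -
  have "inj_on (case_prod glue) (reach_opt s \<times> reach_opt t)"
  proof (rule inj_onI, clarify)
    fix u v u' v' assume e: "u \<in> reach_opt s" "u' \<in> reach_opt s" "glue u v = glue u' v'"
    show "u = u' \<and> v = v'"
      by (rule glue_inject) (use e assms reach_opt_solid[OF e(1)] reach_opt_solid[OF e(2)]
          reach_opt_normal[OF e(1)] reach_opt_normal[OF e(2)] in auto)
  qed
  then show ?thesis by (simp add: reach_glue[OF assms(1,2)] card_image card_cartesian_product)
qed

text \<open>In degrees 4 to 8 the largest class size in the table of mixed types. The entry for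
  degree 9 is the largest product \<open>size_bound i * size_bound (8 - i)\<close>, attained at
  \<open>i = 0\<close>; it concerns types that are not mixed.\<close>

definition size_bound :: "nat \<Rightarrow> nat" where
  "size_bound n = [1, 1, 1, 1, 2, 3, 6, 13, 38, 38] ! n"

lemma size_bound_mult:
  assumes "n \<le> 9" "i < n" shows "size_bound i * size_bound (n - 1 - i) \<le> size_bound n"
proof -
  have "list_all (\<lambda>n. list_all (\<lambda>i. size_bound i * size_bound (n - 1 - i) \<le> size_bound n) [0..<n]) [0..<10]"
    by (simp add: upt_conv_Cons size_bound_def)
  then show ?thesis using assms by (auto simp: list_all_iff)
qed

text \<open>Around an indeterminate class sizes multiply, in either direction by transposition; for
  mixed types the tables give the bound.\<close>

lemma card_reach_le:
  assumes mixed: "\<And>n t. n \<in> {4..8} \<Longrightarrow> t \<in> mixed n \<Longrightarrow> card (reach t) \<le> size_bound n"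
    and "n \<le> 9" "t \<in> assoc_types n" "n = 9 \<Longrightarrow> t \<notin> mixed 9"
  shows "card (reach t) \<le> size_bound n"
  using assms(2-4)
proof (induction n arbitrary: t rule: less_induct)
  case (less n)
  have opt: "card (reach_opt s) \<le> size_bound (deg_opt s)" if "normal_opt s" "deg_opt s < n" for s :: "unit mono option"
  proof (cases s)
    case None
    then show ?thesis by (simp add: opt_defs size_bound_def)
  next
    case (Some u)
    then have "u \<in> assoc_types (deg_opt s)" using that by (simp add: opt_defs assoc_types_def)
    then have "card (reach u) \<le> size_bound (deg_opt s)" using less that by (intro less.IH) auto
    then show ?thesis using Some by (simp add: reach_opt_def card_image)
  qed
  have nonsolid: "card (reach u) \<le> size_bound n" if u: "u \<in> assoc_types n" "\<not> solid u" for u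
  proof -
    obtain s t where st: "solid_opt s" "normal_opt s" "normal_opt t" "u = glue s t"
      using glue_surj[of u] u unfolding assoc_types_def by blast
    have d: "n = Suc (deg_opt s + deg_opt t)" using u st by (simp add: assoc_types_def glue_deg)
    have "card (reach u) = card (reach_opt s) * card (reach_opt t)" using st by (simp add: card_reach_glue)
    also have "\<dots> \<le> size_bound (deg_opt s) * size_bound (deg_opt t)"
      using st d by (intro mult_mono opt) auto
    also have "\<dots> \<le> size_bound n"
      using size_bound_mult[of n "deg_opt s"] less.prems(1) d by simp
    finally show ?thesis .
  qed
  consider "\<not> solid t" | "\<not> solid (tr t)" | "t \<in> mixed n" using less.prems by (auto simp: mixed_def)
  then show ?case
  proof cases
    case 1 then show ?thesis using nonsolid less.prems by blast
  next
    case 2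
    have "card (reach (tr t)) = card (reach t)"
      unfolding reach_tr by (rule card_image) (metis inj_onI tr_tr)
    then show ?thesis using nonsolid[of "tr t"] 2 less.prems by (simp add: assoc_types_def)
  next
    case 3
    have "mixed 2 = {}" "mixed 3 = {}" using card_mixed_values(1,2) finite_mixed by simp_all
    then have "n \<noteq> 2" "n \<noteq> 3" using 3 by auto
    moreover have "n \<noteq> 0" using 3 by (auto simp: mixed_def assoc_types_def)
    moreover have "n \<noteq> 1"
    proof
      assume "n = 1"
      then have "t = Ind ()" using 3 assoc_types_1 unfolding mixed_def by blast
      then show False using 3 by (simp add: mixed_def)
    qed
    moreover have "n \<noteq> 9" using 3 less.prems by auto
    ultimately have "n \<in> {4..8}" using less.prems(1) by auto
    then show ?thesis using 3 by (rule mixed)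
  qed
qed

definition connected_classes :: "nat \<Rightarrow> unit mono set set" where
  "connected_classes n = reach ` {t \<in> assoc_types n. neighbours t \<noteq> []}"

text \<open>3574 = 2 * (8816 - 7029) counts the connected classes that are not solid in one of the
  two directions. All of them have at most 38 types, so for \<open>N > 38\<close> they all lie below
  \<open>N\<close> and the classes of size \<open>N\<close> are mixed.\<close>

lemma card_small_classes:
  assumes mixed: "\<And>n t. n \<in> {4..8} \<Longrightarrow> t \<in> mixed n \<Longrightarrow> card (reach t) \<le> size_bound n"
    and "card (reach ` mixed 4) = 1" "card (reach ` mixed 5) = 4" "card (reach ` mixed 6) = 14"
      "card (reach ` mixed 7) = 46" "card (reach ` mixed 8) = 139"
    and big: "card {C \<in> reach ` mixed 9. card C < N} = k" and N: "N > 38"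
  shows "card {C \<in> connected_classes 9. card C < N} = 3574 + k"
    and "{C \<in> connected_classes 9. card C = N} = {C \<in> reach ` mixed 9. card C = N}"
proof -
  let ?X = "{t \<in> assoc_types 9. \<not> solid t}" and ?Y = "{t \<in> assoc_types 9. \<not> solid (tr t)}"
  let ?c = "\<lambda>X. {t \<in> X. neighbours t \<noteq> []}"
  have fin: "finite ?X" "finite ?Y" using finite_assoc_types[of 9] by simp_all
  have fin': "finite (?c ?X)" "finite (?c ?Y)" by (simp_all add: finite_assoc_types)
  have eq: "{t \<in> ?X. neighbours t = []} = {t \<in> assoc_types 9. neighbours t = [] \<and> \<not> solid t}"
    "{t \<in> ?Y. neighbours t = []} = {t \<in> assoc_types 9. neighbours t = [] \<and> \<not> solid (tr t)}" by auto
  have c: "card (reach ` ?X) = 8816" "card (reach ` ?Y) = 8816"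
    using classes_nonsolid_count[OF assms(2-6)] classes.card_nonsolid_tr[of 9]
    by (simp_all add: classes.nonsolid_count_def)
  have i: "card {t \<in> ?X. neighbours t = []} = 7029" "card {t \<in> ?Y. neighbours t = []} = 7029"
    using isolated_nonsolid_count isolated.card_nonsolid_tr[of 9]
    unfolding eq by (simp_all add: isolated.nonsolid_count_def)
  have X: "card (reach ` ?c ?X) = 1787" and Y: "card (reach ` ?c ?Y) = 1787"
    using card_connected_classes[OF fin(1)] card_connected_classes[OF fin(2)] c i
    by (simp_all add: assoc_types_def)
  have le: "card (reach t) \<le> 38" if "t \<in> ?X \<union> ?Y" for t
    using card_reach_le[OF mixed, of 9 t] that by (auto simp: size_bound_def mixed_def)
  have split: "{t \<in> assoc_types 9. neighbours t \<noteq> []} = (?c ?X \<union> ?c ?Y) \<union> mixed 9"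
    using mixed_not_isolated[of _ 9] unfolding mixed_def by blast
  have XY: "reach s \<noteq> reach t" if "s \<in> ?c ?X" "t \<in> ?c ?Y" for s t
  proof
    assume "reach s = reach t"
    then have "solid s = solid t" by (rule classes.\<kappa>_solid)
    moreover have "deg t = 9" using that by (simp add: assoc_types_def)
    ultimately show False using types.solid_or_solid_tr[of t] that by simp
  qed
  have XM: "reach s \<noteq> reach t" if "s \<in> ?X \<union> ?Y" "t \<in> mixed 9" for s t
  proof
    assume "reach s = reach t"
    then have "solid s = solid t" "solid (tr s) = solid (tr t)"
      using classes.\<kappa>_solid classes.\<kappa>_solid_tr by blast+
    then show False using that by (auto simp: mixed_def)
  qed
  let ?M = "{t \<in> mixed 9. card (reach t) < N}"
  have finM: "finite ?M" by (simp add: finite_mixed)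
  have XM': "reach s \<noteq> reach t" if "s \<in> ?c ?X \<union> ?c ?Y" "t \<in> ?M" for s t
    using XM[of s t] that by blast
  have "{C \<in> connected_classes 9. card C < N} = reach ` ((?c ?X \<union> ?c ?Y) \<union> ?M)"
    unfolding connected_classes_def split using le N by fastforce
  then have "card {C \<in> connected_classes 9. card C < N} = card (reach ` ((?c ?X \<union> ?c ?Y) \<union> ?M))"
    by (rule arg_cong)
  also have "\<dots> = card (reach ` (?c ?X \<union> ?c ?Y)) + card (reach ` ?M)"
    by (rule card_image_Un[OF finite_UnI[OF fin'] finM XM'])
  also have "\<dots> = card (reach ` ?c ?X) + card (reach ` ?c ?Y) + card (reach ` ?M)"
    by (simp only: card_image_Un[OF fin' XY])
  also have "\<dots> = 1787 + 1787 + k"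
  proof -
    have "reach ` ?M = {C \<in> reach ` mixed 9. card C < N}" by auto
    then show ?thesis by (simp only: X Y big)
  qed
  finally show "card {C \<in> connected_classes 9. card C < N} = 3574 + k" by simp
  show "{C \<in> connected_classes 9. card C = N} = {C \<in> reach ` mixed 9. card C = N}"
    unfolding connected_classes_def split using le N by fastforce
qed

section \<open>Mixed classes up to degree 9\<close>

abbreviation (input) I :: "unit mono" where "I \<equiv> Ind ()"

text \<open>
  Each table lists, by class size, the least element (for \<open>cmp_unit\<close>) of every class of mixed types
  of the given degree. A table is complete because its sizes add up to the number of mixed types.
\<close>

definition class_table_4 :: "(nat \<times> unit mono list) list" where
  "class_table_4 = [(2, [H (V I I) (V I I)])]"

definition class_table_5 :: "(nat \<times> unit mono list) list" where
  "class_table_5 = [(3, [H (V I I) (V I (H I I)), H (V I I) (V I (V I I)), H (V I I) (V (H I I) I), H (V I (V I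
      I)) (V I I)])]"

definition class_table_6 :: "(nat \<times> unit mono list) list" where
  "class_table_6 = [(3, [H (V I I) (V I (H (V I I) I)), H (V I I) (V I (V (H I I) I)), H (V I I) (V (H (V I I)
      I) I), H (V I (V (H I I) I)) (V I I)]),
   (4, [H (V I I) (V I (H I (H I I))), H (V I I) (V I (V I (V I I))), H (V I I) (V (H I (H I I)) I), H (V I (V I
      (V I I))) (V I I)]),
   (6, [H (V I I) (H (V I I) (V I I)), H (V I I) (V I (H I (V I I))), H (V I I) (V (H I I) (V I I)), H (V I (H
      (V I I) I)) (V I I), H (V I (V I I)) (V I (V I I)), H (V I (V I I)) (V (H I I) I)])]"

definition class_table_7 :: "(nat \<times> unit mono list) list" where
  "class_table_7 = [(3, [H (V I I) (V I (H (V I (H I I)) I)), H (V I I) (V I (H (V I (V I I)) I)), H (V I I) (V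
      I (H (V (H I I) I) I)), H (V I I) (V I (V (H I (H I I)) I)), H (V I I) (V I (V (H I (V I I)) I)), H (V I
      I) (V I (V (H (V I I) I) I)), H (V I I) (V (H (V I (H I I)) I) I), H (V I I) (V (H (V I (V I I)) I) I), H
      (V I I) (V (H (V (H I I) I) I) I), H (V I (V (H I (H I I)) I)) (V I I), H (V I (V (H I (V I I)) I)) (V I
      I), H (V I (V (H (V I I) I) I)) (V I I)]),
   (4, [H (V I I) (V I (H I (H (V I I) I))), H (V I I) (V I (H (V I I) (H I I))), H (V I I) (V I (V I (V (H I I)
      I))), H (V I I) (V I (V (H I I) (V I I))), H (V I I) (V (H I (H (V I I) I)) I), H (V I I) (V (H (V I I) (H
      I I)) I), H (V I (V I (V (H I I) I))) (V I I), H (V I (V (H I I) (V I I))) (V I I)]),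
   (5, [H (V I I) (V I (H I (H I (H I I)))), H (V I I) (V I (V I (V I (V I I)))), H (V I I) (V (H I (H I (H I
      I))) I), H (V I (V I (V I (V I I)))) (V I I)]),
   (10, [H (V I I) (H (V I I) (V I (H I I))), H (V I I) (H (V I I) (V (H I I) I)), H (V I I) (V I (H I (H I (V I
      I)))), H (V I I) (V I (H I (V I (V I I)))), H (V I I) (V (H I I) (V I (V I I))), H (V I I) (V (H I (H I
      I)) (V I I)), H (V I (H (V I I) I)) (V I (H I I)), H (V I (H (V I (V I I)) I)) (V I I), H (V I (V I I)) (V
      I (V I (V I I))), H (V I (V I I)) (V (H I (H I I)) I), H (V I (V I (V I I))) (V I (V I I)), H (V I (V I (V
      I I))) (V (H I I) I)]),
   (11, [H (V I I) (H (V I (V I I)) (V I I)), H (V I (V I I)) (V I (V (H I I) I))]),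
   (12, [H (V I I) (V I (H I (V (H I I) I))), H (V I I) (V (H I I) (V (H I I) I)), H (V I (H (V I I) (V I I)))
      (V I I), H (V I (V I I)) (V (H (V I I) I) I)]),
   (13, [H (V I I) (H (V I I) (V I (V I I))), H (V I (H (V I I) I)) (V I (V I I)), H (V I (H (V I I) I)) (V (H I
      I) I), H (V I (V I I)) (V (H I I) (V I I))])]"

definition class_table_8 :: "(nat \<times> unit mono list) list" where
  "class_table_8 = [(3, [H (V I I) (V I (H (V I (H I (H I I))) I)), H (V I I) (V I (H (V I (H I (V I I))) I)), H
      (V I I) (V I (H (V I (H (V I I) I)) I)), H (V I I) (V I (H (V I (V I (H I I))) I)), H (V I I) (V I (H (V I
      (V I (V I I))) I)), H (V I I) (V I (H (V I (V (H I I) I)) I)), H (V I I) (V I (H (V (H I I) (V I I)) I)),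
      H (V I I) (V I (H (V (H I (H I I)) I) I)), H (V I I) (V I (H (V (H I (V I I)) I) I)), H (V I I) (V I (H (V
      (H (V I I) I) I) I)), H (V I I) (V I (V (H I (H I (H I I))) I)), H (V I I) (V I (V (H I (H I (V I I)))
      I)), H (V I I) (V I (V (H I (H (V I I) I)) I)), H (V I I) (V I (V (H I (V I (H I I))) I)), H (V I I) (V I
      (V (H I (V I (V I I))) I)), H (V I I) (V I (V (H I (V (H I I) I)) I)), H (V I I) (V I (V (H (V I I) (H I
      I)) I)), H (V I I) (V I (V (H (V I (H I I)) I) I)), H (V I I) (V I (V (H (V I (V I I)) I) I)), H (V I I)
      (V I (V (H (V (H I I) I) I) I)), H (V I I) (V (H (V I (H I (H I I))) I) I), H (V I I) (V (H (V I (H I (V I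
      I))) I) I), H (V I I) (V (H (V I (H (V I I) I)) I) I), H (V I I) (V (H (V I (V I (H I I))) I) I), H (V I
      I) (V (H (V I (V I (V I I))) I) I), H (V I I) (V (H (V I (V (H I I) I)) I) I), H (V I I) (V (H (V (H I I)
      (V I I)) I) I), H (V I I) (V (H (V (H I (H I I)) I) I) I), H (V I I) (V (H (V (H I (V I I)) I) I) I), H (V
      I I) (V (H (V (H (V I I) I) I) I) I), H (V I (V (H I (H I (H I I))) I)) (V I I), H (V I (V (H I (H I (V I
      I))) I)) (V I I), H (V I (V (H I (H (V I I) I)) I)) (V I I), H (V I (V (H I (V I (H I I))) I)) (V I I), H
      (V I (V (H I (V I (V I I))) I)) (V I I), H (V I (V (H I (V (H I I) I)) I)) (V I I), H (V I (V (H (V I I)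
      (H I I)) I)) (V I I), H (V I (V (H (V I (H I I)) I) I)) (V I I), H (V I (V (H (V I (V I I)) I) I)) (V I
      I), H (V I (V (H (V (H I I) I) I) I)) (V I I)]),
   (4, [H (V I I) (V I (H I (H (V I (H I I)) I))), H (V I I) (V I (H I (H (V I (V I I)) I))), H (V I I) (V I (H
      I (H (V (H I I) I) I))), H (V I I) (V I (H (V I (H I I)) (H I I))), H (V I I) (V I (H (V I (V I I)) (H I
      I))), H (V I I) (V I (H (V (H I I) I) (H I I))), H (V I I) (V I (V I (V (H I (H I I)) I))), H (V I I) (V I
      (V I (V (H I (V I I)) I))), H (V I I) (V I (V I (V (H (V I I) I) I))), H (V I I) (V I (V (H I (H I I)) (V
      I I))), H (V I I) (V I (V (H I (V I I)) (V I I))), H (V I I) (V I (V (H (V I I) I) (V I I))), H (V I I) (V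
      (H I (H (V I (H I I)) I)) I), H (V I I) (V (H I (H (V I (V I I)) I)) I), H (V I I) (V (H I (H (V (H I I)
      I) I)) I), H (V I I) (V (H (V I (H I I)) (H I I)) I), H (V I I) (V (H (V I (V I I)) (H I I)) I), H (V I I)
      (V (H (V (H I I) I) (H I I)) I), H (V I (V I (V (H I (H I I)) I))) (V I I), H (V I (V I (V (H I (V I I))
      I))) (V I I), H (V I (V I (V (H (V I I) I) I))) (V I I), H (V I (V (H I (H I I)) (V I I))) (V I I), H (V I
      (V (H I (V I I)) (V I I))) (V I I), H (V I (V (H (V I I) I) (V I I))) (V I I)]),
   (5, [H (V I I) (V I (H I (H I (H (V I I) I)))), H (V I I) (V I (H I (H (V I I) (H I I)))), H (V I I) (V I (H
      (V I I) (H I (H I I)))), H (V I I) (V I (V I (V I (V (H I I) I)))), H (V I I) (V I (V I (V (H I I) (V I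
      I)))), H (V I I) (V I (V (H I I) (V I (V I I)))), H (V I I) (V (H I (H I (H (V I I) I))) I), H (V I I) (V
      (H I (H (V I I) (H I I))) I), H (V I I) (V (H (V I I) (H I (H I I))) I), H (V I (V I (V I (V (H I I) I))))
      (V I I), H (V I (V I (V (H I I) (V I I)))) (V I I), H (V I (V (H I I) (V I (V I I)))) (V I I)]),
   (6, [H (V I I) (V I (H I (H I (H I (H I I))))), H (V I I) (V I (V I (V I (V I (V I I))))), H (V I I) (V (H I
      (H I (H I (H I I)))) I), H (V I (V I (V I (V I (V I I))))) (V I I)]),
   (7, [H (V I I) (V I (H (V I I) (H (V I I) I))), H (V I I) (V I (V (H I I) (V (H I I) I))), H (V I I) (V (H (V
      I I) (H (V I I) I)) I), H (V I (V (H I I) (V (H I I) I))) (V I I)]),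
   (11, [H (V I I) (H (V I (V (H I I) I)) (V I I)), H (V I (V I I)) (V I (V (H (V I I) I) I))]),
   (15, [H (V I I) (H (V I I) (V I (H I (H I I)))), H (V I I) (H (V I I) (V (H I (H I I)) I)), H (V I I) (V I (H
      I (H I (H I (V I I))))), H (V I I) (V I (H I (V I (V I (V I I))))), H (V I I) (V (H I I) (V I (V I (V I
      I)))), H (V I I) (V (H I (H I (H I I))) (V I I)), H (V I (H (V I I) I)) (V I (H I (H I I))), H (V I (H (V
      I (V I (V I I))) I)) (V I I), H (V I (V I I)) (V I (V I (V I (V I I)))), H (V I (V I I)) (V (H I (H I (H I
      I))) I), H (V I (V I (V I (V I I)))) (V I (V I I)), H (V I (V I (V I (V I I)))) (V (H I I) I)]),
   (16, [H (V I I) (H (V I (V I (V I I))) (V I I)), H (V I (V I I)) (V I (V (H I (H I I)) I))]),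
   (20, [H (V I I) (H (V I I) (H (V I I) (V I I))), H (V I I) (V I (H I (H I (V I (V I I))))), H (V I I) (V (H I
      (H I I)) (V I (V I I))), H (V I (H (V I (H (V I I) I)) I)) (V I I), H (V I (V I (V I I))) (V I (V I (V I
      I))), H (V I (V I (V I I))) (V (H I (H I I)) I)]),
   (24, [H (V I I) (H (V I I) (V I (H I (V I I)))), H (V I I) (H (V I I) (V I (V I (V I I)))), H (V I I) (H (V I
      I) (V (H I I) (V I I))), H (V I (H (V I I) I)) (H (V I I) (V I I)), H (V I (H (V I I) I)) (V I (H I (V I
      I))), H (V I (H (V I I) I)) (V I (V I (V I I))), H (V I (H (V I I) I)) (V (H I (H I I)) I), H (V I (H (V I
      (V I I)) I)) (V I (V I I)), H (V I (H (V I (V I I)) I)) (V (H I I) I), H (V I (V I I)) (V (H I I) (V I (V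
      I I))), H (V I (V I I)) (V (H I (H I I)) (V I I)), H (V I (V I (V I I))) (V (H I I) (V I I))]),
   (30, [H (V I I) (V I (H I (V (H I (H I I)) I))), H (V I I) (V (H I I) (V (H I (H I I)) I)), H (V I (H (V I I)
      I)) (V (H I I) (V I I)), H (V I (H (V I I) (V I (V I I)))) (V I I), H (V I (V I I)) (V (H (V I (H I I)) I)
      I)]),
   (33, [H (V I I) (H (V I I) (V I (H (V I I) I))), H (V I I) (H (V I I) (V (H (V I I) I) I)), H (V I (V I I))
      (V I (V I (V (H I I) I))), H (V I (V I (V I I))) (V I (V (H I I) I))]),
   (36, [H (V I I) (V I (H I (H I (V (H I I) I)))), H (V I I) (V I (H I (V I (V (H I I) I)))), H (V I I) (V (H I
      I) (V I (V (H I I) I))), H (V I I) (V (H I (H I I)) (V (H I I) I)), H (V I (H (V I I) I)) (V I (H (V I I)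
      I)), H (V I (H (V I (V I I)) (V I I))) (V I I), H (V I (V I I)) (V (H I (H (V I I) I)) I), H (V I (V I (V
      I I))) (V (H (V I I) I) I)]),
   (38, [H (V I I) (H (V I I) (V I (V (H I I) I))), H (V I (H (V I I) I)) (V I (V (H I I) I)), H (V I (H (V I I)
      I)) (V (H (V I I) I) I), H (V I (V I I)) (V (H I I) (V (H I I) I))])]"

definition class_table_9 :: "(nat \<times> unit mono list) list" where
  "class_table_9 = [(3, [H (V I I) (V I (H (V I (H I (H I (H I I)))) I)), H (V I I) (V I (H (V I (H I (H I (V I
      I)))) I)), H (V I I) (V I (H (V I (H I (H (V I I) I))) I)), H (V I I) (V I (H (V I (H I (V I (H I I))))
      I)), H (V I I) (V I (H (V I (H I (V I (V I I)))) I)), H (V I I) (V I (H (V I (H I (V (H I I) I))) I)), H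
      (V I I) (V I (H (V I (H (V I I) (H I I))) I)), H (V I I) (V I (H (V I (H (V I (H I I)) I)) I)), H (V I I)
      (V I (H (V I (H (V I (V I I)) I)) I)), H (V I I) (V I (H (V I (H (V (H I I) I) I)) I)), H (V I I) (V I (H
      (V I (V I (H I (H I I)))) I)), H (V I I) (V I (H (V I (V I (H I (V I I)))) I)), H (V I I) (V I (H (V I (V
      I (H (V I I) I))) I)), H (V I I) (V I (H (V I (V I (V I (H I I)))) I)), H (V I I) (V I (H (V I (V I (V I
      (V I I)))) I)), H (V I I) (V I (H (V I (V I (V (H I I) I))) I)), H (V I I) (V I (H (V I (V (H I I) (V I
      I))) I)), H (V I I) (V I (H (V I (V (H I (H I I)) I)) I)), H (V I I) (V I (H (V I (V (H I (V I I)) I))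
      I)), H (V I I) (V I (H (V I (V (H (V I I) I) I)) I)), H (V I I) (V I (H (V (H I I) (V I (H I I))) I)), H
      (V I I) (V I (H (V (H I I) (V I (V I I))) I)), H (V I I) (V I (H (V (H I (H I I)) (V I I)) I)), H (V I I)
      (V I (H (V (H I (H I (H I I))) I) I)), H (V I I) (V I (H (V (H I (H I (V I I))) I) I)), H (V I I) (V I (H
      (V (H I (H (V I I) I)) I) I)), H (V I I) (V I (H (V (H I (V I I)) (V I I)) I)), H (V I I) (V I (H (V (H I
      (V I (H I I))) I) I)), H (V I I) (V I (H (V (H I (V I (V I I))) I) I)), H (V I I) (V I (H (V (H I (V (H I
      I) I)) I) I)), H (V I I) (V I (H (V (H (V I I) I) (V I I)) I)), H (V I I) (V I (H (V (H (V I I) (H I I))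
      I) I)), H (V I I) (V I (H (V (H (V I (H I I)) I) I) I)), H (V I I) (V I (H (V (H (V I (V I I)) I) I) I)),
      H (V I I) (V I (H (V (H (V (H I I) I) I) I) I)), H (V I I) (V I (V (H I (H I (H I (H I I)))) I)), H (V I
      I) (V I (V (H I (H I (H I (V I I)))) I)), H (V I I) (V I (V (H I (H I (H (V I I) I))) I)), H (V I I) (V I
      (V (H I (H I (V I (H I I)))) I)), H (V I I) (V I (V (H I (H I (V I (V I I)))) I)), H (V I I) (V I (V (H I
      (H I (V (H I I) I))) I)), H (V I I) (V I (V (H I (H (V I I) (H I I))) I)), H (V I I) (V I (V (H I (H (V I
      (H I I)) I)) I)), H (V I I) (V I (V (H I (H (V I (V I I)) I)) I)), H (V I I) (V I (V (H I (H (V (H I I) I)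
      I)) I)), H (V I I) (V I (V (H I (V I (H I (H I I)))) I)), H (V I I) (V I (V (H I (V I (H I (V I I)))) I)),
      H (V I I) (V I (V (H I (V I (H (V I I) I))) I)), H (V I I) (V I (V (H I (V I (V I (H I I)))) I)), H (V I
      I) (V I (V (H I (V I (V I (V I I)))) I)), H (V I I) (V I (V (H I (V I (V (H I I) I))) I)), H (V I I) (V I
      (V (H I (V (H I I) (V I I))) I)), H (V I I) (V I (V (H I (V (H I (H I I)) I)) I)), H (V I I) (V I (V (H I
      (V (H I (V I I)) I)) I)), H (V I I) (V I (V (H I (V (H (V I I) I) I)) I)), H (V I I) (V I (V (H (V I I) (H
      I (H I I))) I)), H (V I I) (V I (V (H (V I I) (H I (V I I))) I)), H (V I I) (V I (V (H (V I (H I I)) (H I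
      I)) I)), H (V I I) (V I (V (H (V I (H I (H I I))) I) I)), H (V I I) (V I (V (H (V I (H I (V I I))) I) I)),
      H (V I I) (V I (V (H (V I (H (V I I) I)) I) I)), H (V I I) (V I (V (H (V I (V I I)) (H I I)) I)), H (V I
      I) (V I (V (H (V I (V I (H I I))) I) I)), H (V I I) (V I (V (H (V I (V I (V I I))) I) I)), H (V I I) (V I
      (V (H (V I (V (H I I) I)) I) I)), H (V I I) (V I (V (H (V (H I I) I) (H I I)) I)), H (V I I) (V I (V (H (V
      (H I I) (V I I)) I) I)), H (V I I) (V I (V (H (V (H I (H I I)) I) I) I)), H (V I I) (V I (V (H (V (H I (V
      I I)) I) I) I)), H (V I I) (V I (V (H (V (H (V I I) I) I) I) I)), H (V I I) (V (H (V I (H I (H I (H I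
      I)))) I) I), H (V I I) (V (H (V I (H I (H I (V I I)))) I) I), H (V I I) (V (H (V I (H I (H (V I I) I))) I)
      I), H (V I I) (V (H (V I (H I (V I (H I I)))) I) I), H (V I I) (V (H (V I (H I (V I (V I I)))) I) I), H (V
      I I) (V (H (V I (H I (V (H I I) I))) I) I), H (V I I) (V (H (V I (H (V I I) (H I I))) I) I), H (V I I) (V
      (H (V I (H (V I (H I I)) I)) I) I), H (V I I) (V (H (V I (H (V I (V I I)) I)) I) I), H (V I I) (V (H (V I
      (H (V (H I I) I) I)) I) I), H (V I I) (V (H (V I (V I (H I (H I I)))) I) I), H (V I I) (V (H (V I (V I (H
      I (V I I)))) I) I), H (V I I) (V (H (V I (V I (H (V I I) I))) I) I), H (V I I) (V (H (V I (V I (V I (H I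
      I)))) I) I), H (V I I) (V (H (V I (V I (V I (V I I)))) I) I), H (V I I) (V (H (V I (V I (V (H I I) I))) I)
      I), H (V I I) (V (H (V I (V (H I I) (V I I))) I) I), H (V I I) (V (H (V I (V (H I (H I I)) I)) I) I), H (V
      I I) (V (H (V I (V (H I (V I I)) I)) I) I), H (V I I) (V (H (V I (V (H (V I I) I) I)) I) I), H (V I I) (V
      (H (V (H I I) (V I (H I I))) I) I), H (V I I) (V (H (V (H I I) (V I (V I I))) I) I), H (V I I) (V (H (V (H
      I (H I I)) (V I I)) I) I), H (V I I) (V (H (V (H I (H I (H I I))) I) I) I), H (V I I) (V (H (V (H I (H I
      (V I I))) I) I) I), H (V I I) (V (H (V (H I (H (V I I) I)) I) I) I), H (V I I) (V (H (V (H I (V I I)) (V I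
      I)) I) I), H (V I I) (V (H (V (H I (V I (H I I))) I) I) I), H (V I I) (V (H (V (H I (V I (V I I))) I) I)
      I), H (V I I) (V (H (V (H I (V (H I I) I)) I) I) I), H (V I I) (V (H (V (H (V I I) I) (V I I)) I) I), H (V
      I I) (V (H (V (H (V I I) (H I I)) I) I) I), H (V I I) (V (H (V (H (V I (H I I)) I) I) I) I), H (V I I) (V
      (H (V (H (V I (V I I)) I) I) I) I), H (V I I) (V (H (V (H (V (H I I) I) I) I) I) I), H (V I (V (H I (H I
      (H I (H I I)))) I)) (V I I), H (V I (V (H I (H I (H I (V I I)))) I)) (V I I), H (V I (V (H I (H I (H (V I
      I) I))) I)) (V I I), H (V I (V (H I (H I (V I (H I I)))) I)) (V I I), H (V I (V (H I (H I (V I (V I I))))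
      I)) (V I I), H (V I (V (H I (H I (V (H I I) I))) I)) (V I I), H (V I (V (H I (H (V I I) (H I I))) I)) (V I
      I), H (V I (V (H I (H (V I (H I I)) I)) I)) (V I I), H (V I (V (H I (H (V I (V I I)) I)) I)) (V I I), H (V
      I (V (H I (H (V (H I I) I) I)) I)) (V I I), H (V I (V (H I (V I (H I (H I I)))) I)) (V I I), H (V I (V (H
      I (V I (H I (V I I)))) I)) (V I I), H (V I (V (H I (V I (H (V I I) I))) I)) (V I I), H (V I (V (H I (V I
      (V I (H I I)))) I)) (V I I), H (V I (V (H I (V I (V I (V I I)))) I)) (V I I), H (V I (V (H I (V I (V (H I
      I) I))) I)) (V I I), H (V I (V (H I (V (H I I) (V I I))) I)) (V I I), H (V I (V (H I (V (H I (H I I)) I))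
      I)) (V I I), H (V I (V (H I (V (H I (V I I)) I)) I)) (V I I), H (V I (V (H I (V (H (V I I) I) I)) I)) (V I
      I), H (V I (V (H (V I I) (H I (H I I))) I)) (V I I), H (V I (V (H (V I I) (H I (V I I))) I)) (V I I), H (V
      I (V (H (V I (H I I)) (H I I)) I)) (V I I), H (V I (V (H (V I (H I (H I I))) I) I)) (V I I), H (V I (V (H
      (V I (H I (V I I))) I) I)) (V I I), H (V I (V (H (V I (H (V I I) I)) I) I)) (V I I), H (V I (V (H (V I (V
      I I)) (H I I)) I)) (V I I), H (V I (V (H (V I (V I (H I I))) I) I)) (V I I), H (V I (V (H (V I (V I (V I
      I))) I) I)) (V I I), H (V I (V (H (V I (V (H I I) I)) I) I)) (V I I), H (V I (V (H (V (H I I) I) (H I I))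
      I)) (V I I), H (V I (V (H (V (H I I) (V I I)) I) I)) (V I I), H (V I (V (H (V (H I (H I I)) I) I) I)) (V I
      I), H (V I (V (H (V (H I (V I I)) I) I) I)) (V I I), H (V I (V (H (V (H (V I I) I) I) I) I)) (V I I)]),
   (4, [H (V I I) (V I (H I (H (V I (H I (H I I))) I))), H (V I I) (V I (H I (H (V I (H I (V I I))) I))), H (V I
      I) (V I (H I (H (V I (H (V I I) I)) I))), H (V I I) (V I (H I (H (V I (V I (H I I))) I))), H (V I I) (V I
      (H I (H (V I (V I (V I I))) I))), H (V I I) (V I (H I (H (V I (V (H I I) I)) I))), H (V I I) (V I (H I (H
      (V (H I I) (V I I)) I))), H (V I I) (V I (H I (H (V (H I (H I I)) I) I))), H (V I I) (V I (H I (H (V (H I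
      (V I I)) I) I))), H (V I I) (V I (H I (H (V (H (V I I) I) I) I))), H (V I I) (V I (H (V I (H I (H I I)))
      (H I I))), H (V I I) (V I (H (V I (H I (V I I))) (H I I))), H (V I I) (V I (H (V I (H (V I I) I)) (H I
      I))), H (V I I) (V I (H (V I (V I (H I I))) (H I I))), H (V I I) (V I (H (V I (V I (V I I))) (H I I))), H
      (V I I) (V I (H (V I (V (H I I) I)) (H I I))), H (V I I) (V I (H (V (H I I) (V I I)) (H I I))), H (V I I)
      (V I (H (V (H I (H I I)) I) (H I I))), H (V I I) (V I (H (V (H I (V I I)) I) (H I I))), H (V I I) (V I (H
      (V (H (V I I) I) I) (H I I))), H (V I I) (V I (V I (V (H I (H I (H I I))) I))), H (V I I) (V I (V I (V (H
      I (H I (V I I))) I))), H (V I I) (V I (V I (V (H I (H (V I I) I)) I))), H (V I I) (V I (V I (V (H I (V I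
      (H I I))) I))), H (V I I) (V I (V I (V (H I (V I (V I I))) I))), H (V I I) (V I (V I (V (H I (V (H I I)
      I)) I))), H (V I I) (V I (V I (V (H (V I I) (H I I)) I))), H (V I I) (V I (V I (V (H (V I (H I I)) I)
      I))), H (V I I) (V I (V I (V (H (V I (V I I)) I) I))), H (V I I) (V I (V I (V (H (V (H I I) I) I) I))), H
      (V I I) (V I (V (H I (H I (H I I))) (V I I))), H (V I I) (V I (V (H I (H I (V I I))) (V I I))), H (V I I)
      (V I (V (H I (H (V I I) I)) (V I I))), H (V I I) (V I (V (H I (V I (H I I))) (V I I))), H (V I I) (V I (V
      (H I (V I (V I I))) (V I I))), H (V I I) (V I (V (H I (V (H I I) I)) (V I I))), H (V I I) (V I (V (H (V I
      I) (H I I)) (V I I))), H (V I I) (V I (V (H (V I (H I I)) I) (V I I))), H (V I I) (V I (V (H (V I (V I I))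
      I) (V I I))), H (V I I) (V I (V (H (V (H I I) I) I) (V I I))), H (V I I) (V (H I (H (V I (H I (H I I)))
      I)) I), H (V I I) (V (H I (H (V I (H I (V I I))) I)) I), H (V I I) (V (H I (H (V I (H (V I I) I)) I)) I),
      H (V I I) (V (H I (H (V I (V I (H I I))) I)) I), H (V I I) (V (H I (H (V I (V I (V I I))) I)) I), H (V I
      I) (V (H I (H (V I (V (H I I) I)) I)) I), H (V I I) (V (H I (H (V (H I I) (V I I)) I)) I), H (V I I) (V (H
      I (H (V (H I (H I I)) I) I)) I), H (V I I) (V (H I (H (V (H I (V I I)) I) I)) I), H (V I I) (V (H I (H (V
      (H (V I I) I) I) I)) I), H (V I I) (V (H (V I (H I (H I I))) (H I I)) I), H (V I I) (V (H (V I (H I (V I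
      I))) (H I I)) I), H (V I I) (V (H (V I (H (V I I) I)) (H I I)) I), H (V I I) (V (H (V I (V I (H I I))) (H
      I I)) I), H (V I I) (V (H (V I (V I (V I I))) (H I I)) I), H (V I I) (V (H (V I (V (H I I) I)) (H I I))
      I), H (V I I) (V (H (V (H I I) (V I I)) (H I I)) I), H (V I I) (V (H (V (H I (H I I)) I) (H I I)) I), H (V
      I I) (V (H (V (H I (V I I)) I) (H I I)) I), H (V I I) (V (H (V (H (V I I) I) I) (H I I)) I), H (V I (V I
      (V (H I (H I (H I I))) I))) (V I I), H (V I (V I (V (H I (H I (V I I))) I))) (V I I), H (V I (V I (V (H I
      (H (V I I) I)) I))) (V I I), H (V I (V I (V (H I (V I (H I I))) I))) (V I I), H (V I (V I (V (H I (V I (V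
      I I))) I))) (V I I), H (V I (V I (V (H I (V (H I I) I)) I))) (V I I), H (V I (V I (V (H (V I I) (H I I))
      I))) (V I I), H (V I (V I (V (H (V I (H I I)) I) I))) (V I I), H (V I (V I (V (H (V I (V I I)) I) I))) (V
      I I), H (V I (V I (V (H (V (H I I) I) I) I))) (V I I), H (V I (V (H I (H I (H I I))) (V I I))) (V I I), H
      (V I (V (H I (H I (V I I))) (V I I))) (V I I), H (V I (V (H I (H (V I I) I)) (V I I))) (V I I), H (V I (V
      (H I (V I (H I I))) (V I I))) (V I I), H (V I (V (H I (V I (V I I))) (V I I))) (V I I), H (V I (V (H I (V
      (H I I) I)) (V I I))) (V I I), H (V I (V (H (V I I) (H I I)) (V I I))) (V I I), H (V I (V (H (V I (H I I))
      I) (V I I))) (V I I), H (V I (V (H (V I (V I I)) I) (V I I))) (V I I), H (V I (V (H (V (H I I) I) I) (V I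
      I))) (V I I)]),
   (5, [H (V I I) (V I (H I (H I (H (V I (H I I)) I)))), H (V I I) (V I (H I (H I (H (V I (V I I)) I)))), H (V I
      I) (V I (H I (H I (H (V (H I I) I) I)))), H (V I I) (V I (H I (H (V I (H I I)) (H I I)))), H (V I I) (V I
      (H I (H (V I (V I I)) (H I I)))), H (V I I) (V I (H I (H (V (H I I) I) (H I I)))), H (V I I) (V I (H (V I
      I) (H I (H (V I I) I)))), H (V I I) (V I (H (V I (H I I)) (H I (H I I)))), H (V I I) (V I (H (V I (V I I))
      (H I (H I I)))), H (V I I) (V I (H (V (H I I) I) (H I (H I I)))), H (V I I) (V I (V I (V I (V (H I (H I
      I)) I)))), H (V I I) (V I (V I (V I (V (H I (V I I)) I)))), H (V I I) (V I (V I (V I (V (H (V I I) I)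
      I)))), H (V I I) (V I (V I (V (H I (H I I)) (V I I)))), H (V I I) (V I (V I (V (H I (V I I)) (V I I)))), H
      (V I I) (V I (V I (V (H (V I I) I) (V I I)))), H (V I I) (V I (V (H I I) (V I (V (H I I) I)))), H (V I I)
      (V I (V (H I (H I I)) (V I (V I I)))), H (V I I) (V I (V (H I (V I I)) (V I (V I I)))), H (V I I) (V I (V
      (H (V I I) I) (V I (V I I)))), H (V I I) (V (H I (H I (H (V I (H I I)) I))) I), H (V I I) (V (H I (H I (H
      (V I (V I I)) I))) I), H (V I I) (V (H I (H I (H (V (H I I) I) I))) I), H (V I I) (V (H I (H (V I (H I I))
      (H I I))) I), H (V I I) (V (H I (H (V I (V I I)) (H I I))) I), H (V I I) (V (H I (H (V (H I I) I) (H I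
      I))) I), H (V I I) (V (H (V I I) (H I (H (V I I) I))) I), H (V I I) (V (H (V I (H I I)) (H I (H I I))) I),
      H (V I I) (V (H (V I (V I I)) (H I (H I I))) I), H (V I I) (V (H (V (H I I) I) (H I (H I I))) I), H (V I
      (V I (V I (V (H I (H I I)) I)))) (V I I), H (V I (V I (V I (V (H I (V I I)) I)))) (V I I), H (V I (V I (V
      I (V (H (V I I) I) I)))) (V I I), H (V I (V I (V (H I (H I I)) (V I I)))) (V I I), H (V I (V I (V (H I (V
      I I)) (V I I)))) (V I I), H (V I (V I (V (H (V I I) I) (V I I)))) (V I I), H (V I (V (H I I) (V I (V (H I
      I) I)))) (V I I), H (V I (V (H I (H I I)) (V I (V I I)))) (V I I), H (V I (V (H I (V I I)) (V I (V I I))))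
      (V I I), H (V I (V (H (V I I) I) (V I (V I I)))) (V I I)]),
   (6, [H (V I I) (V I (H I (H I (H I (H (V I I) I))))), H (V I I) (V I (H I (H I (H (V I I) (H I I))))), H (V I
      I) (V I (H I (H (V I I) (H I (H I I))))), H (V I I) (V I (H (V I I) (H I (H I (H I I))))), H (V I I) (V I
      (H (V I (H (V I I) (V I I))) I)), H (V I I) (V I (H (V (H I I) (V (H I I) I)) I)), H (V I I) (V I (V I (V
      I (V I (V (H I I) I))))), H (V I I) (V I (V I (V I (V (H I I) (V I I))))), H (V I I) (V I (V I (V (H I I)
      (V I (V I I))))), H (V I I) (V I (V (H I I) (V I (V I (V I I))))), H (V I I) (V I (V (H I (H (V I I) (V I
      I))) I)), H (V I I) (V I (V (H (V I I) (H (V I I) I)) I)), H (V I I) (V (H I (H I (H I (H (V I I) I))))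
      I), H (V I I) (V (H I (H I (H (V I I) (H I I)))) I), H (V I I) (V (H I (H (V I I) (H I (H I I)))) I), H (V
      I I) (V (H (V I I) (H I (H I (H I I)))) I), H (V I I) (V (H (V I (H (V I I) (V I I))) I) I), H (V I I) (V
      (H (V (H I I) (V (H I I) I)) I) I), H (V I (V I (V I (V I (V (H I I) I))))) (V I I), H (V I (V I (V I (V
      (H I I) (V I I))))) (V I I), H (V I (V I (V (H I I) (V I (V I I))))) (V I I), H (V I (V (H I I) (V I (V I
      (V I I))))) (V I I), H (V I (V (H I (H (V I I) (V I I))) I)) (V I I), H (V I (V (H (V I I) (H (V I I) I))
      I)) (V I I)]),
   (7, [H (V I I) (V I (H I (H I (H I (H I (H I I)))))), H (V I I) (V I (V I (V I (V I (V I (V I I)))))), H (V I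
      I) (V (H I (H I (H I (H I (H I I))))) I), H (V I (V I (V I (V I (V I (V I I)))))) (V I I)]),
   (9, [H (V I I) (V I (H I (H (V I I) (H (V I I) I)))), H (V I I) (V I (H (V I I) (H (V I I) (H I I)))), H (V I
      I) (V I (V I (V (H I I) (V (H I I) I)))), H (V I I) (V I (V (H I I) (V (H I I) (V I I)))), H (V I I) (V (H
      I (H (V I I) (H (V I I) I))) I), H (V I I) (V (H (V I I) (H (V I I) (H I I))) I), H (V I (V I (V (H I I)
      (V (H I I) I)))) (V I I), H (V I (V (H I I) (V (H I I) (V I I)))) (V I I)]),
   (10, [H (V I I) (V I (H (V I I) (H (V I (V I I)) I))), H (V I I) (V I (H (V I (V I I)) (H (V I I) I))), H (V
      I I) (V I (V (H I I) (V (H I (H I I)) I))), H (V I I) (V I (V (H I (H I I)) (V (H I I) I))), H (V I I) (V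
      (H (V I I) (H (V I (V I I)) I)) I), H (V I I) (V (H (V I (V I I)) (H (V I I) I)) I), H (V I (V (H I I) (V
      (H I (H I I)) I))) (V I I), H (V I (V (H I (H I I)) (V (H I I) I))) (V I I)]),
   (11, [H (V I I) (H (V I (V (H I (H I I)) I)) (V I I)), H (V I I) (H (V I (V (H I (V I I)) I)) (V I I)), H (V
      I I) (H (V I (V (H (V I I) I) I)) (V I I)), H (V I I) (V I (H (V I I) (H (V I (H I I)) I))), H (V I I) (V
      I (H (V I I) (H (V (H I I) I) I))), H (V I I) (V I (V (H I I) (V (H I (V I I)) I))), H (V I I) (V I (V (H
      I I) (V (H (V I I) I) I))), H (V I I) (V (H (V I I) (H (V I (H I I)) I)) I), H (V I I) (V (H (V I I) (H (V
      (H I I) I) I)) I), H (V I (V I I)) (V I (V (H (V I (H I I)) I) I)), H (V I (V I I)) (V I (V (H (V I (V I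
      I)) I) I)), H (V I (V I I)) (V I (V (H (V (H I I) I) I) I)), H (V I (V (H I I) (V (H I (V I I)) I))) (V I
      I), H (V I (V (H I I) (V (H (V I I) I) I))) (V I I)]),
   (16, [H (V I I) (H (V I (V I (V (H I I) I))) (V I I)), H (V I I) (H (V I (V (H I I) (V I I))) (V I I)), H (V
      I (V I I)) (V I (V (H I (H (V I I) I)) I)), H (V I (V I I)) (V I (V (H (V I I) (H I I)) I))]),
   (21, [H (V I I) (H (V I I) (V I (H I (H I (H I I))))), H (V I I) (H (V I I) (V (H I (H I (H I I))) I)), H (V
      I I) (H (V I (V I (V I (V I I)))) (V I I)), H (V I I) (V I (H I (H I (H I (H I (V I I)))))), H (V I I) (V
      I (H I (V I (V I (V I (V I I)))))), H (V I I) (V (H I I) (V I (V I (V I (V I I))))), H (V I I) (V (H I (H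
      I (H I (H I I)))) (V I I)), H (V I (H (V I I) I)) (V I (H I (H I (H I I)))), H (V I (H (V I (V I (V I (V I
      I)))) I)) (V I I), H (V I (V I I)) (V I (V I (V I (V I (V I I))))), H (V I (V I I)) (V I (V (H I (H I (H I
      I))) I)), H (V I (V I I)) (V (H I (H I (H I (H I I)))) I), H (V I (V I (V I (V I (V I I))))) (V I (V I
      I)), H (V I (V I (V I (V I (V I I))))) (V (H I I) I)]),
   (35, [H (V I I) (H (V I I) (H (V I I) (V I (H I I)))), H (V I I) (H (V I I) (H (V I I) (V (H I I) I))), H (V
      I I) (V I (H I (H I (H I (V I (V I I)))))), H (V I I) (V I (H I (H I (V I (V I (V I I)))))), H (V I I) (V
      (H I (H I I)) (V I (V I (V I I)))), H (V I I) (V (H I (H I (H I I))) (V I (V I I))), H (V I (H (V I (H (V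
      I I) I)) I)) (V I (H I I)), H (V I (H (V I (H (V I (V I I)) I)) I)) (V I I), H (V I (V I (V I I))) (V I (V
      I (V I (V I I)))), H (V I (V I (V I I))) (V (H I (H I (H I I))) I), H (V I (V I (V I (V I I)))) (V I (V I
      (V I I))), H (V I (V I (V I (V I I)))) (V (H I (H I I)) I)]),
   (40, [H (V I I) (H (V I I) (V I (H I (H I (V I I))))), H (V I I) (H (V I I) (V I (V I (V I (V I I))))), H (V
      I I) (H (V I I) (V (H I (H I I)) (V I I))), H (V I (H (V I I) I)) (H (V I I) (V I (H I I))), H (V I (H (V
      I I) I)) (V I (H I (H I (V I I)))), H (V I (H (V I I) I)) (V I (V I (V I (V I I)))), H (V I (H (V I I) I))
      (V (H I (H I (H I I))) I), H (V I (H (V I (V I (V I I))) I)) (V I (V I I)), H (V I (H (V I (V I (V I I)))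
      I)) (V (H I I) I), H (V I (V I I)) (V (H I I) (V I (V I (V I I)))), H (V I (V I I)) (V (H I (H I (H I I)))
      (V I I)), H (V I (V I (V I (V I I)))) (V (H I I) (V I I))]),
   (49, [H (V I I) (H (V I I) (H (V I I) (V I (V I I)))), H (V I I) (H (V I I) (V I (H I (V I (V I I))))), H (V
      I I) (H (V I I) (V (H I I) (V I (V I I)))), H (V I (H (V I I) I)) (H (V I I) (V (H I I) I)), H (V I (H (V
      I I) I)) (V I (H I (V I (V I I)))), H (V I (H (V I (H (V I I) I)) I)) (V I (V I I)), H (V I (H (V I (H (V
      I I) I)) I)) (V (H I I) I), H (V I (H (V I (V I I)) I)) (V I (V I (V I I))), H (V I (H (V I (V I I)) I))
      (V (H I (H I I)) I), H (V I (V I I)) (V (H I (H I I)) (V I (V I I))), H (V I (V I (V I I))) (V (H I I) (V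
      I (V I I))), H (V I (V I (V I I))) (V (H I (H I I)) (V I I))]),
   (59, [H (V I (H (V I I) I)) (H (V I I) (V I (V I I))), H (V I (H (V I I) I)) (V (H I I) (V I (V I I))), H (V
      I (H (V I I) I)) (V (H I (H I I)) (V I I)), H (V I (H (V I (V I I)) I)) (V (H I I) (V I I))]),
   (80, [H (V I I) (H (V I I) (V I (H I (H (V I I) I)))), H (V I I) (H (V I I) (V (H I (H (V I I) I)) I)), H (V
      I (V I I)) (V I (V I (V I (V (H I I) I)))), H (V I (V I (V I (V I I)))) (V I (V (H I I) I))]),
   (86, [H (V I I) (V I (H I (H I (H I (V (H I I) I))))), H (V I I) (V I (H I (V I (V I (V (H I I) I))))), H (V
      I I) (V (H I I) (V I (V I (V (H I I) I)))), H (V I I) (V (H I (H I (H I I))) (V (H I I) I)), H (V I (H (V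
      I I) I)) (V I (H I (H (V I I) I))), H (V I (H (V I (V I (V I I))) (V I I))) (V I I), H (V I (V I I)) (V (H
      I (H I (H (V I I) I))) I), H (V I (V I (V I (V I I)))) (V (H (V I I) I) I)]),
   (89, [H (V I I) (H (V I I) (H (V I (V I I)) (V I I))), H (V I (V I (V I I))) (V I (V I (V (H I I) I)))]),
   (96, [H (V I I) (V I (H I (V (H I (H I (H I I))) I))), H (V I I) (V (H I I) (V (H I (H I (H I I))) I)), H (V
      I (H (V I I) (V I (V I (V I I))))) (V I I), H (V I (V I I)) (V (H (V I (H I (H I I))) I) I)]),
   (100, [H (V I I) (V I (H I (H I (V I (V (H I I) I))))), H (V I I) (V (H I (H I I)) (V I (V (H I I) I))), H (V
      I (H (V I (H (V I I) I)) (V I I))) (V I I), H (V I (V I (V I I))) (V (H I (H (V I I) I)) I)]),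
   (105, [H (V I I) (H (V I I) (V I (H I (V (H I I) I)))), H (V I I) (H (V I I) (V (H I I) (V (H I I) I))), H (V
      I (H (V I I) I)) (H (V I (V I I)) (V I I)), H (V I (H (V I I) I)) (V I (V I (V (H I I) I))), H (V I (H (V
      I I) I)) (V (H I (H (V I I) I)) I), H (V I (H (V I (V I I)) I)) (V I (V (H I I) I)), H (V I (V I I)) (V (H
      I I) (V I (V (H I I) I))), H (V I (V I (V I I))) (V (H I I) (V (H I I) I))]),
   (107, [H (V I I) (H (V I I) (V I (H (V I (V I I)) I))), H (V I I) (H (V I I) (V (H (V I (H I I)) I) I)), H (V
      I (V I I)) (V I (V I (V (H I (H I I)) I))), H (V I (V I (V I I))) (V I (V (H I (H I I)) I))]),
   (108, [H (V I I) (H (V I I) (V I (V I (V (H I I) I)))), H (V I (H (V I I) I)) (V I (H I (V (H I I) I))), H (V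
      I (H (V I (V I I)) I)) (V (H (V I I) I) I), H (V I (V I I)) (V (H I (H I I)) (V (H I I) I))]),
   (113, [H (V I I) (H (V I I) (V I (V (H I (H I I)) I))), H (V I (H (V I I) I)) (V I (V (H I (H I I)) I)), H (V
      I (H (V I I) I)) (V (H (V I (H I I)) I) I), H (V I (V I I)) (V (H I I) (V (H I (H I I)) I))]),
   (118, [H (V I (H (V I I) I)) (V (H I I) (V (H I I) I))]),
   (120, [H (V I I) (V I (H I (H I (V (H I (H I I)) I)))), H (V I I) (V I (H I (V I (V (H I (H I I)) I)))), H (V
      I I) (V (H I I) (V I (V (H I (H I I)) I))), H (V I I) (V (H I (H I I)) (V (H I (H I I)) I)), H (V I (H (V
      I I) I)) (V I (H (V I (V I I)) I)), H (V I (H (V I (V I I)) (V I (V I I)))) (V I I), H (V I (V I I)) (V (H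
      I (H (V I (H I I)) I)) I), H (V I (V I (V I I))) (V (H (V I (H I I)) I) I)])]"


text \<open>All equations by which \<open>simp only\<close> runs the searches inside the
  logic.\<close>

lemmas eval_rules =
  neighbours.simps list.map append.simps hmerge_first.simps vmerge_first.simps hmerge_def vmerge_def
  concat.simps prod.case vsplits.simps hsplits.simps hcomp.simps vcomp.simps cmp.simps cmp_then.simps
  member_eval insert_eval dfs_eval inorder2.simps check_tree.simps check_list.simps ascending.simps
  count.simps Num.inc.simps simp_thms list.pred_inject

definition table_reaches :: "(nat \<times> unit mono list) list \<Rightarrow> bool" where
  "table_reaches T = list_all (\<lambda>(k, rs). ascending rs \<and>
     list_all (\<lambda>r. check_tree r k (dfs (\<lambda>_ _. EQ) [r] Leaf)) rs) T"
definition table_mixed :: "nat \<Rightarrow> (nat \<times> unit mono list) list \<Rightarrow> bool" where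
  "table_mixed n T = list_all (\<lambda>(k, rs). list_all (\<lambda>r. normal r \<and> solid r \<and> solid (tr r) \<and> deg r = n) rs) T"

lemma reaches_4: "table_reaches class_table_4"
  by (simp only: table_reaches_def class_table_4_def eval_rules)
lemma mixed_4: "table_mixed 4 class_table_4"
  by (simp add: table_mixed_def class_table_4_def)
lemma reaches_5: "table_reaches class_table_5"
  by (simp only: table_reaches_def class_table_5_def eval_rules)
lemma mixed_5: "table_mixed 5 class_table_5"
  by (simp add: table_mixed_def class_table_5_def)
lemma reaches_6: "table_reaches class_table_6"
  by (simp only: table_reaches_def class_table_6_def eval_rules)
lemma mixed_6: "table_mixed 6 class_table_6"
  by (simp add: table_mixed_def class_table_6_def)
lemma reaches_7: "table_reaches class_table_7"
  by (simp only: table_reaches_def class_table_7_def eval_rules)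
lemma mixed_7: "table_mixed 7 class_table_7"
  by (simp add: table_mixed_def class_table_7_def)
lemma reaches_8: "table_reaches class_table_8"
  by (simp only: table_reaches_def class_table_8_def eval_rules)
lemma mixed_8: "table_mixed 8 class_table_8"
  by (simp add: table_mixed_def class_table_8_def)
lemma reaches_9: "table_reaches class_table_9"
  by (simp only: table_reaches_def class_table_9_def eval_rules)
lemma mixed_9: "table_mixed 9 class_table_9"
  by (simp add: table_mixed_def class_table_9_def)

lemma class_tableI:
  assumes "table_reaches T" "table_mixed n T" "distinct (map fst T)"
    "(\<Sum>(k, rs)\<leftarrow>T. k * length rs) = card (mixed n)"
  shows "class_table n T"
  using assms unfolding table_reaches_def table_mixed_def class_table_def
  by (auto simp: list_all_iff mixed_def assoc_types_def)

lemma class_table_4: "class_table 4 class_table_4"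
  by (rule class_tableI[OF reaches_4 mixed_4])
    (simp_all add: class_table_4_def card_mixed_values)
lemma class_table_5: "class_table 5 class_table_5"
  by (rule class_tableI[OF reaches_5 mixed_5])
    (simp_all add: class_table_5_def card_mixed_values)
lemma class_table_6: "class_table 6 class_table_6"
  by (rule class_tableI[OF reaches_6 mixed_6])
    (simp_all add: class_table_6_def card_mixed_values)
lemma class_table_7: "class_table 7 class_table_7"
  by (rule class_tableI[OF reaches_7 mixed_7])
    (simp_all add: class_table_7_def card_mixed_values)
lemma class_table_8: "class_table 8 class_table_8"
  by (rule class_tableI[OF reaches_8 mixed_8])
    (simp_all add: class_table_8_def card_mixed_values)
lemma class_table_9: "class_table 9 class_table_9"
  by (rule class_tableI[OF reaches_9 mixed_9])
    (simp_all add: class_table_9_def card_mixed_values)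

lemma card_mixed_classes:
  "card (reach ` mixed 4) = 1" "card (reach ` mixed 5) = 4" "card (reach ` mixed 6) = 14"
  "card (reach ` mixed 7) = 46" "card (reach ` mixed 8) = 139"
  using class_table(1)[OF class_table_4, of "\<lambda>_. True"] class_table(1)[OF class_table_5, of "\<lambda>_. True"]
    class_table(1)[OF class_table_6, of "\<lambda>_. True"] class_table(1)[OF class_table_7, of "\<lambda>_. True"]
    class_table(1)[OF class_table_8, of "\<lambda>_. True"]
  by (simp_all add: class_table_4_def class_table_5_def class_table_6_def class_table_7_def class_table_8_def)

lemma class_table_size_bound:
  assumes "class_table n T" "list_all (\<lambda>(k, rs). k \<le> size_bound n) T" "t \<in> mixed n"
  shows "card (reach t) \<le> size_bound n"
  using class_table(2)[OF assms(1,3)] assms(2) by (auto simp: list_all_iff)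

lemma mixed_size_bound: "n \<in> {4..8} \<Longrightarrow> t \<in> mixed n \<Longrightarrow> card (reach t) \<le> size_bound n"
proof -
  assume n: "n \<in> {4..8}" and t: "t \<in> mixed n"
  have "n = 4 \<or> n = 5 \<or> n = 6 \<or> n = 7 \<or> n = 8" using n by auto
  then show ?thesis
  proof (elim disjE)
    assume "n = 4"
    with t show ?thesis using class_table_size_bound[OF class_table_4]
      by (simp add: class_table_4_def size_bound_def)
  next
    assume "n = 5"
    with t show ?thesis using class_table_size_bound[OF class_table_5]
      by (simp add: class_table_5_def size_bound_def)
  next
    assume "n = 6"
    with t show ?thesis using class_table_size_bound[OF class_table_6]
      by (simp add: class_table_6_def size_bound_def)
  next
    assume "n = 7"
    with t show ?thesis using class_table_size_bound[OF class_table_7]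
      by (simp add: class_table_7_def size_bound_def)
  next
    assume "n = 8"
    with t show ?thesis using class_table_size_bound[OF class_table_8]
      by (simp add: class_table_8_def size_bound_def)
  qed
qed

text \<open>The table has 406 entries of size below 107, to be added to the 3574 classes outside it,
  and four entries of size 107.\<close>

theorem card_classes_9:
  "card {C \<in> connected_classes 9. card C < 107} = 3980"
  "card {C \<in> connected_classes 9. card C = 107} = 4"
proof -
  have "card {C \<in> reach ` mixed 9. card C < 107} = 406"
    by (subst class_table(1)[OF class_table_9, of "\<lambda>k. k < 107"]) (simp add: class_table_9_def)
  note * = card_small_classes[OF mixed_size_bound card_mixed_classes this]
  show "card {C \<in> connected_classes 9. card C < 107} = 3980" by (subst *(1)) simp_all
  have "card {C \<in> reach ` mixed 9. card C = 107} = 4"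
    by (subst class_table(1)[OF class_table_9, of "\<lambda>k. k = 107"]) (simp add: class_table_9_def)
  then show "card {C \<in> connected_classes 9. card C = 107} = 4" by (subst *(2)) simp_all
qed

section \<open>The order on components\<close>

lemma type_less_deg: "type_less s t \<Longrightarrow> deg s \<le> deg t"
  by (induction s t rule: type_less.induct) auto
lemma type_less_irrefl: "\<not> type_less s s"
  by (induction s) auto
lemma type_less_total: "s \<noteq> t \<Longrightarrow> type_less s t \<or> type_less t s"
proof (induction s arbitrary: t)
  case (Ind x)
  have "1 < deg a + deg b" for a b :: "unit mono" using deg_pos[of a] deg_pos[of b] by (simp del: deg_pos)
  then show ?case using Ind by (cases t) simp_all
next
  case (H a b)
  show ?case
  proof (cases t)
    case (Ind y) then show ?thesis using deg_pos[of a] deg_pos[of b] by (simp del: deg_pos)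
  next
    case (H c d) then show ?thesis using H.IH(1)[of c] H.IH(2)[of d] H.prems by auto
  next
    case (V c d) then show ?thesis by auto
  qed
next
  case (V a b)
  show ?case
  proof (cases t)
    case (Ind y) then show ?thesis using deg_pos[of a] deg_pos[of b] by (simp del: deg_pos)
  next
    case (V c d) then show ?thesis using V.IH(1)[of c] V.IH(2)[of d] V.prems by auto
  next
    case (H c d) then show ?thesis by auto
  qed
qed
lemma type_less_trans: "type_less s t \<Longrightarrow> type_less t u \<Longrightarrow> type_less s u"
proof (induction s arbitrary: t u)
  case (Ind x)
  then show ?case using type_less_deg[of t u] by (cases t; cases u) auto
next
  case (H a b)
  note d = type_less_deg[of t u] type_less_deg[of "H a b" t]
  show ?case
  proof (cases t)
    case (Ind y) then show ?thesis using H.prems d by (cases u) auto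
  next
    case t: (H c d)
    show ?thesis
    proof (cases u)
      case u: (H e f)
      from H.prems show ?thesis unfolding t u using H.IH(1)[of c e] H.IH(2)[of d f]
        by auto
    qed (use H.prems t d in auto)
  next
    case t: (V c d)
    then show ?thesis using H.prems d by (cases u) auto
  qed
next
  case (V a b)
  note d = type_less_deg[of t u] type_less_deg[of "V a b" t]
  show ?case
  proof (cases t)
    case (Ind y) then show ?thesis using V.prems d by (cases u) auto
  next
    case t: (V c d)
    show ?thesis
    proof (cases u)
      case u: (V e f)
      from V.prems show ?thesis unfolding t u using V.IH(1)[of c e] V.IH(2)[of d f]
        by auto
    qed (use V.prems t d in auto)
  next
    case t: (H c d)
    then show ?thesis using V.prems d by (cases u) auto
  qed
qed

lemma ex_least:
  assumes "finite X" "X \<noteq> {}" "\<And>x y. x \<in> X \<Longrightarrow> y \<in> X \<Longrightarrow> x \<noteq> y \<Longrightarrow> lt x y \<or> lt y x"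
    "\<And>x y z. x \<in> X \<Longrightarrow> y \<in> X \<Longrightarrow> z \<in> X \<Longrightarrow> lt x y \<Longrightarrow> lt y z \<Longrightarrow> lt x z"
  shows "\<exists>x\<in>X. \<forall>y\<in>X. y = x \<or> lt x y"
  using assms
proof (induction X rule: finite_ne_induct)
  case (insert x F)
  have "\<exists>x\<in>F. \<forall>y\<in>F. y = x \<or> lt x y"
  proof (rule insert.IH)
    show "lt u v \<or> lt v u" if "u \<in> F" "v \<in> F" "u \<noteq> v" for u v
      using insert.prems(1)[of u v] that by simp
    show "lt u w" if "u \<in> F" "v \<in> F" "w \<in> F" "lt u v" "lt v w" for u v w
      using insert.prems(2)[of u v w] that by simp
  qed
  then obtain m where m: "m \<in> F" "\<forall>y\<in>F. y = m \<or> lt m y" by blast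
  show ?case
  proof (cases "lt m x")
    case True then show ?thesis using m by auto
  next
    case False
    then have "lt x m" using insert.prems(1)[of x m] insert.hyps m by auto
    then have "lt x y" if "y \<in> F" for y using m that insert.prems(2)[of x m y] by auto
    then show ?thesis by auto
  qed
next
  case (singleton x)
  show ?case by simp
qed

lemma min_vertex:
  assumes "finite C" "C \<noteq> {}"
  shows "min_vertex C \<in> C" and "u \<in> C \<Longrightarrow> u = min_vertex C \<or> type_less (min_vertex C) u"
proof -
  have "\<exists>t\<in>C. \<forall>u\<in>C. u = t \<or> type_less t u"
    by (rule ex_least[OF assms type_less_total type_less_trans])
  then obtain t where t: "t \<in> C" "\<forall>u\<in>C. u = t \<or> type_less t u" by blast
  have m: "min_vertex C = t"
    unfolding min_vertex_def
  proof (rule the_equality)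
    fix s assume s: "s \<in> C \<and> (\<forall>u\<in>C. u = s \<or> type_less s u)"
    show "s = t"
    proof (rule ccontr)
      assume "s \<noteq> t"
      then have "type_less s t" "type_less t s" using s t by auto
      then show False using type_less_trans type_less_irrefl by blast
    qed
  qed (use t in auto)
  show "min_vertex C \<in> C" unfolding m by (rule t(1))
  show "u \<in> C \<Longrightarrow> u = min_vertex C \<or> type_less (min_vertex C) u" unfolding m using t(2) by blast
qed

text \<open>Compares two minima without determining either: one vertex of \<open>C\<close> below all
  of \<open>D\<close> is enough.\<close>

lemma min_vertex_less:
  assumes "finite C" "finite D" "D \<noteq> {}" "u \<in> C" "\<And>v. v \<in> D \<Longrightarrow> type_less u v"
  shows "type_less (min_vertex C) (min_vertex D)"
proof -
  have "C \<noteq> {}" using assms by auto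
  then have "u = min_vertex C \<or> type_less (min_vertex C) u" using min_vertex(2)[of C u] assms by auto
  moreover have "type_less u (min_vertex D)" using assms min_vertex(1)[of D] by auto
  ultimately show ?thesis using type_less_trans by blast
qed

text \<open>Totality is asked on \<open>X\<close> only: \<open>component_less\<close> cannot
  separate two sets with equal size and equal minimum, but distinct components are disjoint.\<close>

locale strict_order_on =
  fixes X :: "'b set" and lt :: "'b \<Rightarrow> 'b \<Rightarrow> bool"
  assumes finite: "finite X"
    and irrefl: "\<And>x. \<not> lt x x"
    and trans: "\<And>x y z. lt x y \<Longrightarrow> lt y z \<Longrightarrow> lt x z"
    and total: "\<And>x y. x \<in> X \<Longrightarrow> y \<in> X \<Longrightarrow> x \<noteq> y \<Longrightarrow> lt x y \<or> lt y x"
begin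

lemma sorted_distinct: "sorted_wrt lt xs \<Longrightarrow> distinct xs"
  using irrefl by (induction xs) auto

lemma card_less_nth:
  assumes "sorted_wrt lt xs" "k < length xs"
  shows "card {y \<in> set xs. lt y (xs ! k)} = k"
proof -
  have "{y \<in> set xs. lt y (xs ! k)} = set (take k xs)"
  proof (intro equalityI subsetI)
    fix y assume "y \<in> {y \<in> set xs. lt y (xs ! k)}"
    then obtain j where j: "j < length xs" "y = xs ! j" "lt (xs ! j) (xs ! k)" by (auto simp: in_set_conv_nth)
    have "j < k"
    proof (rule ccontr)
      assume "\<not> j < k"
      then have "j = k \<or> lt (xs ! k) (xs ! j)" using assms j sorted_wrt_nth_less[of lt xs k j] by (cases "j = k") auto
      then show False using j irrefl trans by metis
    qed
    then show "y \<in> set (take k xs)" using j by (auto simp: in_set_conv_nth)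
  next
    fix y assume "y \<in> set (take k xs)"
    then obtain j where "j < k" "y = xs ! j" using assms by (auto simp: in_set_conv_nth)
    then show "y \<in> {y \<in> set xs. lt y (xs ! k)}" using assms sorted_wrt_nth_less[of lt xs j k] by auto
  qed
  then show ?thesis
    using distinct_card[of "take k xs"] sorted_distinct[OF assms(1)] assms(2) by simp
qed

lemma ex_sorted: "Y \<subseteq> X \<Longrightarrow> \<exists>xs. set xs = Y \<and> sorted_wrt lt xs"
proof (induction "card Y" arbitrary: Y)
  case 0
  then have "Y = {}" using finite finite_subset card_0_eq by metis
  then show ?case by (intro exI[of _ "[]"]) simp
next
  case (Suc n)
  have Y: "finite Y" "Y \<noteq> {}" using Suc finite finite_subset by (metis, auto)
  have "\<exists>m\<in>Y. \<forall>y\<in>Y. y = m \<or> lt m y"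
    by (rule ex_least[OF Y total[OF subsetD[OF Suc.prems] subsetD[OF Suc.prems]] trans])
  then obtain m where m: "m \<in> Y" "\<forall>y\<in>Y. y = m \<or> lt m y" by blast
  have "n = card (Y - {m})" using Suc.hyps(2) m Y by simp
  then obtain xs where "set xs = Y - {m}" "sorted_wrt lt xs" using Suc.hyps(1)[of "Y - {m}"] Suc.prems by auto
  then show ?case using m by (intro exI[of _ "m # xs"]) auto
qed

text \<open>The entry at position \<open>k\<close> is the only element with exactly \<open>k\<close>
  smaller ones.\<close>

lemma sorted_unique:
  assumes "sorted_wrt lt xs" "sorted_wrt lt ys" "set xs = set ys" "set xs \<subseteq> X"
  shows "xs = ys"
proof (rule nth_equalityI)
  show len: "length xs = length ys"
    using assms sorted_distinct distinct_card by metis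
  fix k assume k: "k < length xs"
  have eq: "card {y \<in> set xs. lt y (xs ! k)} = card {y \<in> set xs. lt y (ys ! k)}"
    using card_less_nth[OF assms(1) k] card_less_nth[OF assms(2), of k] k len assms(3) by simp
  have mono: "card {y \<in> set xs. lt y a} < card {y \<in> set xs. lt y b}" if "lt a b" "a \<in> set xs" for a b
  proof (rule psubset_card_mono)
    show "{y \<in> set xs. lt y a} \<subset> {y \<in> set xs. lt y b}" using that trans irrefl by blast
  qed simp
  have mem: "xs ! k \<in> set xs" "ys ! k \<in> set xs"
    using nth_mem[OF k] nth_mem[OF k[unfolded len]] by (simp_all only: assms(3))
  show "xs ! k = ys ! k"
  proof (rule ccontr)
    assume "xs ! k \<noteq> ys ! k"
    then consider "lt (xs ! k) (ys ! k)" | "lt (ys ! k) (xs ! k)"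
      using total[OF subsetD[OF assms(4) mem(1)] subsetD[OF assms(4) mem(2)]] by blast
    then show False using mono[of "xs ! k" "ys ! k"] mono[of "ys ! k" "xs ! k"] mem eq by cases simp_all
  qed
qed

text \<open>Replaces a position in the list behind \<open>THE\<close> by a cardinality, so the 4001
  components never have to be listed.\<close>

lemma nth_sorted_list:
  assumes "x \<in> X"
  shows "(THE xs. set xs = X \<and> sorted_wrt lt xs) ! card {y \<in> X. lt y x} = x"
proof -
  obtain xs where xs: "set xs = X" "sorted_wrt lt xs" using ex_sorted[of X] by auto
  have the: "(THE xs. set xs = X \<and> sorted_wrt lt xs) = xs"
  proof (rule the_equality)
    fix ys assume "set ys = X \<and> sorted_wrt lt ys"
    then show "ys = xs" using sorted_unique[of ys xs] xs by simp
  qed (simp add: xs)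
  obtain k where k: "k < length xs" "x = xs ! k" using xs assms by (metis in_set_conv_nth)
  have "card {y \<in> X. lt y x} = k" using card_less_nth[OF xs(2) k(1)] by (simp only: xs(1) k(2))
  then show ?thesis by (simp only: the k(2))
qed

end

section \<open>Components of \<open>G(n)\<close> and classes of association types\<close>

text \<open>A relabelling leaves the tree as it is, so every cut of the image comes from a cut of
  the original.\<close>

lemma map_mono_eq_hcompD:
  "map_mono f m = hcomp a b \<Longrightarrow> normal a \<Longrightarrow> normal m \<Longrightarrow> \<exists>a' b'. m = hcomp a' b' \<and> map_mono f a' = a \<and> map_mono f b' = b \<and> normal a' \<and> normal b'"
proof (induction a arbitrary: m)
  case (H s t)
  then obtain s' u where m: "m = H s' u" "map_mono f s' = s" "map_mono f u = hcomp t b" by (cases m) auto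
  then obtain t' b' where "u = hcomp t' b'" "map_mono f t' = t" "map_mono f b' = b" "normal t'" "normal b'"
    using H.IH(2)[of u] H.prems by auto
  then show ?case using m H.prems by (intro exI[of _ "H s' t'"] exI[of _ b']) auto
next
  case (Ind x)
  then obtain s' u where "m = H s' u" "map_mono f s' = Ind x" "map_mono f u = b" by (cases m) auto
  moreover from this have "\<not> is_H s'" by (cases s') auto
  ultimately show ?case using Ind.prems by (intro exI[of _ s'] exI[of _ u]) (auto simp: hcomp_not_H)
next
  case (V s t)
  then obtain s' u where "m = H s' u" "map_mono f s' = V s t" "map_mono f u = b" by (cases m) auto
  moreover from this have "\<not> is_H s'" by (cases s') auto
  ultimately show ?case using V.prems by (intro exI[of _ s'] exI[of _ u]) (auto simp: hcomp_not_H)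
qed

lemma map_mono_eq_vcompD:
  "map_mono f m = vcomp a b \<Longrightarrow> normal a \<Longrightarrow> normal m \<Longrightarrow> \<exists>a' b'. m = vcomp a' b' \<and> map_mono f a' = a \<and> map_mono f b' = b \<and> normal a' \<and> normal b'"
proof (induction a arbitrary: m)
  case (V s t)
  then obtain s' u where m: "m = V s' u" "map_mono f s' = s" "map_mono f u = vcomp t b" by (cases m) auto
  then obtain t' b' where "u = vcomp t' b'" "map_mono f t' = t" "map_mono f b' = b" "normal t'" "normal b'"
    using V.IH(2)[of u] V.prems by auto
  then show ?case using m V.prems by (intro exI[of _ "V s' t'"] exI[of _ b']) auto
next
  case (Ind x)
  then obtain s' u where "m = V s' u" "map_mono f s' = Ind x" "map_mono f u = b" by (cases m) auto
  moreover from this have "\<not> is_V s'" by (cases s') auto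
  ultimately show ?case using Ind.prems by (intro exI[of _ s'] exI[of _ u]) (auto simp: vcomp_not_V)
next
  case (H s t)
  then obtain s' u where "m = V s' u" "map_mono f s' = H s t" "map_mono f u = b" by (cases m) auto
  moreover from this have "\<not> is_V s'" by (cases s') auto
  ultimately show ?case using H.prems by (intro exI[of _ s'] exI[of _ u]) (auto simp: vcomp_not_V)
qed

text \<open>The tree alone decides where an interchange applies. This is the lifting of edges for
  the projection from \<open>F(n)\<close> to \<open>G(n)\<close>.\<close>

lemma interchange_lift:
  assumes "interchange t t'" "map_mono f m = t" "normal m"
  shows "\<exists>m'. interchange m m' \<and> map_mono f m' = t'"
  using assms
proof (induction arbitrary: m rule: interchange.induct)
  case (hv w x y z)
  have n: "normal (vcomp w x)" using hv.hyps by simp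
  obtain a b where ab: "m = hcomp a b" "map_mono f a = vcomp w x" "map_mono f b = vcomp y z" "normal a" "normal b"
    using map_mono_eq_hcompD[OF hv.prems(1) n hv.prems(2)] by blast
  obtain w' x' where 1: "a = vcomp w' x'" "map_mono f w' = w" "map_mono f x' = x" "normal w'" "normal x'"
    using map_mono_eq_vcompD[OF ab(2) hv.hyps(1) ab(4)] by blast
  obtain y' z' where 2: "b = vcomp y' z'" "map_mono f y' = y" "map_mono f z' = z" "normal y'" "normal z'"
    using map_mono_eq_vcompD[OF ab(3) hv.hyps(3) ab(5)] by blast
  have "map_mono f (vcomp (hcomp w' y') (hcomp x' z')) = vcomp (hcomp w y) (hcomp x z)"
    by (simp add: map_mono_hcomp map_mono_vcomp 1 2)
  then show ?case using interchange.hv[OF 1(4,5) 2(4,5)] unfolding ab(1) 1(1) 2(1) by blast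
next
  case (vh w x y z)
  have n: "normal (hcomp w y)" using vh.hyps by simp
  obtain a b where ab: "m = vcomp a b" "map_mono f a = hcomp w y" "map_mono f b = hcomp x z" "normal a" "normal b"
    using map_mono_eq_vcompD[OF vh.prems(1) n vh.prems(2)] by blast
  obtain w' y' where 1: "a = hcomp w' y'" "map_mono f w' = w" "map_mono f y' = y" "normal w'" "normal y'"
    using map_mono_eq_hcompD[OF ab(2) vh.hyps(1) ab(4)] by blast
  obtain x' z' where 2: "b = hcomp x' z'" "map_mono f x' = x" "map_mono f z' = z" "normal x'" "normal z'"
    using map_mono_eq_hcompD[OF ab(3) vh.hyps(2) ab(5)] by blast
  have "map_mono f (hcomp (vcomp w' x') (vcomp y' z')) = hcomp (vcomp w x) (vcomp y z)"
    by (simp add: map_mono_hcomp map_mono_vcomp 1 2)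
  then show ?case using interchange.vh[OF 1(4) 2(4) 1(5) 2(5)] unfolding ab(1) 1(1) 2(1) by blast
next
  case (h_left s s' t)
  have n: "normal s" using h_left.hyps interchange_normal by blast
  obtain a b where m: "m = hcomp a b" "map_mono f a = s" "map_mono f b = t" "normal a" "normal b"
    using map_mono_eq_hcompD[OF h_left.prems(1) n h_left.prems(2)] by blast
  obtain a' where "interchange a a'" "map_mono f a' = s'" using h_left.IH[OF m(2,4)] by blast
  then have "interchange m (hcomp a' b)" "map_mono f (hcomp a' b) = hcomp s' t"
    using m by (simp_all add: interchange.h_left map_mono_hcomp)
  then show ?case by blast
next
  case (h_right s t t')
  obtain a b where m: "m = hcomp a b" "map_mono f a = s" "map_mono f b = t" "normal a" "normal b"
    using map_mono_eq_hcompD[OF h_right.prems(1) h_right.hyps(1) h_right.prems(2)] by blast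
  obtain b' where "interchange b b'" "map_mono f b' = t'" using h_right.IH[OF m(3,5)] by blast
  then have "interchange m (hcomp a b')" "map_mono f (hcomp a b') = hcomp s t'"
    using m by (simp_all add: interchange.h_right map_mono_hcomp)
  then show ?case by blast
next
  case (v_left s s' t)
  have n: "normal s" using v_left.hyps interchange_normal by blast
  obtain a b where m: "m = vcomp a b" "map_mono f a = s" "map_mono f b = t" "normal a" "normal b"
    using map_mono_eq_vcompD[OF v_left.prems(1) n v_left.prems(2)] by blast
  obtain a' where "interchange a a'" "map_mono f a' = s'" using v_left.IH[OF m(2,4)] by blast
  then have "interchange m (vcomp a' b)" "map_mono f (vcomp a' b) = vcomp s' t"
    using m by (simp_all add: interchange.v_left map_mono_vcomp)
  then show ?case by blast
next
  case (v_right s t t')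
  obtain a b where m: "m = vcomp a b" "map_mono f a = s" "map_mono f b = t" "normal a" "normal b"
    using map_mono_eq_vcompD[OF v_right.prems(1) v_right.hyps(1) v_right.prems(2)] by blast
  obtain b' where "interchange b b'" "map_mono f b' = t'" using v_right.IH[OF m(3,5)] by blast
  then have "interchange m (vcomp a b')" "map_mono f (vcomp a b') = vcomp s t'"
    using m by (simp_all add: interchange.v_right map_mono_vcomp)
  then show ?case by blast
qed

lemma deg_type_of [simp]: "deg (type_of m) = deg m" by (simp add: type_of_def)
lemma normal_type_of [simp]: "normal (type_of m) = normal m" by (simp add: type_of_def)
lemma type_of_rot: "type_of (rot m) = rot (type_of m)" by (simp add: type_of_def rot_map_mono)

text \<open>In the form of one multiset equation the condition is visibly preserved by interchange
  and by rotation.\<close>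

lemma multilinear_iff: "m \<in> multilinear n \<longleftrightarrow> normal m \<and> mset (indets m) = mset [0..<n]"
proof -
  have "mset (indets m) = mset [0..<n] \<longleftrightarrow> distinct (indets m) \<and> set (indets m) = {..<n}"
  proof
    assume "mset (indets m) = mset [0..<n]"
    then show "distinct (indets m) \<and> set (indets m) = {..<n}"
      by (metis atLeast_upt distinct_upt mset_eq_imp_distinct_iff set_mset_mset)
  next
    assume "distinct (indets m) \<and> set (indets m) = {..<n}"
    then show "mset (indets m) = mset [0..<n]"
      by (metis atLeast_upt distinct_upt set_eq_iff_mset_eq_distinct)
  qed
  then show ?thesis by (auto simp: multilinear_def)
qed

lemma multilinear_interchange: "m \<in> multilinear n \<Longrightarrow> interchange m m' \<Longrightarrow> m' \<in> multilinear n"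
  using interchange_normal interchange_mset by (fastforce simp: multilinear_iff)
lemma F_edges_iff: "(m, m') \<in> F_edges n \<longleftrightarrow> m \<in> multilinear n \<and> interchange m m'"
  using multilinear_interchange by (auto simp: F_edges_def)
lemma multilinear_deg: "m \<in> multilinear n \<Longrightarrow> deg m = n"
  unfolding multilinear_iff deg_def by (metis length_upt minus_nat.diff_0 size_mset)
lemma multilinear_length: "m \<in> multilinear n \<Longrightarrow> length (indets m) = n"
  using multilinear_deg by (simp add: deg_def)
lemma type_of_multilinear: "m \<in> multilinear n \<Longrightarrow> type_of m \<in> assoc_types n"
  using multilinear_deg by (auto simp: assoc_types_def multilinear_iff)

primrec label_from :: "nat \<Rightarrow> 'a mono \<Rightarrow> nat mono" where
  "label_from k (Ind x) = Ind k"
| "label_from k (H s t) = H (label_from k s) (label_from (k + deg s) t)"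
| "label_from k (V s t) = V (label_from k s) (label_from (k + deg s) t)"

lemma indets_label_from: "indets (label_from k t) = [k..<k + deg t]"
proof (induction t arbitrary: k)
  case (H a b) then show ?case using upt_add_eq_append[of k "k + deg a" "deg b"] by (simp add: add.assoc)
next
  case (V a b) then show ?case using upt_add_eq_append[of k "k + deg a" "deg b"] by (simp add: add.assoc)
qed simp
lemma is_H_label_from [simp]: "is_H (label_from k t) = is_H t" by (cases t) auto
lemma is_V_label_from [simp]: "is_V (label_from k t) = is_V t" by (cases t) auto
lemma normal_label_from [simp]: "normal (label_from k t) = normal t"
  by (induction t arbitrary: k) auto
lemma type_of_label_from: "type_of (label_from k t) = t" for t :: "unit mono"
  by (induction t arbitrary: k) (auto simp: type_of_def)

lemma ex_multilinear: "t \<in> assoc_types n \<Longrightarrow> \<exists>m\<in>multilinear n. type_of m = t"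
  by (rule bexI[of _ "label_from 0 t"])
    (auto simp: assoc_types_def multilinear_iff indets_label_from type_of_label_from)

lemma F_edge_arc:
  assumes "(m, m') \<in> F_edges n"
  obtains \<sigma> where "(type_of m, \<sigma>, type_of m') \<in> G_arcs n" "indets m' = permute_list \<sigma> (indets m)" "\<sigma> permutes {..<n}"
proof -
  have m: "m \<in> multilinear n" "mset (indets m') = mset (indets m)"
    using assms interchange_mset[of m m'] by (auto simp: F_edges_iff)
  obtain \<sigma> where \<sigma>: "\<sigma> permutes {..<length (indets m)}" "permute_list \<sigma> (indets m) = indets m'"
    by (rule mset_eq_permutation[OF m(2)])
  have "\<sigma> permutes {..<n}" using \<sigma>(1) by (simp only: multilinear_length[OF m(1)])
  moreover have "(type_of m, \<sigma>, type_of m') \<in> G_arcs n"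
    unfolding G_arcs_def using assms \<sigma>(2)[symmetric] \<open>\<sigma> permutes {..<n}\<close> by blast
  ultimately show ?thesis using that \<sigma>(2) by simp
qed

lemma G_adj_iff:
  assumes "t \<in> assoc_types n"
  shows "(t, t') \<in> G_adj n \<longleftrightarrow> interchange t t'"
proof
  assume "(t, t') \<in> G_adj n"
  then obtain m m' where "(m, m') \<in> F_edges n" "t = type_of m" "t' = type_of m'"
    by (auto simp: G_adj_def G_arcs_def src_def tgt_def)
  then show "interchange t t'" by (simp add: F_edges_iff type_of_def interchange_map)
next
  assume i: "interchange t t'"
  obtain m where m: "m \<in> multilinear n" "type_of m = t" using ex_multilinear[OF assms] by blast
  then have "normal m" by (simp add: multilinear_iff)
  then obtain m' where "interchange m m'" "type_of m' = t'"
    using interchange_lift[OF i, of "\<lambda>_. ()" m] m(2) unfolding type_of_def by blast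
  then have "(m, m') \<in> F_edges n" using m by (simp add: F_edges_iff)
  then obtain \<sigma> where "(type_of m, \<sigma>, type_of m') \<in> G_arcs n" by (rule F_edge_arc)
  then show "(t, t') \<in> G_adj n"
    unfolding G_adj_def using m \<open>type_of m' = t'\<close> by (force simp: src_def tgt_def)
qed

lemma G_adj_reach: "t \<in> assoc_types n \<Longrightarrow> (G_adj n)\<^sup>* `` {t} = reach t"
proof -
  assume t: "t \<in> assoc_types n"
  have "u \<in> reach t" if "(t, u) \<in> (G_adj n)\<^sup>*" for u
    using that
  proof (induction rule: rtrancl_induct)
    case (step u v)
    then have "u \<in> assoc_types n" using reach_subset_assoc_types[OF t] by blast
    then have "interchange u v" using step G_adj_iff by blast
    then show ?case using step.IH by (simp add: reach_def)
  qed simp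
  moreover have "(t, u) \<in> (G_adj n)\<^sup>*" if "u \<in> reach t" for u
  proof -
    have "interchange\<^sup>*\<^sup>* t u" using that by (simp add: reach_def)
    then show ?thesis
    proof (induction rule: rtranclp_induct)
      case (step u v)
      then have "u \<in> assoc_types n" using reach_subset_assoc_types[OF t] by (auto simp: reach_def)
      then have "(u, v) \<in> G_adj n" using step G_adj_iff by blast
      then show ?case using step.IH by simp
    qed simp
  qed
  ultimately show ?thesis by blast
qed

lemma components_eq: "components n = connected_classes n"
proof -
  have "t \<in> Domain (G_adj n) \<longleftrightarrow> neighbours t \<noteq> []" if "t \<in> assoc_types n" for t
  proof -
    have "t \<in> Domain (G_adj n) \<longleftrightarrow> (\<exists>u. interchange t u)" using G_adj_iff[OF that] by (simp add: Domain_iff)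
    also have "\<dots> \<longleftrightarrow> set (neighbours t) \<noteq> {}"
    proof -
      have "normal t" using that by (simp add: assoc_types_def)
      then have eq: "set (neighbours t) = {u. interchange t u}" using neighbours_iff by blast
      show ?thesis unfolding eq by blast
    qed
    finally show ?thesis by simp
  qed
  then have "{t \<in> assoc_types n. t \<in> Domain (G_adj n)} = {t \<in> assoc_types n. neighbours t \<noteq> []}" by blast
  then have "connected_classes n = reach ` {t \<in> assoc_types n. t \<in> Domain (G_adj n)}"
    by (simp only: connected_classes_def)
  also have "\<dots> = (\<lambda>t. (G_adj n)\<^sup>* `` {t}) ` {t \<in> assoc_types n. t \<in> Domain (G_adj n)}"
    by (rule image_cong) (simp_all add: G_adj_reach)
  also have "\<dots> = components n" unfolding components_def by blast
  finally show ?thesis ..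
qed

lemma componentE:
  assumes "C \<in> components n"
  obtains t where "t \<in> assoc_types n" "C = reach t"
  using assms unfolding components_eq connected_classes_def by blast

lemma component_props:
  assumes "C \<in> components n"
  shows "finite C" "C \<noteq> {}"
proof -
  obtain t where t: "t \<in> assoc_types n" "C = reach t" using assms by (rule componentE)
  show "finite C" unfolding t(2) by (rule finite_subset[OF reach_subset_assoc_types[OF t(1)] finite_assoc_types])
  show "C \<noteq> {}" unfolding t(2) using reach_refl[of t] by (metis empty_iff)
qed

lemma components_disjoint:
  assumes "C \<in> components n" "D \<in> components n" "t \<in> C" "t \<in> D"
  shows "C = D"
proof -
  obtain u where u: "C = reach u" using assms(1) by (rule componentE)
  obtain v where v: "D = reach v" using assms(2) by (rule componentE)
  show ?thesis using reach_eq[of t u] reach_eq[of t v] assms(3,4) unfolding u v by simp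
qed

interpretation components: strict_order_on "components n" component_less for n
proof
  show "finite (components n)"
    unfolding components_eq connected_classes_def using finite_assoc_types by simp
  fix C D E :: "unit mono set"
  show "\<not> component_less C C" using type_less_irrefl by (simp add: component_less_def)
  show "component_less C D \<Longrightarrow> component_less D E \<Longrightarrow> component_less C E"
    using type_less_trans by (auto simp: component_less_def)
  assume C: "C \<in> components n" and D: "D \<in> components n" and "C \<noteq> D"
  then have "min_vertex C \<noteq> min_vertex D"
    using components_disjoint[OF C D] min_vertex(1)[OF component_props[OF C]] min_vertex(1)[OF component_props[OF D]]
    by metis
  then show "component_less C D \<or> component_less D C"
    using type_less_total by (auto simp: component_less_def)
qed

text \<open>Numbering starts at 1, list positions at 0, hence \<open>Suc N\<close> for
  \<open>N\<close> smaller components.\<close>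

lemma component_eqI:
  assumes "C \<in> components n" "card {D \<in> components n. component_less D C} = N"
  shows "component n (Suc N) = C"
  using components.nth_sorted_list[OF assms(1)] assms(2) by (simp add: component_def component_list_def)

section \<open>Walks in \<open>G(n)\<close> and their lifts to \<open>F(n)\<close>\<close>

text \<open>The type determines the lengths at which the word of indeterminates is to be
  cut.\<close>

lemma type_indets_inject:
  "type_of a = type_of b \<Longrightarrow> indets a = indets b \<Longrightarrow> a = b"
proof (induction a arbitrary: b)
  case (Ind x)
  then show ?case by (cases b) (auto simp: type_of_def)
next
  case (H s t)
  then obtain s' t' where b: "b = H s' t'" "type_of s = type_of s'" "type_of t = type_of t'"
    by (cases b) (auto simp: type_of_def)
  then have "length (indets s) = length (indets s')" by (metis deg_def deg_type_of)
  then have "indets s = indets s'" "indets t = indets t'" using H.prems b(1) by auto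
  then show ?case using H.IH b by blast
next
  case (V s t)
  then obtain s' t' where b: "b = V s' t'" "type_of s = type_of s'" "type_of t = type_of t'"
    by (cases b) (auto simp: type_of_def)
  then have "length (indets s) = length (indets s')" by (metis deg_def deg_type_of)
  then have "indets s = indets s'" "indets t = indets t'" using V.prems b(1) by auto
  then show ?case using V.IH b by blast
qed

lemma type_of_map_mono [simp]: "type_of (map_mono f m) = type_of m"
  by (simp add: type_of_def mono.map_comp comp_def)

text \<open>Transports an edge of \<open>F(n)\<close> from the monomial that witnesses an arc to any
  other monomial of the same type.\<close>

lemma ex_relabelling:
  assumes "type_of m = type_of m'" "distinct (indets m)"
  shows "\<exists>f. map_mono f m = m'"
proof
  let ?f = "\<lambda>x. the (map_of (zip (indets m) (indets m')) x)"
  have len: "length (indets m) = length (indets m')" by (metis assms(1) deg_def deg_type_of)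
  have m: "map ?f (indets m) = indets m'"
  proof (rule nth_equalityI)
    fix i assume "i < length (map ?f (indets m))"
    then have i: "i < length (indets m)" by simp
    then show "map ?f (indets m) ! i = indets m' ! i"
      using map_of_zip_nth[OF len assms(2), of i] by (simp only: len nth_map) simp
  qed (simp only: length_map len)
  show "map_mono ?f m = m'"
  proof (rule type_indets_inject)
    show "type_of (map_mono ?f m) = type_of m'" by (simp only: type_of_map_mono assms(1))
    show "indets (map_mono ?f m) = indets m'" unfolding indets_map_mono by (rule m)
  qed
qed

lemma G_arcsE:
  assumes "a \<in> G_arcs n"
  obtains m m' where "(m, m') \<in> F_edges n" "src a = type_of m" "tgt a = type_of m'"
    "lbl a permutes {..<n}" "indets m' = permute_list (lbl a) (indets m)"
  using assms unfolding G_arcs_def src_def tgt_def lbl_def by auto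

lemma arc_eqI: "src a = src b \<Longrightarrow> lbl a = lbl b \<Longrightarrow> tgt a = tgt b \<Longrightarrow> a = b"
  by (simp add: src_def tgt_def lbl_def prod_eq_iff)
lemma src_rev_arc [simp]: "src (rev_arc a) = tgt a" and tgt_rev_arc [simp]: "tgt (rev_arc a) = src a"
  and lbl_rev_arc [simp]: "lbl (rev_arc a) = inv_into UNIV (lbl a)"
  by (simp_all add: rev_arc_def src_def tgt_def lbl_def)

lemma lbl_permutes: "a \<in> G_arcs n \<Longrightarrow> lbl a permutes {..<n}"
  by (rule G_arcsE)
lemma rev_rev_arc: "a \<in> G_arcs n \<Longrightarrow> rev_arc (rev_arc a) = a"
  by (rule arc_eqI) (simp_all add: inv_inv_eq permutes_bij[OF lbl_permutes])

lemma rev_arc_in_G_arcs: "a \<in> G_arcs n \<Longrightarrow> rev_arc a \<in> G_arcs n"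
proof -
  assume "a \<in> G_arcs n"
  then obtain m m' where m: "(m, m') \<in> F_edges n" "src a = type_of m" "tgt a = type_of m'"
    "lbl a permutes {..<n}" "indets m' = permute_list (lbl a) (indets m)" by (rule G_arcsE)
  have ml: "m \<in> multilinear n" "m' \<in> multilinear n" using m(1) by (auto simp: F_edges_def)
  have "(m', m) \<in> F_edges n" using m(1) ml interchange_sym by (simp add: F_edges_iff)
  moreover have inv: "inv_into UNIV (lbl a) permutes {..<n}" using m(4) by (rule permutes_inv)
  moreover have "indets m = permute_list (inv_into UNIV (lbl a)) (indets m')"
  proof -
    have "permute_list (inv_into UNIV (lbl a)) (indets m') = permute_list (lbl a \<circ> inv_into UNIV (lbl a)) (indets m)"
      unfolding m(5) by (rule permute_list_compose[symmetric]) (simp add: inv multilinear_length[OF ml(1)])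
    then show ?thesis using permutes_inv_o(1)[OF m(4)] by simp
  qed
  ultimately show ?thesis unfolding rev_arc_def m(2,3) G_arcs_def by blast
qed

text \<open>Labels act on positions, renamings on indeterminates. The two actions commute, so the
  label survives when the witnessing edge is renamed.\<close>

lemma arc_lift:
  assumes "a \<in> G_arcs n" "m \<in> multilinear n" "type_of m = src a"
  obtains m' where "(m, m') \<in> F_edges n" "type_of m' = tgt a" "indets m' = permute_list (lbl a) (indets m)"
proof -
  obtain u u' where u: "(u, u') \<in> F_edges n" "src a = type_of u" "tgt a = type_of u'"
    "lbl a permutes {..<n}" "indets u' = permute_list (lbl a) (indets u)" using assms(1) by (rule G_arcsE)
  have mu: "u \<in> multilinear n" "interchange u u'" using u(1) by (auto simp: F_edges_iff)
  then have "distinct (indets u)" by (simp add: multilinear_def)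
  then obtain f where f: "map_mono f u = m" using ex_relabelling[of u m] assms(3) u(2) by auto
  have "(m, map_mono f u') \<in> F_edges n" using interchange_map[OF mu(2), of f] f assms(2) by (simp add: F_edges_iff)
  moreover have "indets (map_mono f u') = permute_list (lbl a) (indets m)"
    unfolding indets_map_mono u(5) f[symmetric]
    by (rule permute_list_map[symmetric]) (simp add: multilinear_length[OF mu(1)] u(4))
  ultimately show ?thesis using that u(3) by simp
qed

lemma F_edges_rtrancl: "m \<in> multilinear n \<Longrightarrow> (m, m') \<in> (F_edges n)\<^sup>* \<longleftrightarrow> m' \<in> reach m"
proof
  assume m: "m \<in> multilinear n"
  show "m' \<in> reach m" if "(m, m') \<in> (F_edges n)\<^sup>*"
    using that
    by (induction rule: rtrancl_induct) (auto simp: F_edges_iff reach_def)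
  assume "m' \<in> reach m"
  then have "interchange\<^sup>*\<^sup>* m m'" by (simp add: reach_def)
  then have "(m, m') \<in> (F_edges n)\<^sup>* \<and> m' \<in> multilinear n"
  proof (induction rule: rtranclp_induct)
    case (step u v)
    then have "(u, v) \<in> F_edges n" by (simp add: F_edges_iff)
    then show ?case using step multilinear_interchange by (meson rtrancl.rtrancl_into_rtrancl)
  qed (simp add: m)
  then show "(m, m') \<in> (F_edges n)\<^sup>*" ..
qed

lemma reach_multilinear: "m \<in> multilinear n \<Longrightarrow> u \<in> reach m \<Longrightarrow> u \<in> multilinear n"
  using reach_normal[of u m] reach_mset[of u m] unfolding multilinear_iff by metis

text \<open>By lifting of edges a class of monomials projects onto a whole class of types.\<close>

lemma reach_type_of: "normal m \<Longrightarrow> reach (type_of m) = type_of ` reach m"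
proof (intro equalityI subsetI)
  fix t assume m: "normal m" and "t \<in> reach (type_of m)"
  then have "interchange\<^sup>*\<^sup>* (type_of m) t" by (simp add: reach_def)
  then show "t \<in> type_of ` reach m"
  proof (induction rule: rtranclp_induct)
    case (step t u)
    then obtain m' where m': "m' \<in> reach m" "type_of m' = t" by blast
    then have "normal m'" using m reach_normal by blast
    then obtain m'' where "interchange m' m''" "type_of m'' = u"
      using interchange_lift[OF step(2), of "\<lambda>_. ()" m'] m'(2) unfolding type_of_def by blast
    then show ?case using m'(1) unfolding reach_def by (auto intro: rtranclp.rtrancl_into_rtrancl)
  qed auto
next
  fix t assume "t \<in> type_of ` reach m"
  then obtain u where "u \<in> reach m" "t = type_of u" by blast
  then show "t \<in> reach (type_of m)"
    using reach_map[of u m type_of] interchange_map by (auto simp: type_of_def)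
qed

lemma walk_append: "walk n s (p @ q) t \<longleftrightarrow> (\<exists>u. walk n s p u \<and> walk n u q t)"
  by (induction p arbitrary: s) auto
lemma walk_rev: "walk n s p t \<Longrightarrow> walk n t (rev (map rev_arc p)) s"
  by (induction p arbitrary: s) (auto simp: walk_append rev_arc_in_G_arcs)
lemma walk_G_arcs: "walk n s p t \<Longrightarrow> set p \<subseteq> G_arcs n"
  by (induction p arbitrary: s) auto
lemma perm_of_append: "perm_of (p @ q) = perm_of p \<circ> perm_of q"
  by (induction p) (auto simp: comp_assoc)
lemma perm_of_permutes: "set p \<subseteq> G_arcs n \<Longrightarrow> perm_of p permutes {..<n}"
  by (induction p) (auto intro: permutes_compose lbl_permutes permutes_id)
lemma perm_of_rev: "set p \<subseteq> G_arcs n \<Longrightarrow> perm_of (rev (map rev_arc p)) = inv_into UNIV (perm_of p)"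
proof (induction p)
  case (Cons a p)
  then have "a \<in> G_arcs n" "set p \<subseteq> G_arcs n" by auto
  then have "bij (lbl a)" "bij (perm_of p)"
    by (blast intro: permutes_bij lbl_permutes perm_of_permutes)+
  then have "inv_into UNIV (perm_of (a # p)) = inv_into UNIV (perm_of p) \<circ> inv_into UNIV (lbl a)"
    unfolding perm_of.simps by (rule o_inv_distrib)
  then show ?case using Cons by (simp only: rev.simps list.map perm_of_append perm_of.simps) simp
qed (simp add: inv_id)

text \<open>Path lifting for the covering of \<open>G(n)\<close> by \<open>F(n)\<close>. The first
  label is the leftmost factor of \<open>perm_of\<close>, as \<open>permute_list_compose\<close>
  requires.\<close>

lemma walk_lift:
  assumes "walk n s p t" "m \<in> multilinear n" "type_of m = s"
  obtains m' where "m' \<in> reach m" "type_of m' = t" "indets m' = permute_list (perm_of p) (indets m)"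
proof -
  have "\<exists>m'\<in>reach m. type_of m' = t \<and> indets m' = permute_list (perm_of p) (indets m)"
    using assms
  proof (induction p arbitrary: s m)
    case (Cons a p)
    then have a: "a \<in> G_arcs n" "src a = s" and w: "walk n (tgt a) p t" by auto
    obtain u where u: "(m, u) \<in> F_edges n" "type_of u = tgt a" "indets u = permute_list (lbl a) (indets m)"
      using arc_lift[OF a(1) Cons.prems(2)] Cons.prems(3) a(2) by metis
    have mu: "u \<in> multilinear n" "u \<in> reach m" using u(1) by (auto simp: F_edges_def reach_def)
    obtain m' where m': "m' \<in> reach u" "type_of m' = t" "indets m' = permute_list (perm_of p) (indets u)"
      using Cons.IH[OF w mu(1) u(2)] by blast
    have "indets m' = permute_list (perm_of (a # p)) (indets m)"
      unfolding m'(3) u(3) perm_of.simps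
      by (rule permute_list_compose[symmetric])
        (simp only: multilinear_length[OF Cons.prems(2)] perm_of_permutes[OF walk_G_arcs[OF w]])
    moreover have "m' \<in> reach m" using m'(1) reach_eq[OF mu(2)] by simp
    ultimately show ?case using m'(2) by blast
  qed (auto intro: reach_refl)
  then show ?thesis using that by blast
qed

lemma reach_walk:
  assumes "m \<in> multilinear n" "m' \<in> reach m"
  shows "\<exists>p. walk n (type_of m) p (type_of m') \<and> indets m' = permute_list (perm_of p) (indets m)"
proof -
  have "interchange\<^sup>*\<^sup>* m m'" using assms(2) by (simp add: reach_def)
  then show ?thesis
  proof (induction rule: rtranclp_induct)
    case base
    show ?case by (rule exI[of _ "[]"]) simp
  next
    case (step u v)
    obtain p where p: "walk n (type_of m) p (type_of u)" "indets u = permute_list (perm_of p) (indets m)"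
      using step.IH by blast
    have u: "u \<in> multilinear n" using reach_multilinear[OF assms(1)] step(1) by (simp add: reach_def)
    then have "(u, v) \<in> F_edges n" using step(2) by (simp add: F_edges_iff)
    then obtain \<sigma> where \<sigma>: "(type_of u, \<sigma>, type_of v) \<in> G_arcs n" "indets v = permute_list \<sigma> (indets u)" "\<sigma> permutes {..<n}"
      by (rule F_edge_arc)
    let ?p = "p @ [(type_of u, \<sigma>, type_of v)]"
    have "walk n (type_of m) ?p (type_of v)"
      using p(1) \<sigma>(1) by (auto simp: walk_append src_def tgt_def)
    moreover have "indets v = permute_list (perm_of ?p) (indets m)"
      unfolding \<sigma>(2) p(2) perm_of_append
      by (simp add: lbl_def permute_list_compose multilinear_length[OF assms(1)] \<sigma>(3))
    ultimately show ?case by blast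
  qed
qed

text \<open>Freeness of the action on positions, due to distinct entries.\<close>

lemma permute_list_eq_self_iff:
  assumes "distinct xs" "\<sigma> permutes {..<length xs}"
  shows "permute_list \<sigma> xs = xs \<longleftrightarrow> \<sigma> = id"
proof
  assume e: "permute_list \<sigma> xs = xs"
  show "\<sigma> = id"
  proof
    fix i
    show "\<sigma> i = id i"
    proof (cases "i < length xs")
      case True
      then have "xs ! \<sigma> i = xs ! i" using permute_list_nth[OF assms(2) True] e by simp
      moreover have "\<sigma> i < length xs" using permutes_in_image[OF assms(2), of i] True by simp
      ultimately show ?thesis using assms(1) True by (simp add: nth_eq_iff_index_eq)
    next
      case False
      then show ?thesis using permutes_not_in[OF assms(2), of i] by simp
    qed
  qed
qed simp

text \<open>With distinct sources a repeated edge must be run through backwards the second time. An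
  arc before, between or after the two passages would then start at a vertex already used, so the
  walk only goes there and back.\<close>

lemma closed_walk_distinct_edges:
  assumes "walk n s c s" "distinct (map src c)" "\<not> distinct (map edge_of c)"
  shows "\<exists>a. c = [a, rev_arc a]"
proof -
  obtain xs ys zs e where e: "map edge_of c = xs @ [e] @ ys @ [e] @ zs"
    using not_distinct_decomp[OF assms(3)] by blast
  then obtain xs' a ys' b zs' where c: "c = xs' @ [a] @ ys' @ [b] @ zs'" "edge_of a = edge_of b"
    by (auto simp: map_eq_append_conv map_eq_Cons_conv append_eq_map_conv Cons_eq_map_conv)
  have "src a \<noteq> src b" using assms(2) unfolding c by auto
  moreover have "b \<in> {a, rev_arc a}" using c(2) unfolding edge_of_def by blast
  ultimately have b: "b = rev_arc a" by auto
  obtain u where w: "walk n s xs' (src a)" "walk n (tgt a) ys' u" "walk n u ([b] @ zs') s"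
    using assms(1) unfolding c by (auto simp: walk_append)
  have u: "u = tgt a" and z: "walk n (src a) zs' s" using w(3) b by auto
  have "ys' = []"
  proof (cases ys')
    case (Cons y ys'')
    then have "src y = src b" using w(2) b by auto
    then show ?thesis using assms(2) unfolding c Cons by auto
  qed simp
  moreover have "zs' = []"
  proof (cases zs')
    case (Cons y ys'')
    then have "src y = src a" using z by auto
    then show ?thesis using assms(2) unfolding c Cons by auto
  qed simp
  moreover have "xs' = []"
  proof (cases xs')
    case (Cons y ys'')
    then have "src y = src a" using w(1) z \<open>zs' = []\<close> by auto
    then show ?thesis using assms(2) unfolding c Cons by auto
  qed simp
  ultimately show ?thesis using c b by auto
qed

text \<open>At a repeated vertex a closed walk splits into an inner loop and the remaining closed
  walk. If both products were trivial, so would be the whole, hence one of the shorter walks is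
  nontrivial. A walk there and back has trivial product, so the process ends in a cycle.\<close>

lemma shortest_nontrivial_closed_walk:
  assumes "walk n s c s" "perm_of c \<noteq> id" "s \<in> C"
    and closed: "\<And>a. a \<in> G_arcs n \<Longrightarrow> src a \<in> C \<Longrightarrow> tgt a \<in> C"
  shows "\<exists>s c. cycle n C s c \<and> nontrivial c"
  using assms(1-3)
proof (induction "length c" arbitrary: s c rule: less_induct)
  case less
  have walk_in: "t \<in> C" if "walk n s p t" "s \<in> C" for s p t
    using that closed by (induction p arbitrary: s) auto
  have c: "c \<noteq> []" using less.prems by auto
  show ?case
  proof (cases "distinct (map src c)")
    case False
    then obtain xs ys zs v where "map src c = xs @ [v] @ ys @ [v] @ zs" using not_distinct_decomp by blast
    then obtain xs' a ys' b zs' where d: "c = xs' @ [a] @ ys' @ [b] @ zs'" "src a = src b"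
      by (auto simp: map_eq_append_conv map_eq_Cons_conv append_eq_map_conv Cons_eq_map_conv)
    obtain u where w: "walk n s xs' (src a)" "walk n (src a) ([a] @ ys') u" "walk n u ([b] @ zs') s"
      using less.prems(1) unfolding d(1) by (auto simp: walk_append)
    have u: "u = src a" using w(3) d(2) by auto
    have inner: "walk n (src a) ([a] @ ys') (src a)" using w(2) u by simp
    have outer: "walk n s (xs' @ [b] @ zs') s" using w(1,3) u unfolding walk_append by blast
    have "perm_of ([a] @ ys') \<noteq> id \<or> perm_of (xs' @ [b] @ zs') \<noteq> id"
    proof (rule ccontr)
      assume "\<not> ?thesis"
      then have i: "perm_of ([a] @ ys') = id" and o: "perm_of (xs' @ [b] @ zs') = id" by auto
      have "perm_of c = perm_of xs' \<circ> (perm_of ([a] @ ys') \<circ> perm_of ([b] @ zs'))"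
        unfolding d(1) by (simp only: perm_of_append comp_assoc)
      also have "\<dots> = id" using o unfolding i by (simp only: perm_of_append id_comp)
      finally show False using less.prems(2) by simp
    qed
    then show ?thesis
    proof
      assume "perm_of ([a] @ ys') \<noteq> id"
      then show ?thesis using less.hyps[OF _ inner] walk_in[OF w(1) less.prems(3)] by (simp add: d(1))
    next
      assume "perm_of (xs' @ [b] @ zs') \<noteq> id"
      then show ?thesis using less.hyps[OF _ outer _ less.prems(3)] by (simp add: d(1))
    qed
  next
    case True
    have "distinct (map edge_of c)"
    proof (rule ccontr)
      assume "\<not> ?thesis"
      then obtain a where a: "c = [a, rev_arc a]" using closed_walk_distinct_edges less.prems(1) True by blast
      then have "a \<in> G_arcs n" using less.prems(1) by simp
      then have "perm_of c = id" using permutes_inv_o(1)[OF lbl_permutes] by (simp add: a)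
      then show False using less.prems(2) by simp
    qed
    then have "cycle n C s c" using True less.prems c by (simp add: cycle_def)
    then show ?thesis using less.prems(2) unfolding nontrivial_def by blast
  qed
qed

section \<open>The two-sheeted covering and its monodromy\<close>

lemma type_of_swap [simp]: "type_of (swap_indets x y m) = type_of m"
  by (simp add: swap_indets_def)
lemma indets_swap: "indets (swap_indets x y m) = map (transpose x y) (indets m)"
  by (simp add: swap_indets_def indets_map_mono)
lemma swap_swap [simp]: "swap_indets x y (swap_indets x y m) = m"
  by (rule type_indets_inject) (simp_all add: indets_swap)
lemma swap_in_reach: "u \<in> reach m \<Longrightarrow> swap_indets x y u \<in> reach (swap_indets x y m)"
  unfolding swap_indets_def by (rule reach_map) (auto intro: interchange_map)

text \<open>The renaming moves every monomial of the class, since \<open>x\<close> occurs and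
  differs from \<open>y\<close>; this gives at least two sheets, and \<open>card_le\<close> gives at
  most two. All assumptions are stable under quarter turns.\<close>

locale two_sheeted =
  fixes n :: nat and x y :: nat and m0 :: "nat mono"
  assumes m0: "m0 \<in> multilinear n" and xy: "x < n" "x \<noteq> y"
    and swap_m0: "swap_indets x y m0 \<in> reach m0"
    and card_le: "card (reach m0) \<le> 2 * card (reach (type_of m0))"
begin

abbreviation swap :: "nat mono \<Rightarrow> nat mono" where "swap \<equiv> swap_indets x y"
abbreviation C :: "unit mono set" where "C \<equiv> reach (type_of m0)"

lemma C_eq: "C = type_of ` reach m0"
  using m0 reach_type_of by (auto simp: multilinear_iff)
lemma C_subset: "C \<subseteq> assoc_types n"
  by (rule reach_subset_assoc_types[OF type_of_multilinear[OF m0]])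
lemma finite_C: "finite C"
  by (rule finite_subset[OF C_subset finite_assoc_types])

lemma swap_reach: assumes "m \<in> reach m0" shows "swap m \<in> reach m0"
  using swap_in_reach[OF assms, of x y] reach_eq[OF swap_m0] by simp

lemma multi: "m \<in> reach m0 \<Longrightarrow> m \<in> multilinear n"
  by (rule reach_multilinear[OF m0])

lemma swap_neq: assumes "m \<in> reach m0" shows "swap m \<noteq> m"
proof
  assume e: "swap m = m"
  have "x \<in> set (indets m)" using multi[OF assms] xy by (auto simp: multilinear_def)
  then obtain i where i: "i < length (indets m)" "indets m ! i = x" by (auto simp: in_set_conv_nth)
  then have "indets (swap m) ! i = y" by (simp add: indets_swap)
  then show False using e i xy by simp
qed

lemma finite_reach_m0: "finite (reach m0)"
proof -
  let ?f = "\<lambda>m. (type_of m, indets m)"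
  have "inj_on ?f (reach m0)" by (rule inj_onI) (auto intro: type_indets_inject)
  moreover have "?f ` reach m0 \<subseteq> assoc_types n \<times> {xs. set xs \<subseteq> {..<n} \<and> length xs = n}"
  proof (intro image_subsetI SigmaI)
    fix m assume "m \<in> reach m0"
    then have m: "m \<in> multilinear n" by (rule multi)
    show "type_of m \<in> assoc_types n" by (rule type_of_multilinear[OF m])
    show "indets m \<in> {xs. set xs \<subseteq> {..<n} \<and> length xs = n}"
      using multilinear_length[OF m] m by (simp add: multilinear_def)
  qed
  moreover have "finite (assoc_types n \<times> {xs. set xs \<subseteq> {..<n} \<and> length xs = n})"
    by (intro finite_cartesian_product finite_assoc_types finite_lists_length_eq finite_lessThan)
  ultimately show ?thesis by (rule inj_on_finite)
qed

text \<open>Each fibre contains a monomial and its renaming. A third element in one fibre would push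
  the class beyond twice the number of types.\<close>

lemma two_sheets:
  assumes "m \<in> reach m0" "m' \<in> reach m0" "type_of m' = type_of m"
  shows "m' = m \<or> m' = swap m"
proof (rule ccontr)
  assume ne: "\<not> ?thesis"
  let ?f = "\<lambda>t. {u \<in> reach m0. type_of u = t}"
  have fin: "finite (?f t)" for t using finite_reach_m0 by simp
  have ge: "card (?f t) \<ge> 2" if t: "t \<in> C" for t
  proof -
    obtain u where u: "u \<in> reach m0" "type_of u = t" using t unfolding C_eq by blast
    have "card {u, swap u} = 2" using swap_neq[OF u(1)] by auto
    moreover have "{u, swap u} \<subseteq> ?f t" using u swap_reach by auto
    ultimately show ?thesis using card_mono[OF fin, of "{u, swap u}" t] by simp
  qed
  have mC: "type_of m \<in> C" unfolding C_eq using assms(1) by blast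
  have "card {m, swap m, m'} = 3" using swap_neq[OF assms(1)] ne by auto
  moreover have "{m, swap m, m'} \<subseteq> ?f (type_of m)" using assms swap_reach by auto
  ultimately have g3: "card (?f (type_of m)) \<ge> 3" using card_mono[OF fin, of "{m, swap m, m'}" "type_of m"] by simp
  have "(\<Sum>t\<in>C. 2) < (\<Sum>t\<in>C. card (?f t))"
    by (rule sum_strict_mono_ex1[OF finite_C]) (use ge mC g3 in force)+
  also have "(\<Sum>t\<in>C. card (?f t)) = card (\<Union>t\<in>C. ?f t)"
    by (rule card_UN_disjoint[symmetric, OF finite_C]) (use fin in auto)
  also have "(\<Union>t\<in>C. ?f t) = reach m0" unfolding C_eq by blast
  finally show False using card_le by simp
qed

lemma src_tgt_C: "a \<in> G_arcs n \<Longrightarrow> src a \<in> C \<Longrightarrow> tgt a \<in> C"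
proof -
  assume a: "a \<in> G_arcs n" "src a \<in> C"
  then have "(src a, tgt a) \<in> G_adj n" unfolding G_adj_def by blast
  then have "interchange (src a) (tgt a)" using G_adj_iff C_subset a(2) by blast
  then have "tgt a \<in> reach (src a)" by (simp add: reach_def r_into_rtranclp)
  then show "tgt a \<in> C" using reach_eq[OF a(2)] by simp
qed
lemma walk_src_C: "walk n s p t \<Longrightarrow> s \<in> C \<Longrightarrow> a \<in> set p \<Longrightarrow> src a \<in> C \<and> a \<in> G_arcs n"
  using src_tgt_C by (induction p arbitrary: s) auto

text \<open>A nontrivial product moves the monomial by freeness, and the other sheet is the only
  place left in the fibre.\<close>

lemma closed_walk_lift:
  assumes "m \<in> reach m0" "walk n (type_of m) q (type_of m)" "perm_of q \<noteq> id"
    "indets m'' = permute_list (perm_of q) (indets m)" "type_of m'' = type_of m"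
  shows "m'' = swap m"
proof -
  obtain m' where m': "m' \<in> reach m" "type_of m' = type_of m" "indets m' = permute_list (perm_of q) (indets m)"
    by (rule walk_lift[OF assms(2) multi[OF assms(1)] refl])
  have "m'' = m'" by (rule type_indets_inject) (simp_all only: m' assms)
  moreover have "m'' \<noteq> m"
  proof
    assume "m'' = m"
    then have "permute_list (perm_of q) (indets m) = indets m" using assms(4) by simp
    then have "perm_of q = id"
      using permute_list_eq_self_iff[of "indets m" "perm_of q"] multi[OF assms(1)]
        perm_of_permutes[OF walk_G_arcs[OF assms(2)]] multilinear_length[OF multi[OF assms(1)]]
      by (simp add: multilinear_def)
    then show False using assms(3) by simp
  qed
  moreover have "m' \<in> reach m0" using m'(1) reach_eq[OF assms(1)] by simp
  ultimately show ?thesis using two_sheets[OF assms(1)] assms(5) by auto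
qed

lemma connecting_walk: "m \<in> reach m0 \<Longrightarrow> s \<in> C \<Longrightarrow> \<exists>p. walk n (type_of m) p s"
proof -
  assume m: "m \<in> reach m0" and "s \<in> C"
  then obtain u where u: "u \<in> reach m0" "type_of u = s" unfolding C_eq by blast
  then have "u \<in> reach m" using reach_eq[OF m] by simp
  then show ?thesis using reach_walk[OF multi[OF m]] u(2) by blast
qed

text \<open>Conjugation by the connecting walk keeps the product nontrivial, so every choice of that
  walk ends on the other sheet.\<close>

lemma produces_iff:
  assumes m: "m \<in> reach m0" and c: "cycle n C s c" "nontrivial c"
  shows "produces n s c m m'' \<longleftrightarrow> m'' = swap m"
proof -
  have w: "walk n s c s" "s \<in> C" using c(1) by (auto simp: cycle_def)
  have loop: "walk n (type_of m) (p @ c @ rev (map rev_arc p)) (type_of m)"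
    "perm_of (p @ c @ rev (map rev_arc p)) \<noteq> id" if p: "walk n (type_of m) p s" for p
  proof -
    show "walk n (type_of m) (p @ c @ rev (map rev_arc p)) (type_of m)"
      using p w(1) walk_rev[OF p] unfolding walk_append by blast
    let ?P = "perm_of p" and ?Q = "perm_of c"
    have bij: "bij ?P" using perm_of_permutes[OF walk_G_arcs[OF p]] by (rule permutes_bij)
    have "perm_of (p @ c @ rev (map rev_arc p)) = ?P \<circ> (?Q \<circ> inv_into UNIV ?P)"
      by (simp only: perm_of_append perm_of_rev[OF walk_G_arcs[OF p]])
    moreover have "?P \<circ> (?Q \<circ> inv_into UNIV ?P) \<noteq> id"
    proof
      assume "?P \<circ> (?Q \<circ> inv_into UNIV ?P) = id"
      then have "(?P \<circ> (?Q \<circ> inv_into UNIV ?P)) (?P z) = ?P z" for z by simp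
      then have "?P (?Q z) = ?P z" for z using bij by (simp add: bij_is_inj inv_f_f)
      then have "?Q = id" using bij by (auto simp: fun_eq_iff bij_def inj_eq)
      then show False using c(2) by (simp add: nontrivial_def)
    qed
    ultimately show "perm_of (p @ c @ rev (map rev_arc p)) \<noteq> id" by simp
  qed
  show ?thesis
  proof
    assume "produces n s c m m''"
    then obtain p where "walk n (type_of m) p s" "type_of m'' = type_of m"
      "indets m'' = permute_list (perm_of (p @ c @ rev (map rev_arc p))) (indets m)"
      unfolding produces_def by blast
    then show "m'' = swap m" using closed_walk_lift[OF m loop] by blast
  next
    assume e: "m'' = swap m"
    obtain p where p: "walk n (type_of m) p s" using connecting_walk[OF m w(2)] by blast
    let ?q = "p @ c @ rev (map rev_arc p)"
    obtain m' where m': "m' \<in> reach m" "type_of m' = type_of m" "indets m' = permute_list (perm_of ?q) (indets m)"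
      by (rule walk_lift[OF loop(1)[OF p] multi[OF m] refl])
    then have "m' = swap m" using closed_walk_lift[OF m loop[OF p]] by blast
    then show "produces n s c m m''" unfolding produces_def using p m'(2,3) e by blast
  qed
qed

text \<open>A path from \<open>m0\<close> to its renaming projects to a closed walk with nontrivial
  product, which is then shortened to a cycle.\<close>

lemma ex_nontrivial_cycle: "\<exists>s c. cycle n C s c \<and> nontrivial c"
proof -
  obtain p where p: "walk n (type_of m0) p (type_of m0)" "indets (swap m0) = permute_list (perm_of p) (indets m0)"
    using reach_walk[OF m0 swap_m0] unfolding type_of_swap by (elim exE conjE)
  have "perm_of p \<noteq> id"
  proof
    assume "perm_of p = id"
    then have "indets (swap m0) = indets m0" using p(2) by (simp only: permute_list_id)
    then have "swap m0 = m0" by (rule type_indets_inject[OF type_of_swap])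
    then show False using swap_neq[OF reach_refl] by (rule notE[rotated])
  qed
  then show ?thesis
    by (rule shortest_nontrivial_closed_walk[OF p(1) _ reach_refl src_tgt_C])
qed

text \<open>The monodromy of a walk relative to a section of the covering, as an element of \<open>\<int>/2\<close>.\<close>

definition sheet :: "unit mono \<Rightarrow> nat mono" where
  "sheet t = (SOME m. m \<in> reach m0 \<and> type_of m = t)"
definition switch :: "bit \<Rightarrow> nat mono \<Rightarrow> nat mono" where
  "switch b m = (if b = 1 then swap m else m)"
definition weight :: "arc \<Rightarrow> bit" where
  "weight a = (if indets (sheet (tgt a)) = permute_list (lbl a) (indets (sheet (src a))) then 0 else 1)"

lemma sheet: "t \<in> C \<Longrightarrow> sheet t \<in> reach m0 \<and> type_of (sheet t) = t"
  unfolding sheet_def C_eq by (rule someI_ex) blast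

lemma switch_switch: "switch a (switch b m) = switch (a + b) m"
  by (cases a; cases b) (simp_all add: switch_def)
lemma switch_eq_self: "m \<in> reach m0 \<Longrightarrow> switch b m = m \<longleftrightarrow> b = 0"
  using swap_neq by (cases b) (simp_all add: switch_def)
lemma type_of_switch [simp]: "type_of (switch b m) = type_of m"
  by (simp add: switch_def)

lemma weight:
  assumes a: "a \<in> G_arcs n" "src a \<in> C"
  shows "permute_list (lbl a) (indets (sheet (src a))) = indets (switch (weight a) (sheet (tgt a)))"
proof -
  note s = sheet[OF a(2)] and t = sheet[OF src_tgt_C[OF a]]
  obtain m' where m': "(sheet (src a), m') \<in> F_edges n" "type_of m' = tgt a"
    "indets m' = permute_list (lbl a) (indets (sheet (src a)))"
    by (rule arc_lift[OF a(1) multi[OF conjunct1[OF s]] conjunct2[OF s]])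
  have "m' \<in> reach (sheet (src a))" using m'(1) by (simp add: F_edges_iff reach_def r_into_rtranclp)
  then have "m' \<in> reach m0" using reach_eq[OF conjunct1[OF s]] by simp
  then have "m' = sheet (tgt a) \<or> m' = swap (sheet (tgt a))"
    using two_sheets[OF conjunct1[OF t]] t m'(2) by simp
  then show ?thesis
  proof
    assume "m' = sheet (tgt a)"
    then show ?thesis using m'(3) by (simp add: weight_def switch_def)
  next
    assume e: "m' = swap (sheet (tgt a))"
    then have "indets (sheet (tgt a)) \<noteq> indets m'"
      using swap_neq[OF conjunct1[OF t]] type_indets_inject[of "sheet (tgt a)" m'] by auto
    then show ?thesis using m'(3) e by (simp add: weight_def switch_def)
  qed
qed

lemma walk_weight:
  assumes "walk n s p t" "s \<in> C"
  shows "permute_list (perm_of p) (indets (sheet s)) = indets (switch (\<Sum>a\<leftarrow>p. weight a) (sheet t))"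
  using assms
proof (induction p arbitrary: s)
  case (Cons a p)
  then have a: "a \<in> G_arcs n" "src a = s" "src a \<in> C" and w: "walk n (tgt a) p t" by auto
  note tC = src_tgt_C[OF a(1,3)]
  have len: "length (indets (sheet u)) = n" if "u \<in> C" for u
    using sheet[OF that] multi multilinear_length by blast
  have pp: "perm_of p permutes {..<n}" by (rule perm_of_permutes[OF walk_G_arcs[OF w]])
  have sw: "indets (switch b m) = map (if b = 1 then transpose x y else id) (indets m)" for b m
    by (simp add: switch_def indets_swap)
  have "permute_list (perm_of (a # p)) (indets (sheet s)) = permute_list (perm_of p) (permute_list (lbl a) (indets (sheet s)))"
    unfolding perm_of.simps by (rule permute_list_compose) (use pp len Cons.prems(2) in simp)
  also have "\<dots> = permute_list (perm_of p) (indets (switch (weight a) (sheet (tgt a))))"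
    using weight[OF a(1,3)] a(2) by simp
  \<comment> \<open>Renaming indeterminates commutes with permuting positions, so the switch made by
    the first arc can be moved past the rest of the walk.\<close>
  also have "\<dots> = map (if weight a = 1 then transpose x y else id) (permute_list (perm_of p) (indets (sheet (tgt a))))"
    unfolding sw by (rule permute_list_map) (use pp len tC in simp)
  also have "\<dots> = indets (switch (weight a) (switch (\<Sum>a\<leftarrow>p. weight a) (sheet t)))"
    unfolding Cons.IH[OF w tC] sw[of "weight a"] ..
  finally show ?case by (simp only: switch_switch list.map sum_list.Cons)
qed (simp add: switch_def)

text \<open>Turns a statement about products in the symmetric group into a linear one over
  \<open>bit\<close>, which can be evaluated on symmetric differences of edge sets.\<close>

lemma closed_walk_weight:
  assumes "walk n s p s" "s \<in> C"
  shows "perm_of p = id \<longleftrightarrow> (\<Sum>a\<leftarrow>p. weight a) = 0"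
proof -
  note s = sheet[OF assms(2)]
  have "perm_of p = id \<longleftrightarrow> permute_list (perm_of p) (indets (sheet s)) = indets (sheet s)"
    using permute_list_eq_self_iff[of "indets (sheet s)" "perm_of p"] multi s
      perm_of_permutes[OF walk_G_arcs[OF assms(1)]] multilinear_length[OF multi]
    by (simp add: multilinear_def)
  also have "\<dots> \<longleftrightarrow> switch (\<Sum>a\<leftarrow>p. weight a) (sheet s) = sheet s"
    unfolding walk_weight[OF assms] using type_indets_inject[of "switch (\<Sum>a\<leftarrow>p. weight a) (sheet s)" "sheet s"]
    by auto
  also have "\<dots> \<longleftrightarrow> (\<Sum>a\<leftarrow>p. weight a) = 0" using s switch_eq_self by blast
  finally show ?thesis .
qed

text \<open>Makes \<open>weight\<close> a function of undirected edges.\<close>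

lemma weight_rev:
  assumes a: "a \<in> G_arcs n" "src a \<in> C" shows "weight (rev_arc a) = weight a"
proof -
  have w: "walk n (src a) [a, rev_arc a] (src a)" using a by (simp add: rev_arc_in_G_arcs)
  have "perm_of [a, rev_arc a] = id" using permutes_inv_o(1)[OF lbl_permutes[OF a(1)]] by simp
  then have "weight a + weight (rev_arc a) = 0" using closed_walk_weight[OF w a(2)] by simp
  then show ?thesis by (cases "weight a"; cases "weight (rev_arc a)") simp_all
qed

end

section \<open>Edge sets over \<open>\<int>/2\<close>\<close>

text \<open>The choice is harmless because it is applied to functions that agree on an arc and its
  reverse.\<close>

definition on_edge :: "(arc \<Rightarrow> bit) \<Rightarrow> arc set \<Rightarrow> bit" where
  "on_edge h e = h (SOME a. a \<in> e)"
text \<open>The boundary map modulo 2 at the vertex \<open>v\<close>; a loop contributes twice, that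
  is, zero.\<close>

definition incident :: "unit mono \<Rightarrow> arc \<Rightarrow> bit" where
  "incident v a = (if src a = v then 1 else 0) + (if tgt a = v then 1 else 0)"

lemma on_edge: assumes "h (rev_arc a) = h a" shows "on_edge h (edge_of a) = h a"
proof -
  have "(SOME b. b \<in> edge_of a) \<in> edge_of a" by (rule someI[of _ a]) (simp add: edge_of_def)
  then have "(SOME b. b \<in> edge_of a) = a \<or> (SOME b. b \<in> edge_of a) = rev_arc a"
    by (simp add: edge_of_def)
  then show ?thesis unfolding on_edge_def using assms by auto
qed

lemma incident_rev [simp]: "incident v (rev_arc a) = incident v a"
  by (simp only: incident_def src_rev_arc tgt_rev_arc add.commute)

lemma edge_of_rev: "a \<in> G_arcs n \<Longrightarrow> edge_of (rev_arc a) = edge_of a"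
  by (auto simp: edge_of_def rev_rev_arc)

lemma sum_cycle_edges:
  assumes "distinct (map edge_of c)" "\<And>a. a \<in> set c \<Longrightarrow> h (rev_arc a) = h a"
  shows "(\<Sum>e\<in>cycle_edges c. on_edge h e) = (\<Sum>a\<leftarrow>c. h a)"
proof -
  have d: "distinct c" "inj_on edge_of (set c)" using assms(1) by (simp_all add: distinct_map)
  have "(\<Sum>e\<in>cycle_edges c. on_edge h e) = (\<Sum>a\<in>set c. on_edge h (edge_of a))"
    unfolding cycle_edges_def by (simp add: sum.reindex[OF d(2)])
  also have "\<dots> = (\<Sum>a\<in>set c. h a)" by (rule sum.cong[OF refl]) (rule on_edge[where h = h, OF assms(2)])
  also have "\<dots> = (\<Sum>a\<leftarrow>c. h a)" using d(1) by (simp only: sum_list_distinct_conv_sum_set)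
  finally show ?thesis .
qed

lemma bit_add_cancel: "a + b + (b + c) = a + c" for a b c :: bit
  by (cases a; cases b; cases c) simp_all
text \<open>Telescoping: inner vertices cancel and only the two ends remain.\<close>

lemma walk_incident:
  "walk n s p t \<Longrightarrow> (\<Sum>a\<leftarrow>p. incident v a) = (if s = v then 1 else 0) + (if t = v then 1 else 0)"
proof (induction p arbitrary: s)
  case Nil
  then show ?case by simp
next
  case (Cons a p)
  then have "src a = s" "walk n (tgt a) p t" by auto
  then show ?case using Cons.IH[of "tgt a"]
    by (simp only: list.map sum_list.Cons incident_def[of v a] bit_add_cancel)
qed

context two_sheeted begin

text \<open>A longest path in \<open>X\<close> ends at a vertex \<open>t\<close> where its last edge
  contributes 1. By evenness another edge of \<open>X\<close> meets \<open>t\<close>, and by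
  maximality it leads back to the path and closes a cycle. Loops do not contribute to the boundary
  and are cycles at once, so they are treated first.\<close>

lemma even_edges_contain_cycle:
  assumes X: "X \<subseteq> edges n C" "finite X" "X \<noteq> {}" and even: "\<And>v. (\<Sum>e\<in>X. on_edge (incident v) e) = 0"
  shows "\<exists>s c. cycle n C s c \<and> cycle_edges c \<subseteq> X"
proof (cases "\<exists>a\<in>G_arcs n. src a \<in> C \<and> edge_of a \<in> X \<and> src a = tgt a")
  case True
  then obtain a where a: "a \<in> G_arcs n" "src a \<in> C" "edge_of a \<in> X" "src a = tgt a" by blast
  then have "cycle n C (src a) [a]" "cycle_edges [a] \<subseteq> X" by (simp_all add: cycle_def cycle_edges_def)
  then show ?thesis by blast
next
  case no_loop: False
  define P where "P p \<longleftrightarrow> p \<noteq> [] \<and> (\<exists>s t. s \<in> C \<and> walk n s p t \<and> distinct (map src p @ [t]) \<and> (\<forall>b\<in>set p. edge_of b \<in> X))"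
    for p
  obtain a where a: "a \<in> G_arcs n" "src a \<in> C" "edge_of a \<in> X" using X(1,3) unfolding edges_def by blast
  then have "src a \<noteq> tgt a" using no_loop by blast
  then have Pa: "P [a]" unfolding P_def using a by auto
  have bound: "length p \<le> card C" if Pp: "P p" for p
  proof -
    obtain s t where st: "s \<in> C" "walk n s p t" "distinct (map src p)" using Pp unfolding P_def by auto
    have "set (map src p) \<subseteq> C" using walk_src_C[OF st(2,1)] by auto
    then show ?thesis using card_mono[OF finite_C, of "set (map src p)"] distinct_card[OF st(3)] by simp
  qed
  have "\<exists>p. P p \<and> (\<forall>q. P q \<longrightarrow> length q \<le> length p)"
    by (rule ex_has_greatest_nat[of P "[a]" length "Suc (card C)", OF Pa])
      (intro allI impI le_imp_less_Suc bound)
  then obtain p where p: "P p" "\<And>q. P q \<Longrightarrow> length q \<le> length p" by (elim exE conjE) simp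
  obtain s t where st: "s \<in> C" "walk n s p t" "distinct (map src p @ [t])" "\<forall>b\<in>set p. edge_of b \<in> X" "p \<noteq> []"
    using p(1) unfolding P_def by blast
  obtain q a where q: "p = q @ [a]" using st(5) by (cases p rule: rev_cases) auto
  have t: "tgt a = t" "src a \<noteq> t" "edge_of a \<in> X" using st(2-4) unfolding q by (auto simp: walk_append)
  have inc: "on_edge (incident t) (edge_of a) = 1" using t(1,2) by (simp add: on_edge incident_def)
  have "\<exists>e\<in>X. e \<noteq> edge_of a \<and> on_edge (incident t) e = 1"
  proof (rule ccontr)
    assume "\<not> ?thesis"
    then have "(\<Sum>e\<in>X - {edge_of a}. on_edge (incident t) e) = 0" by (intro sum.neutral) auto
    then have "(\<Sum>e\<in>X. on_edge (incident t) e) = 1"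
      using sum.remove[OF X(2) t(3), of "on_edge (incident t)"] inc by simp
    then show False using even by simp
  qed
  then obtain e where e: "e \<in> X" "e \<noteq> edge_of a" "on_edge (incident t) e = 1" by blast
  then obtain b0 where b0: "b0 \<in> G_arcs n" "src b0 \<in> C" "e = edge_of b0" using X(1) unfolding edges_def by blast
  have "incident t b0 = 1" using e(3) unfolding b0(3) by (simp add: on_edge)
  then have one: "(src b0 = t) \<noteq> (tgt b0 = t)" by (auto simp: incident_def split: if_splits)
  define b where "b = (if src b0 = t then b0 else rev_arc b0)"
  have b: "b \<in> G_arcs n" "src b = t" "tgt b \<noteq> t" "edge_of b = e"
    using b0 one rev_arc_in_G_arcs[OF b0(1)] edge_of_rev[OF b0(1)] by (auto simp: b_def)
  show ?thesis
  proof (cases "tgt b \<in> set (map src p)")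
    case False
    have "walk n s (p @ [b]) (tgt b)" using st(2) b by (auto simp: walk_append)
    moreover have "distinct (map src (p @ [b]) @ [tgt b])" using st(3) b False by auto
    moreover have "\<forall>d\<in>set (p @ [b]). edge_of d \<in> X" using st(4) b(4) e(1) by auto
    ultimately have "P (p @ [b])" unfolding P_def using st(1) by blast
    then show ?thesis using p(2)[of "p @ [b]"] by simp
  next
    case True
    then obtain d where d: "d \<in> set p" "tgt b = src d" by auto
    obtain p1 p2 where p12: "p = p1 @ d # p2" using split_list[OF d(1)] by blast
    let ?c = "(d # p2) @ [b]"
    have "walk n (src d) (d # p2) t" using st(2) unfolding p12 by (auto simp: walk_append)
    then have w: "walk n (src d) ?c (src d)" unfolding walk_append using b d(2) by auto
    have ds: "distinct (map src ?c)" using st(3) b(2) unfolding p12 by auto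
    have "distinct (map edge_of ?c)"
    proof (rule ccontr)
      assume "\<not> ?thesis"
      then obtain x where x: "?c = [x, rev_arc x]" using closed_walk_distinct_edges[OF w ds] by blast
      then have "p2 = []" "b = rev_arc d" by (cases p2; simp)+
      moreover then have "d = a" using q p12 by simp
      \<comment> \<open>The closing edge could repeat an edge of the cycle only by running back
        along the last arc, but it was chosen different from that one.\<close>
      ultimately have "edge_of b = edge_of a" using edge_of_rev walk_G_arcs[OF st(2)] d(1) by blast
      then show False using b(4) e(2) by simp
    qed
    moreover have "src d \<in> C" using walk_src_C[OF st(2,1) d(1)] by blast
    ultimately have "cycle n C (src d) ?c" using w ds by (simp add: cycle_def)
    moreover have "cycle_edges ?c \<subseteq> X" using st(4) b(4) e(1) unfolding p12 by (auto simp: cycle_edges_def)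
    ultimately show ?thesis by blast
  qed
qed

end

section \<open>Rows of bit matrices as edge sets\<close>

lemma sum_selected:
  fixes g :: "'e \<Rightarrow> bit"
  assumes "distinct es"
  shows "(\<Sum>e\<in>{es ! j | j. j < length es \<and> v j = 1}. g e) = (\<Sum>j<length es. v j * g (es ! j))"
proof -
  have "{es ! j | j. j < length es \<and> v j = 1} = (!) es ` {j\<in>{..<length es}. v j = 1}" by auto
  moreover have "inj_on ((!) es) {j\<in>{..<length es}. v j = 1}"
    using assms by (auto simp: inj_on_def nth_eq_iff_index_eq)
  ultimately have "(\<Sum>e\<in>{es ! j | j. j < length es \<and> v j = 1}. g e) = (\<Sum>j\<in>{j\<in>{..<length es}. v j = 1}. g (es ! j))"
    by (simp only: sum.reindex comp_def)
  also have "\<dots> = (\<Sum>j\<in>{..<length es}. v j * g (es ! j))"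
  proof (rule sum.mono_neutral_cong_left)
    show "\<forall>j\<in>{..<length es} - {j\<in>{..<length es}. v j = 1}. v j * g (es ! j) = 0" by auto
  qed auto
  finally show ?thesis .
qed

lemma mult_mat_entry:
  assumes "A \<in> carrier_mat r k" "B \<in> carrier_mat k m" "i < r" "j < m"
  shows "(A * B) $$ (i, j) = (\<Sum>l<k. A $$ (i, l) * B $$ (l, j))"
  using assms by (simp add: scalar_prod_def atLeast0LessThan)

lemma mult_mat_row_sum:
  fixes g :: "nat \<Rightarrow> bit"
  assumes "A \<in> carrier_mat r k" "B \<in> carrier_mat k m" "i < r"
  shows "(\<Sum>j<m. (A * B) $$ (i, j) * g j) = (\<Sum>l<k. A $$ (i, l) * (\<Sum>j<m. B $$ (l, j) * g j))"
proof -
  have "(\<Sum>j<m. (A * B) $$ (i, j) * g j) = (\<Sum>j<m. \<Sum>l<k. A $$ (i, l) * B $$ (l, j) * g j)"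
    by (rule sum.cong[OF refl]) (simp only: mult_mat_entry[OF assms] lessThan_iff sum_distrib_right)
  also have "\<dots> = (\<Sum>l<k. \<Sum>j<m. A $$ (i, l) * B $$ (l, j) * g j)" by (rule sum.swap)
  also have "\<dots> = (\<Sum>l<k. A $$ (i, l) * (\<Sum>j<m. B $$ (l, j) * g j))"
    by (simp only: sum_distrib_left mult.assoc)
  finally show ?thesis .
qed

lemma of_nat_bit: "(of_nat k :: bit) = (if odd k then 1 else 0)"
  by (induction k) auto

lemma sum_indicator_odd:
  assumes "finite A"
  shows "(\<Sum>i\<in>A. if Q i then 1 else 0 :: bit) = (if odd (card {i \<in> A. Q i}) then 1 else 0)"
proof -
  have "(\<Sum>i\<in>A. if Q i then 1 else 0 :: bit) = of_nat (card {i \<in> A. Q i})"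
    using assms by (simp add: sum.If_cases Int_def)
  then show ?thesis by (simp only: of_nat_bit)
qed

context two_sheeted begin

lemma cycle_sums:
  assumes "cycle n C s c"
  shows "(\<Sum>e\<in>cycle_edges c. on_edge weight e) = 0 \<longleftrightarrow> \<not> nontrivial c"
    and "(\<Sum>e\<in>cycle_edges c. on_edge (incident v) e) = 0"
    and "cycle_edges c \<subseteq> edges n C" "cycle_edges c \<noteq> {}"
proof -
  have c: "c \<noteq> []" "s \<in> C" "walk n s c s" "distinct (map edge_of c)" using assms by (auto simp: cycle_def)
  have "(\<Sum>e\<in>cycle_edges c. on_edge weight e) = (\<Sum>a\<leftarrow>c. weight a)"
    by (rule sum_cycle_edges[OF c(4)]) (use walk_src_C[OF c(3,2)] weight_rev in blast)
  then show "(\<Sum>e\<in>cycle_edges c. on_edge weight e) = 0 \<longleftrightarrow> \<not> nontrivial c"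
    using closed_walk_weight[OF c(3,2)] by (simp only: nontrivial_def not_not)
  have "(\<Sum>e\<in>cycle_edges c. on_edge (incident v) e) = (\<Sum>a\<leftarrow>c. incident v a)"
    by (rule sum_cycle_edges[OF c(4)]) simp
  also have "\<dots> = (if s = v then 1 else 0) + (if s = v then 1 else 0)" by (rule walk_incident[OF c(3)])
  also have "\<dots> = 0" by simp
  finally show "(\<Sum>e\<in>cycle_edges c. on_edge (incident v) e) = 0" .
  show "cycle_edges c \<subseteq> edges n C" using walk_src_C[OF c(3,2)] by (auto simp: cycle_edges_def edges_def)
  show "cycle_edges c \<noteq> {}" using c(1) by (simp add: cycle_edges_def)
qed

text \<open>
  The non-pivot columns form a spanning tree, so a nonzero row of the row canonical form is the
  fundamental cycle of its pivot column.
\<close>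

lemma reduced_basis_nontrivial:
  assumes es: "distinct es" "set es = edges n C" and B: "cycle_basis n C B"
  shows "\<exists>s c. cycle n C s c \<and> cycle_edges c \<in> reduced_basis B es \<and> nontrivial c"
proof -
  define r where "r = length B"
  define k where "k = length es"
  define M where "M = cycle_matrix B es"
  define R where "R = gauss_jordan_single M"
  define X where "X i = {es ! j | j. j < length es \<and> R $$ (i, j) = 1}" for i
  have M: "M \<in> carrier_mat r k" by (simp add: M_def cycle_matrix_def r_def k_def)
  note gj = gauss_jordan_single[OF M R_def[symmetric]]
  have R: "R \<in> carrier_mat r k" by (rule gj(2))
  obtain P Q where PQ: "R = P * M" "P \<in> carrier_mat r r" "Q \<in> carrier_mat r r" "Q * P = 1\<^sub>m r"
    using gj(4) by blast
  \<comment> \<open>Row operations are invertible: \<open>P\<close> writes the rows of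
    \<open>R\<close> as sums of basis cycles, \<open>Q\<close> writes the basis cycles as sums of
    rows of \<open>R\<close>.\<close>
  have MQ: "M = Q * R"
    unfolding PQ(1) using assoc_mult_mat[OF PQ(3,2) M] PQ(4) left_mult_one_mat[OF M] by simp
  obtain f where f: "pivot_fun R f k" using gj(3) R unfolding row_echelon_form_def by auto
  have "dim_row R = r" using R by simp
  note piv = pivot_funD[OF this f]
  have cyc: "\<exists>s c. cycle n C s c \<and> B ! l = cycle_edges c" if "l < r" for l
    using B that unfolding cycle_basis_def r_def by (metis nth_mem)
  have Mentry: "M $$ (l, j) = (if es ! j \<in> B ! l then 1 else 0)" if "l < r" "j < k" for l j
    using that by (simp add: M_def cycle_matrix_def r_def k_def)
  have sel: "{es ! j | j. j < length es \<and> (if es ! j \<in> Y then 1 else 0 :: bit) = 1} = Y" if Y: "Y \<subseteq> set es" for Y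
  proof (intro equalityI subsetI)
    fix e assume e: "e \<in> Y"
    then obtain j where "j < length es" "es ! j = e" using Y by (meson in_set_conv_nth subsetD)
    then show "e \<in> {es ! j | j. j < length es \<and> (if es ! j \<in> Y then 1 else 0 :: bit) = 1}" using e by force
  qed (auto split: if_splits)
  have Msum: "(\<Sum>j<k. M $$ (l, j) * g (es ! j)) = (\<Sum>e\<in>B ! l. g e)" if l: "l < r" for l and g :: "arc set \<Rightarrow> bit"
  proof -
    obtain s c where "cycle n C s c" "B ! l = cycle_edges c" using cyc[OF l] by blast
    then have "B ! l \<subseteq> set es" using cycle_sums(3) es(2) by simp
    then have "{es ! j | j. j < length es \<and> M $$ (l, j) = 1} = B ! l"
      using sel[of "B ! l"] Mentry[OF l] unfolding k_def by (simp cong: conj_cong)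
    then show ?thesis using sum_selected[OF es(1), where v = "\<lambda>j. M $$ (l, j)" and g = g] unfolding k_def by simp
  qed
  have Rsum: "(\<Sum>e\<in>X i. g e) = (\<Sum>j<k. R $$ (i, j) * g (es ! j))" for i and g :: "arc set \<Rightarrow> bit"
    unfolding X_def k_def by (rule sum_selected[OF es(1), where v = "\<lambda>j. R $$ (i, j)" and g = g])
  have cb: "\<forall>s c. cycle n C s c \<longrightarrow>
      (\<exists>A\<subseteq>{..<r}. cycle_edges c = {x. odd (card {i \<in> A. x \<in> B ! i})})"
    using B unfolding cycle_basis_def r_def by (elim conjE)
  have span: "\<exists>\<beta>. (\<forall>j<k. (if es ! j \<in> cycle_edges c then 1 else 0) = (\<Sum>h<r. \<beta> h * R $$ (h, j)))"
    if c: "cycle n C s c" for s c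
  proof -
    obtain A where A: "A \<subseteq> {..<r}" "cycle_edges c = {x. odd (card {i \<in> A. x \<in> B ! i})}"
      using cb[rule_format, OF c] by (elim exE conjE)
    have fin: "finite A" by (rule finite_subset[OF A(1) finite_lessThan])
    show ?thesis
    proof (intro exI[of _ "\<lambda>h. \<Sum>l\<in>A. Q $$ (l, h)"] allI impI)
      fix j assume j: "j < k"
      have "(if es ! j \<in> cycle_edges c then 1 else 0) = (\<Sum>l\<in>A. if es ! j \<in> B ! l then 1 else 0 :: bit)"
        unfolding sum_indicator_odd[OF fin] A(2) by simp
      also have "\<dots> = (\<Sum>l\<in>A. \<Sum>h<r. Q $$ (l, h) * R $$ (h, j))"
      proof (rule sum.cong[OF refl])
        fix l assume "l \<in> A"
        then have l: "l < r" using A(1) by blast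
        have "M $$ (l, j) = (\<Sum>h<r. Q $$ (l, h) * R $$ (h, j))"
          by (subst MQ) (rule mult_mat_entry[OF PQ(3) R l j])
        then show "(if es ! j \<in> B ! l then 1 else 0) = (\<Sum>h<r. Q $$ (l, h) * R $$ (h, j))"
          using Mentry[OF l j] by simp
      qed
      also have "\<dots> = (\<Sum>h<r. \<Sum>l\<in>A. Q $$ (l, h) * R $$ (h, j))" by (rule sum.swap)
      also have "\<dots> = (\<Sum>h<r. (\<Sum>l\<in>A. Q $$ (l, h)) * R $$ (h, j))" by (simp only: sum_distrib_right)
      finally show "(if es ! j \<in> cycle_edges c then 1 else 0) = (\<Sum>h<r. (\<Sum>l\<in>A. Q $$ (l, h)) * R $$ (h, j))" .
    qed
  qed
  \<comment> \<open>If all rows had weight zero, so would every cycle, being a sum of rows; but a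
    nontrivial cycle exists.\<close>
  have "\<exists>i<r. (\<Sum>e\<in>X i. on_edge weight e) = 1"
  proof (rule ccontr)
    assume "\<not> ?thesis"
    then have zero: "(\<Sum>j<k. R $$ (i, j) * on_edge weight (es ! j)) = 0" if "i < r" for i
      using that Rsum[of "on_edge weight" i] by auto
    obtain s c where c: "cycle n C s c" "nontrivial c" using ex_nontrivial_cycle by blast
    obtain \<beta> where \<beta>: "\<And>j. j < k \<Longrightarrow> (if es ! j \<in> cycle_edges c then 1 else 0) = (\<Sum>h<r. \<beta> h * R $$ (h, j))"
      using span[OF c(1)] by blast
    have sub: "cycle_edges c \<subseteq> set es" using cycle_sums(3)[OF c(1)] es(2) by simp
    have "(\<Sum>e\<in>cycle_edges c. on_edge weight e) =
        (\<Sum>j<k. (if es ! j \<in> cycle_edges c then 1 else 0) * on_edge weight (es ! j))"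
      using sum_selected[OF es(1), where v = "\<lambda>j. if es ! j \<in> cycle_edges c then 1 else 0" and g = "on_edge weight"]
      unfolding sel[OF sub] k_def .
    also have "\<dots> = (\<Sum>j<k. \<Sum>h<r. \<beta> h * R $$ (h, j) * on_edge weight (es ! j))"
      by (rule sum.cong[OF refl]) (simp only: \<beta> lessThan_iff sum_distrib_right)
    also have "\<dots> = (\<Sum>h<r. \<Sum>j<k. \<beta> h * R $$ (h, j) * on_edge weight (es ! j))" by (rule sum.swap)
    also have "\<dots> = (\<Sum>h<r. \<beta> h * (\<Sum>j<k. R $$ (h, j) * on_edge weight (es ! j)))"
      by (simp only: sum_distrib_left mult.assoc)
    also have "\<dots> = 0"
      by (rule sum.neutral, rule ballI) (simp only: lessThan_iff zero mult_zero_right)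
    finally show False using cycle_sums(1)[OF c(1)] c(2) by (simp only: simp_thms)
  qed
  then obtain i where i: "i < r" "(\<Sum>e\<in>X i. on_edge weight e) = 1" by blast
  have X: "X i \<subseteq> edges n C" "finite (X i)" unfolding X_def es(2)[symmetric] by auto
  have ne: "X i \<noteq> {}" using i(2) by auto
  have "(\<Sum>e\<in>X i. on_edge (incident v) e) = 0" for v
  proof -
    have "(\<Sum>e\<in>X i. on_edge (incident v) e) = (\<Sum>l<r. P $$ (i, l) * (\<Sum>j<k. M $$ (l, j) * on_edge (incident v) (es ! j)))"
      unfolding Rsum unfolding PQ(1) by (rule mult_mat_row_sum[OF PQ(2) M i(1)])
    also have "\<dots> = 0"
    proof (rule sum.neutral, rule ballI)
      fix l assume "l \<in> {..<r}"
      then have l: "l < r" by simp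
      obtain s c where "cycle n C s c" "B ! l = cycle_edges c" using cyc[OF l] by blast
      then have "(\<Sum>e\<in>B ! l. on_edge (incident v) e) = 0" using cycle_sums(2) by (simp only:)
      then show "P $$ (i, l) * (\<Sum>j<k. M $$ (l, j) * on_edge (incident v) (es ! j)) = 0"
        unfolding Msum[OF l] by (simp only: mult_zero_right)
    qed
    finally show ?thesis .
  qed
  \<comment> \<open>A sum of cycles is even at every vertex, so it contains a cycle. It remains to
    exclude that the row is larger than this cycle.\<close>
  then obtain s c where c: "cycle n C s c" "cycle_edges c \<subseteq> X i"
    using even_edges_contain_cycle[OF X ne] by blast
  obtain \<beta> where \<beta>: "\<And>j. j < k \<Longrightarrow> (if es ! j \<in> cycle_edges c then 1 else 0) = (\<Sum>h<r. \<beta> h * R $$ (h, j))"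
    using span[OF c(1)] by blast
  have inX: "R $$ (i, j) = 1" if "j < k" "es ! j \<in> X i" for j
    using that nth_eq_iff_index_eq[OF es(1)] unfolding X_def k_def by auto
  \<comment> \<open>Row \<open>i\<close> vanishes in the pivot column of any other row
    \<open>h\<close>, so that edge lies outside \<open>X i\<close> and hence outside
    \<open>c\<close>; the expansion of \<open>c\<close> then has no share of row \<open>h\<close>. A
    row without pivot is zero. What is left is row \<open>i\<close> itself.\<close>
  have zero: "\<beta> h * R $$ (h, j) = 0" if h: "h < r" "h \<noteq> i" and j: "j < k" for h j
  proof (cases "f h < k")
    case True
    have "(\<Sum>h'<r. \<beta> h' * R $$ (h', f h)) = \<beta> h * R $$ (h, f h) + (\<Sum>h'\<in>{..<r} - {h}. \<beta> h' * R $$ (h', f h))"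
      by (rule sum.remove) (use h in simp_all)
    also have "(\<Sum>h'\<in>{..<r} - {h}. \<beta> h' * R $$ (h', f h)) = 0"
      by (rule sum.neutral) (use piv(5)[OF h(1) True] in auto)
    finally have "(if es ! f h \<in> cycle_edges c then 1 else 0) = \<beta> h"
      using \<beta>[OF True] by (simp only: piv(4)[OF h(1) True] add_0_right mult_1_right)
    moreover have "es ! f h \<notin> cycle_edges c"
    proof
      assume "es ! f h \<in> cycle_edges c"
      then have "R $$ (i, f h) = 1" using inX[OF True] c(2) by blast
      then show False using piv(5)[OF h(1) True i(1)] h(2) by simp
    qed
    ultimately show ?thesis by simp
  next
    case False
    then have "R $$ (h, j) = 0" using piv(2)[OF h(1), of j] j by simp
    then show ?thesis by simp
  qed
  have eq: "(if es ! j \<in> cycle_edges c then 1 else 0) = \<beta> i * R $$ (i, j)" if j: "j < k" for j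
  proof -
    have "(\<Sum>h<r. \<beta> h * R $$ (h, j)) = \<beta> i * R $$ (i, j) + (\<Sum>h\<in>{..<r} - {i}. \<beta> h * R $$ (h, j))"
      by (rule sum.remove) (use i(1) in simp_all)
    also have "(\<Sum>h\<in>{..<r} - {i}. \<beta> h * R $$ (h, j)) = 0"
      by (rule sum.neutral) (use zero j in auto)
    finally show ?thesis using \<beta>[OF j] by (simp only: add_0_right)
  qed
  have "X i \<subseteq> cycle_edges c"
  proof -
    obtain e where e: "e \<in> cycle_edges c" using cycle_sums(4)[OF c(1)] by blast
    then obtain j where j: "j < k" "es ! j = e" using c(2) unfolding X_def k_def by blast
    have "\<beta> i = 1" using eq[OF j(1)] e unfolding j(2) by (cases "\<beta> i") auto
    show ?thesis
    proof
      fix e assume "e \<in> X i"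
      then obtain j where j: "e = es ! j" "j < k" "R $$ (i, j) = 1" unfolding X_def k_def by blast
      have "(if es ! j \<in> cycle_edges c then 1 else 0) = (1 :: bit)"
        using eq[OF j(2)] by (simp only: \<open>\<beta> i = 1\<close> j(3) mult_1_right)
      then show "e \<in> cycle_edges c" unfolding j(1) by (metis zero_neq_one)
    qed
  qed
  with c(2) have eqX: "cycle_edges c = X i" by blast
  have "X i \<in> reduced_basis B es"
    unfolding reduced_basis_def Let_def X_def R_def M_def using i(1) r_def by blast
  moreover have "nontrivial c" using cycle_sums(1)[OF c(1)] i(2) eqX by auto
  ultimately show ?thesis using c(1) unfolding eqX[symmetric] by blast
qed

theorem basis_produces_swap:
  assumes "m \<in> reach m0" shows "basis_produces n C m (swap m)"
  unfolding basis_produces_def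
proof (intro allI impI conjI)
  fix es B assume *: "distinct es \<and> set es = edges n C \<and> cycle_basis n C B"
  show "\<exists>s c. cycle n C s c \<and> cycle_edges c \<in> reduced_basis B es \<and> nontrivial c"
    by (rule reduced_basis_nontrivial) (simp_all only: *)
  fix s c m'' assume "cycle n C s c \<and> cycle_edges c \<in> reduced_basis B es \<and> nontrivial c"
  then show "produces n s c m m'' \<longleftrightarrow> m'' = swap m" by (intro produces_iff[OF assms]) (simp_all only:)
qed

end

section \<open>The four components of type 1\<close>

text \<open>A quarter turn commutes with interchange and with renaming. Since the renaming acts on
  names and not on positions, the same two indeterminates are exchanged in all four
  components.\<close>

lemma two_sheeted_rot:
  assumes "two_sheeted n x y m"
  shows "two_sheeted n x y (rot m)"
proof -
  interpret two_sheeted n x y m by (rule assms)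
  have norm: "normal m" using m0 by (simp add: multilinear_iff)
  have swap: "swap_indets x y (rot m) = rot (swap_indets x y m)" by (simp add: swap_indets_def rot_map_mono)
  have inj: "inj_on rot (reach (type_of m))"
  proof (rule inj_onI)
    fix s t assume "s \<in> reach (type_of m)" "t \<in> reach (type_of m)" "rot s = rot t"
    moreover have "normal u" if "u \<in> reach (type_of m)" for u
      using reach_normal[OF that] norm by simp
    ultimately show "s = t" using rot4 by metis
  qed
  have "card (reach (rot m)) \<le> card (reach m)"
    unfolding reach_rot[OF norm] by (rule card_image_le[OF finite_reach_m0])
  also have "\<dots> \<le> 2 * card (reach (type_of m))" by (rule card_le)
  also have "card (reach (type_of m)) = card (reach (type_of (rot m)))"
    using norm by (simp add: type_of_rot reach_rot card_image[OF inj])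
  finally have "card (reach (rot m)) \<le> 2 * card (reach (type_of (rot m)))" .
  moreover have "swap_indets x y (rot m) \<in> reach (rot m)"
    unfolding swap reach_rot[OF norm] using swap_m0 by (rule imageI)
  moreover have "rot m \<in> multilinear n"
    using m0 mset_indets_rot[of m] by (simp add: multilinear_iff)
  ultimately show ?thesis using xy by unfold_locales
qed

section \<open>Evaluation of monomials in a double semigroup\<close>

context double_semigroup begin

lemma eval_closed: "\<rho> ` set (indets s) \<subseteq> S \<Longrightarrow> eval hop vop \<rho> s \<in> S"
  by (induction s) (auto simp: hop_closed vop_closed image_Un)
lemma eval_hcomp:
  "\<rho> ` set (indets s) \<subseteq> S \<Longrightarrow> \<rho> ` set (indets t) \<subseteq> S \<Longrightarrow>
    eval hop vop \<rho> (hcomp s t) = eval hop vop \<rho> s \<circ>\<^sub>H eval hop vop \<rho> t"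
  by (induction s t rule: hcomp.induct) (simp_all add: image_Un hop_assoc eval_closed)
lemma eval_vcomp:
  "\<rho> ` set (indets s) \<subseteq> S \<Longrightarrow> \<rho> ` set (indets t) \<subseteq> S \<Longrightarrow>
    eval hop vop \<rho> (vcomp s t) = eval hop vop \<rho> s \<bullet>\<^sub>V eval hop vop \<rho> t"
  by (induction s t rule: vcomp.induct) (simp_all add: image_Un vop_assoc eval_closed)
lemma interchange_indets: "interchange s t \<Longrightarrow> set (indets s) = set (indets t)"
  by (metis interchange_mset set_mset_mset)
lemma eval_interchange:
  "interchange s t \<Longrightarrow> \<rho> ` set (indets s) \<subseteq> S \<Longrightarrow> eval hop vop \<rho> s = eval hop vop \<rho> t"
proof (induction rule: interchange.induct)
  case (hv w x y z)
  then show ?case by (simp add: eval_hcomp eval_vcomp eval_closed image_Un interchange_law)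
next
  case (vh w x y z)
  then show ?case by (simp add: eval_hcomp eval_vcomp eval_closed image_Un interchange_law)
next
  case (h_left s s' t)
  then show ?case using interchange_indets[OF h_left(1)] by (simp add: eval_hcomp image_Un)
next
  case (h_right s t t')
  then show ?case using interchange_indets[OF h_right(2)] by (simp add: eval_hcomp image_Un)
next
  case (v_left s s' t)
  then show ?case using interchange_indets[OF v_left(1)] by (simp add: eval_vcomp image_Un)
next
  case (v_right s t t')
  then show ?case using interchange_indets[OF v_right(2)] by (simp add: eval_vcomp image_Un)
qed

lemma eval_reach:
  assumes "t \<in> reach s" "\<rho> ` set (indets s) \<subseteq> S"
  shows "eval hop vop \<rho> t = eval hop vop \<rho> s"
proof -
  have "interchange\<^sup>*\<^sup>* s t" using assms(1) by (simp add: reach_def)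
  then show ?thesis
  proof (induction rule: rtranclp_induct)
    case (step t u)
    then have "t \<in> reach s" by (simp add: reach_def)
    then have "set (indets t) = set (indets s)" using reach_mset[of t s] by (metis set_mset_mset)
    then show ?case using step eval_interchange[OF step(2)] assms(2) by simp
  qed simp
qed

end

text \<open>Structural recursion on unary numbers, so that rewriting decides every comparison of
  indeterminates.\<close>

fun cmp_nat :: "nat \<Rightarrow> nat \<Rightarrow> comparison" where
  "cmp_nat 0 0 = EQ"
| "cmp_nat 0 (Suc j) = LT"
| "cmp_nat (Suc i) 0 = GT"
| "cmp_nat (Suc i) (Suc j) = cmp_nat i j"

lemma cmp_nat_EQ: "cmp_nat i j = EQ \<Longrightarrow> i = j"
  by (induction i j rule: cmp_nat.induct) auto

definition monomial :: "nat mono" where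
  "monomial = V (H (Ind 0) (H (Ind 1) (Ind 2))) (H (Ind 3) (H (V (Ind 4) (Ind 5)) (H (V (Ind 6) (Ind 7)) (Ind 8))))"
definition shape :: "unit mono" where
  "shape = V (H (Ind ()) (H (Ind ()) (Ind ()))) (H (Ind ()) (H (V (Ind ()) (Ind ())) (H (V (Ind ()) (Ind ())) (Ind ()))))"

lemma type_of_monomial: "type_of monomial = shape"
  by (simp add: type_of_def monomial_def shape_def)

text \<open>The number of tree nodes bounds the class from above, which is what
  \<open>card_le\<close> asks for. Since \<open>count\<close> starts at one, the value 215 below
  stands for 214 nodes.\<close>

fun check_cover :: "nat mono \<Rightarrow> nat \<Rightarrow> nat mono tree option \<Rightarrow> bool" where
  "check_cover m k None = False"
| "check_cover m k (Some T) = (member cmp_nat m T \<and> count (inorder2 T []) num.One = k)"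

lemma cover:
  "check_cover (swap_indets 4 6 monomial) 215 (dfs cmp_nat [monomial] Leaf)"
proof -
  have s: "swap_indets 4 6 monomial = V (H (Ind 0) (H (Ind 1) (Ind 2)))
      (H (Ind 3) (H (V (Ind 6) (Ind 5)) (H (V (Ind 4) (Ind 7)) (Ind 8))))"
    by (simp add: swap_indets_def monomial_def transpose_def)
  have unary: "(1::nat) = Suc 0" "(2::nat) = Suc (Suc 0)" "(3::nat) = Suc (Suc (Suc 0))"
    "(4::nat) = Suc (Suc (Suc (Suc 0)))" "(5::nat) = Suc (Suc (Suc (Suc (Suc 0))))"
    "(6::nat) = Suc (Suc (Suc (Suc (Suc (Suc 0)))))" "(7::nat) = Suc (Suc (Suc (Suc (Suc (Suc (Suc 0))))))"
    "(8::nat) = Suc (Suc (Suc (Suc (Suc (Suc (Suc (Suc 0)))))))"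
    by simp_all
  show ?thesis
    unfolding s unfolding monomial_def unary
    by (simp only: eval_rules check_cover.simps cmp_nat.simps)
qed

text \<open>The least types of components 3981, 3982 and 3983, the latter two rotated into component 3981.\<close>

definition least1 :: "unit mono" where "least1 = H (V I I) (H (V I I) (V I (H (V I (V I I)) I)))"
definition least2 :: "unit mono" where "least2 = H (V I (H I (V (H I I) I))) (H (V I I) (V I I))"
definition least3 :: "unit mono" where "least3 = V (H I (H I I)) (H I (H (V I (V I I)) (H I I)))"

text \<open>One search serves all four components: as \<open>v\<close> runs through the class of
  \<open>shape\<close>, its turns run through the other three. The comparisons put one vertex of
  each component below all vertices of the next one. The value 108 stands for 107 nodes.\<close>

fun check_shape :: "unit mono tree option \<Rightarrow> bool" where
  "check_shape None = False"
| "check_shape (Some T) = (count (inorder2 T []) num.One = 108 \<and> ascending (inorder2 T []) \<and>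
     member (\<lambda>_ _. EQ) least1 T \<and> member (\<lambda>_ _. EQ) least2 T \<and> member (\<lambda>_ _. EQ) least3 T \<and>
     list_all (\<lambda>v. type_less least1 (rot (rot v)) \<and> type_less (rot (rot least2)) (rot (rot (rot v))) \<and>
       type_less (rot (rot (rot least3))) (rot v)) (inorder2 T []))"

lemma shape_check: "check_shape (dfs (\<lambda>_ _. EQ) [shape] Leaf)"
  by (simp only: shape_def least1_def least2_def least3_def eval_rules check_shape.simps rot.simps type_less.simps deg_simps
      arith_simps rel_simps one_add_one one_plus_numeral numeral_plus_one mono.inject mono.distinct)

lemma two_sheeted_monomial: "two_sheeted 9 4 6 monomial"
proof
  obtain T where T: "dfs cmp_nat [monomial] Leaf = Some T" "member cmp_nat (swap_indets 4 6 monomial) T"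
    "count (inorder2 T []) num.One = 215"
    using cover by (cases "dfs cmp_nat [monomial] Leaf") simp_all
  have n: "normal monomial" by (simp add: monomial_def)
  have r: "set_tree T = reach monomial" by (rule dfs_reach[OF cmp_nat_EQ T(1) n])
  show "swap_indets 4 6 monomial \<in> reach monomial"
    unfolding r[symmetric] by (rule member_set[OF cmp_nat_EQ T(2)])
  obtain U where U: "dfs (\<lambda>_ _. EQ) [shape] Leaf = Some U" "count (inorder2 U []) num.One = 108" "ascending (inorder2 U [])"
    using shape_check by (cases "dfs (\<lambda>_ _. EQ) [shape] Leaf :: unit mono tree option") simp_all
  have "set_tree U = reach shape" by (rule dfs_reach[OF _ U(1)]) (simp_all add: shape_def)
  then have "card (reach shape) = 107"
    using distinct_card[OF ascending_distinct[OF U(3)]] U(2) by (simp add: count inorder2_inorder)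
  moreover have "card (reach monomial) \<le> 214"
    using card_length[of "inorder T"] T(3) unfolding r[symmetric] by (simp add: count inorder2_inorder)
  ultimately show "card (reach monomial) \<le> 2 * card (reach (type_of monomial))"
    by (simp add: type_of_monomial)
  show "monomial \<in> multilinear 9" by (auto simp: multilinear_def monomial_def)
qed simp_all

lemma shape_facts:
  "card (reach shape) = 107" "least1 \<in> reach shape" "least2 \<in> reach shape" "least3 \<in> reach shape"
  "v \<in> reach shape \<Longrightarrow> type_less least1 (rot (rot v)) \<and>
     type_less (rot (rot least2)) (rot (rot (rot v))) \<and> type_less (rot (rot (rot least3))) (rot v)"
proof -
  obtain U where U: "dfs (\<lambda>_ _. EQ) [shape] Leaf = Some U" "check_shape (Some U)"
    using shape_check by (cases "dfs (\<lambda>_ _. EQ) [shape] Leaf :: unit mono tree option") simp_all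
  have r: "set_tree U = reach shape" by (rule dfs_reach[OF _ U(1)]) (simp_all add: shape_def)
  have "count (inorder2 U []) num.One = 108" "ascending (inorder2 U [])" using U(2) by simp_all
  then show "card (reach shape) = 107"
    using distinct_card[of "inorder U"] ascending_distinct[of "inorder U"] r
    by (simp add: count inorder2_inorder)
  have m: "w \<in> reach shape" if "member (\<lambda>_ _. EQ) w U" for w
    unfolding r[symmetric] by (rule member_set[OF _ that]) simp
  show "least1 \<in> reach shape" "least2 \<in> reach shape" "least3 \<in> reach shape"
    by (rule m; use U(2) in simp)+
  show "v \<in> reach shape \<Longrightarrow> type_less least1 (rot (rot v)) \<and>
     type_less (rot (rot least2)) (rot (rot (rot v))) \<and> type_less (rot (rot (rot least3))) (rot v)"
    using U(2) by (simp add: list_all_iff inorder2_inorder r)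
qed

text \<open>The indices follow the total order on components, while quarter turns run through them
  in the cyclic order 1, 4, 2, 3.\<close>

definition comp1 :: "unit mono set" where "comp1 = reach shape"
definition comp2 :: "unit mono set" where "comp2 = reach (rot (rot shape))"
definition comp3 :: "unit mono set" where "comp3 = reach (rot (rot (rot shape)))"
definition comp4 :: "unit mono set" where "comp4 = reach (rot shape)"

lemma normal_shape: "normal shape" by (simp add: shape_def)
lemma normal_comp1: "u \<in> comp1 \<Longrightarrow> normal u"
  using reach_normal[of u shape] normal_shape by (simp add: comp1_def)
lemma rot_comps:
  "rot ` comp1 = comp4" "rot ` comp4 = comp2" "rot ` comp2 = comp3" "rot ` comp3 = comp1"
  using normal_shape by (simp_all add: comp1_def comp2_def comp3_def comp4_def rot4 flip: reach_rot)

lemma inj_rot: "(\<And>u. u \<in> X \<Longrightarrow> normal u) \<Longrightarrow> inj_on rot X"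
  by (rule inj_onI) (metis rot4)
lemma normal_comps: "u \<in> comp2 \<Longrightarrow> normal u" "u \<in> comp3 \<Longrightarrow> normal u" "u \<in> comp4 \<Longrightarrow> normal u"
  unfolding rot_comps(3)[symmetric] rot_comps(2)[symmetric] rot_comps(1)[symmetric]
  using normal_comp1 by auto
lemma bij_rot: "bij_betw rot comp1 comp4" "bij_betw rot comp4 comp2" "bij_betw rot comp2 comp3" "bij_betw rot comp3 comp1"
  unfolding bij_betw_def using inj_rot normal_comp1 normal_comps rot_comps by blast+

lemma card_comps: "card comp1 = 107" "card comp2 = 107" "card comp3 = 107" "card comp4 = 107"
  using bij_betw_same_card[OF bij_rot(1)] bij_betw_same_card[OF bij_rot(2)] bij_betw_same_card[OF bij_rot(3)]
    shape_facts(1) by (simp_all add: comp1_def)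

lemma comps_in_components: "comp1 \<in> components 9" "comp2 \<in> components 9" "comp3 \<in> components 9" "comp4 \<in> components 9"
proof -
  have "shape \<in> mixed 9" "rot (rot shape) \<in> mixed 9" "rot (rot (rot shape)) \<in> mixed 9" "rot shape \<in> mixed 9"
    by (simp_all add: mixed_def assoc_types_def shape_def)
  moreover have "reach t \<in> components 9" if "t \<in> mixed 9" for t
    using mixed_not_isolated[OF that] that by (simp add: components_eq connected_classes_def mixed_def)
  ultimately show "comp1 \<in> components 9" "comp2 \<in> components 9" "comp3 \<in> components 9" "comp4 \<in> components 9"
    unfolding comp1_def comp2_def comp3_def comp4_def by blast+
qed

lemma component_less_comps:
  "component_less comp1 comp2" "component_less comp2 comp3" "component_less comp3 comp4"
proof -
  note c = comps_in_components[THEN component_props(1)] comps_in_components[THEN component_props(2)]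
  have 1: "least1 \<in> comp1" "rot (rot least2) \<in> comp2" "rot (rot (rot least3)) \<in> comp3"
    unfolding rot_comps(3)[symmetric] rot_comps(2)[symmetric] rot_comps(1)[symmetric] comp1_def
    using shape_facts(2-4) by blast+
  have 2: "type_less least1 v" if "v \<in> comp2" for v
    using that shape_facts(5) unfolding rot_comps(2)[symmetric] rot_comps(1)[symmetric] comp1_def by blast
  have 3: "type_less (rot (rot least2)) v" if "v \<in> comp3" for v
    using that shape_facts(5) unfolding rot_comps(3)[symmetric] rot_comps(2)[symmetric] rot_comps(1)[symmetric] comp1_def by blast
  have 4: "type_less (rot (rot (rot least3))) v" if "v \<in> comp4" for v
    using that shape_facts(5) unfolding rot_comps(1)[symmetric] comp1_def by blast
  show "component_less comp1 comp2"
    using min_vertex_less[OF c(1,2,6) 1(1) 2] card_comps by (simp add: component_less_def)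
  show "component_less comp2 comp3"
    using min_vertex_less[OF c(2,3,7) 1(2) 3] card_comps by (simp add: component_less_def)
  show "component_less comp3 comp4"
    using min_vertex_less[OF c(3,4,8) 1(3) 4] card_comps by (simp add: component_less_def)
qed

text \<open>The four are all the components with 107 vertices, so each is preceded by the 3980
  smaller ones and by the earlier ones among the four.\<close>

lemma component_numbers:
  "component 9 3981 = comp1" "component 9 3982 = comp2" "component 9 3983 = comp3" "component 9 3984 = comp4"
proof -
  let ?S = "{C \<in> components 9. card C < 107}"
  note trans = components.trans and irrefl = components.irrefl
  note l = component_less_comps
  have l13: "component_less comp1 comp3" by (rule trans[OF l(1,2)])
  have l24: "component_less comp2 comp4" by (rule trans[OF l(2,3)])
  have l14: "component_less comp1 comp4" by (rule trans[OF l(1) l24])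
  have nl: "\<not> component_less b a" if "component_less a b" for a b
    using trans[OF that] irrefl by blast
  have ne: "comp1 \<noteq> comp2" "comp1 \<noteq> comp3" "comp1 \<noteq> comp4" "comp2 \<noteq> comp3" "comp2 \<noteq> comp4" "comp3 \<noteq> comp4"
    using l l13 l24 l14 irrefl by auto
  have fin: "finite {C \<in> components 9. card C = 107}" using components.finite by simp
  \<comment> \<open>Four different members exhaust a set of cardinality four.\<close>
  have "{comp1, comp2, comp3, comp4} = {C \<in> components 9. card C = 107}"
    by (rule card_seteq[OF fin])
      (use comps_in_components card_comps ne card_classes_9(2) in \<open>auto simp: components_eq\<close>)
  then have eq: "C \<in> {comp1, comp2, comp3, comp4} \<longleftrightarrow> C \<in> components 9 \<and> card C = 107" for C by blast
  have less: "component_less C D \<longleftrightarrow> card C < 107 \<or> C \<in> {comp1, comp2, comp3, comp4} \<and> component_less C D"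
    if "C \<in> components 9" "card D = 107" for C D
    using that eq[of C] unfolding component_less_def by auto
  have below: "{C \<in> components 9. component_less C D} = ?S \<union> {C \<in> {comp1, comp2, comp3, comp4}. component_less C D}"
    if "card D = 107" for D
    using less[OF _ that] eq by blast
  have count: "card {C \<in> components 9. component_less C D} = 3980 + card {C \<in> {comp1, comp2, comp3, comp4}. component_less C D}"
    if "card D = 107" for D
  proof -
    have "card {C \<in> components 9. component_less C D} = card ?S + card {C \<in> {comp1, comp2, comp3, comp4}. component_less C D}"
      unfolding below[OF that] by (rule card_Un_disjoint) (use components.finite eq in auto)
    then show ?thesis using card_classes_9(1) by (simp add: components_eq)
  qed
  have s: "{C \<in> {comp1, comp2, comp3, comp4}. component_less C comp1} = {}"
    "{C \<in> {comp1, comp2, comp3, comp4}. component_less C comp2} = {comp1}"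
    "{C \<in> {comp1, comp2, comp3, comp4}. component_less C comp3} = {comp1, comp2}"
    "{C \<in> {comp1, comp2, comp3, comp4}. component_less C comp4} = {comp1, comp2, comp3}"
    using l l13 l24 l14 irrefl nl[OF l(1)] nl[OF l(2)] nl[OF l(3)] nl[OF l13] nl[OF l24] nl[OF l14]
    by auto
  show "component 9 3981 = comp1"
    using component_eqI[OF comps_in_components(1) count[OF card_comps(1)]] unfolding s by simp
  show "component 9 3982 = comp2"
    using component_eqI[OF comps_in_components(2) count[OF card_comps(2)]] unfolding s by simp
  show "component 9 3983 = comp3"
    using component_eqI[OF comps_in_components(3) count[OF card_comps(3)]] ne unfolding s by simp
  show "component 9 3984 = comp4"
    using component_eqI[OF comps_in_components(4) count[OF card_comps(4)]] ne unfolding s by simp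
qed

lemma (in double_semigroup) monodromy_property:
  assumes ts: "two_sheeted 9 x y m" and C: "component 9 N = reach (type_of m)"
  shows "component 9 N = type_of ` {m'. (m, m') \<in> (F_edges 9)\<^sup>*} \<and>
    (\<forall>m'. (m, m') \<in> (F_edges 9)\<^sup>* \<longrightarrow>
       basis_produces 9 (component 9 N) m' (swap_indets x y m') \<and>
       (\<forall>\<rho>. \<rho> ` {..<9} \<subseteq> S \<longrightarrow>
          eval hop vop \<rho> m' = eval hop vop \<rho> m \<and>
          eval hop vop \<rho> m' = eval hop vop \<rho> (swap_indets x y m')))"
proof -
  interpret two_sheeted 9 x y m by (rule ts)
  have F: "(m, m') \<in> (F_edges 9)\<^sup>* \<longleftrightarrow> m' \<in> reach m" for m' by (rule F_edges_rtrancl[OF m0])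
  have ev: "eval hop vop \<rho> u = eval hop vop \<rho> m" if "u \<in> reach m" "\<rho> ` {..<9} \<subseteq> S" for u \<rho>
    by (rule eval_reach[OF that(1)]) (use m0 that(2) in \<open>simp add: multilinear_def\<close>)
  show ?thesis
    unfolding F C
  proof (intro conjI allI impI)
    show "reach (type_of m) = type_of ` {m'. m' \<in> reach m}" using C_eq by simp
    fix m' assume m': "m' \<in> reach m"
    show "basis_produces 9 (reach (type_of m)) m' (swap_indets x y m')" by (rule basis_produces_swap[OF m'])
    fix \<rho> :: "nat \<Rightarrow> 'a" assume \<rho>: "\<rho> ` {..<9} \<subseteq> S"
    show "eval hop vop \<rho> m' = eval hop vop \<rho> m" by (rule ev[OF m' \<rho>])
    show "eval hop vop \<rho> m' = eval hop vop \<rho> (swap_indets x y m')"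
      using ev[OF m' \<rho>] ev[OF swap_reach[OF m'] \<rho>] by simp
  qed
qed



theorem theorem4p1:
  fixes S :: "'a set"
    and hop :: "'a \<Rightarrow> 'a \<Rightarrow> 'a" (infixl "\<circ>\<^sub>H" 70)
    and vop :: "'a \<Rightarrow> 'a \<Rightarrow> 'a" (infixl "\<bullet>\<^sub>V" 70)
    and m3981 :: "nat mono"
  assumes DS: "double_semigroup S hop vop"
    and m3981:
      "m3981 = vcol [hrow [Ind 0, Ind 1, Ind 2],
                    hrow [Ind 3, vcol [Ind 4, Ind 5], vcol [Ind 6, Ind 7], Ind 8]]"
  shows
    "\<comment> \<open>the property produced by the nontrivial basis cycles of component 3981\<close>
     type_of m3981 \<in> component 9 3981 \<and>
     basis_produces 9 (component 9 3981) m3981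
       (vcol [hrow [Ind 0, Ind 1, Ind 2],
             hrow [Ind 3, vcol [Ind 6, Ind 5], vcol [Ind 4, Ind 7], Ind 8]]) \<and>
     swap_indets 4 6 m3981 =
       vcol [hrow [Ind 0, Ind 1, Ind 2],
            hrow [Ind 3, vcol [Ind 6, Ind 5], vcol [Ind 4, Ind 7], Ind 8]] \<and>
     (\<forall>a\<in>S. \<forall>b\<in>S. \<forall>c\<in>S. \<forall>d\<in>S. \<forall>e\<in>S. \<forall>f\<in>S. \<forall>g\<in>S. \<forall>h\<in>S. \<forall>i\<in>S.
       (a \<circ>\<^sub>H b \<circ>\<^sub>H c) \<bullet>\<^sub>V (d \<circ>\<^sub>H (e \<bullet>\<^sub>V f) \<circ>\<^sub>H (g \<bullet>\<^sub>V h) \<circ>\<^sub>H i) =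
       (a \<circ>\<^sub>H b \<circ>\<^sub>H c) \<bullet>\<^sub>V (d \<circ>\<^sub>H (g \<bullet>\<^sub>V f) \<circ>\<^sub>H (e \<bullet>\<^sub>V h) \<circ>\<^sub>H i)) \<and>
     \<comment> \<open>the representatives of the other three components of type 1\<close>
     type_of (vcol [hrow [Ind 0, vcol [Ind 1, Ind 2], vcol [Ind 3, Ind 4], Ind 5],
                   hrow [Ind 6, Ind 7, Ind (8::nat)]]) \<in> component 9 3982 \<and>
     type_of (hrow [vcol [Ind 0, Ind 1, Ind 2],
                   vcol [Ind 3, hrow [Ind 4, Ind 5], hrow [Ind 6, Ind 7], Ind (8::nat)]])
       \<in> component 9 3983 \<and>
     type_of (hrow [vcol [Ind 0, hrow [Ind 1, Ind 2], hrow [Ind 3, Ind 4], Ind 5],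
                   vcol [Ind 6, Ind 7, Ind (8::nat)]]) \<in> component 9 3984 \<and>
     \<comment> \<open>cyclic rotation\<close>
     bij_betw rot (component 9 3981) (component 9 3984) \<and>
     bij_betw rot (component 9 3984) (component 9 3982) \<and>
     bij_betw rot (component 9 3982) (component 9 3983) \<and>
     bij_betw rot (component 9 3983) (component 9 3981) \<and>
     \<comment> \<open>the property and its rotations, for every association type in the four components;
         \<open>m'\<close> ranges over the monomials in the same equivalence class as \<open>m\<close>\<close>
     (\<forall>(N, m) \<in> {(3981, m3981), (3984, rot m3981), (3982, rot (rot m3981)),
                  (3983, rot (rot (rot m3981)))}.
       component 9 N = type_of ` {m'. (m, m') \<in> (F_edges 9)\<^sup>*} \<and>
       (\<forall>m'. (m, m') \<in> (F_edges 9)\<^sup>* \<longrightarrow>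
          basis_produces 9 (component 9 N) m' (swap_indets 4 6 m') \<and>
          (\<forall>\<rho>. \<rho> ` {..<9} \<subseteq> S \<longrightarrow>
             eval hop vop \<rho> m' = eval hop vop \<rho> m \<and>
             eval hop vop \<rho> m' = eval hop vop \<rho> (swap_indets 4 6 m'))))"

proof -
  interpret double_semigroup S hop vop by (rule DS)
  have m: "m3981 = monomial" by (simp add: m3981 monomial_def)
  have swap: "swap_indets 4 6 monomial = vcol [hrow [Ind 0, Ind 1, Ind 2],
            hrow [Ind 3, vcol [Ind 6, Ind 5], vcol [Ind 4, Ind 7], Ind 8]]"
    by (simp add: swap_indets_def monomial_def transpose_def)
  note ts1 = two_sheeted_monomial
  note ts4 = two_sheeted_rot[OF ts1]
  note ts2 = two_sheeted_rot[OF ts4]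
  note ts3 = two_sheeted_rot[OF ts2]
  note P1 = monodromy_property[OF ts1, of 3981]
  note P4 = monodromy_property[OF ts4, of 3984]
  note P2 = monodromy_property[OF ts2, of 3982]
  note P3 = monodromy_property[OF ts3, of 3983]
  have C1: "component 9 3981 = reach (type_of monomial)"
    by (simp add: component_numbers comp1_def type_of_monomial)
  have C4: "component 9 3984 = reach (type_of (rot monomial))"
    by (simp add: component_numbers comp4_def type_of_rot type_of_monomial)
  have C2: "component 9 3982 = reach (type_of (rot (rot monomial)))"
    by (simp add: component_numbers comp2_def type_of_rot type_of_monomial)
  have C3: "component 9 3983 = reach (type_of (rot (rot (rot monomial))))"
    by (simp add: component_numbers comp3_def type_of_rot type_of_monomial)
  have ev: "eval hop vop \<rho> monomial = eval hop vop \<rho> (swap_indets 4 6 monomial)" if "\<rho> ` {..<9} \<subseteq> S" for \<rho>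
    using P1[OF C1] that by blast
  have identity: "(a \<circ>\<^sub>H b \<circ>\<^sub>H c) \<bullet>\<^sub>V (d \<circ>\<^sub>H (e \<bullet>\<^sub>V f) \<circ>\<^sub>H (g \<bullet>\<^sub>V h) \<circ>\<^sub>H i) =
       (a \<circ>\<^sub>H b \<circ>\<^sub>H c) \<bullet>\<^sub>V (d \<circ>\<^sub>H (g \<bullet>\<^sub>V f) \<circ>\<^sub>H (e \<bullet>\<^sub>V h) \<circ>\<^sub>H i)"
    if el: "a \<in> S" "b \<in> S" "c \<in> S" "d \<in> S" "e \<in> S" "f \<in> S" "g \<in> S" "h \<in> S" "i \<in> S" for a b c d e f g h i
  proof -
    let ?\<rho> = "\<lambda>k. [a, b, c, d, e, f, g, h, i] ! k"
    have "?\<rho> ` {..<9} \<subseteq> S"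
    proof (intro image_subsetI)
      fix k :: nat assume "k \<in> {..<9}"
      then have "k < length [a, b, c, d, e, f, g, h, i]" by simp
      then have "?\<rho> k \<in> set [a, b, c, d, e, f, g, h, i]" by (rule nth_mem)
      then show "?\<rho> k \<in> S" using el by auto
    qed
    \<comment> \<open>The infix notation groups rows to the left, the trees group them to the right;
      \<open>hop_assoc\<close> reconciles the two.\<close>
    from ev[OF this] show ?thesis unfolding swap by (simp add: monomial_def hop_assoc el hop_closed vop_closed)
  qed
  \<comment> \<open>Only types are compared: turning changes the reading order, so the labels here
    are not those of the turned monomials.\<close>
  have reps:
    "type_of (vcol [hrow [Ind 0, vcol [Ind 1, Ind 2], vcol [Ind 3, Ind 4], Ind 5],
       hrow [Ind 6, Ind 7, Ind (8::nat)]]) = rot (rot shape)"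
    "type_of (hrow [vcol [Ind 0, Ind 1, Ind 2],
       vcol [Ind 3, hrow [Ind 4, Ind 5], hrow [Ind 6, Ind 7], Ind (8::nat)]]) = rot (rot (rot shape))"
    "type_of (hrow [vcol [Ind 0, hrow [Ind 1, Ind 2], hrow [Ind 3, Ind 4], Ind 5],
       vcol [Ind 6, Ind 7, Ind (8::nat)]]) = rot shape"
    by (simp_all add: type_of_def shape_def)
  have basis: "basis_produces 9 (component 9 3981) monomial (swap_indets 4 6 monomial)"
    using P1[OF C1] by blast
  show ?thesis
    unfolding m
  proof (intro conjI)
    show "type_of monomial \<in> component 9 3981" unfolding C1 by simp
    show "basis_produces 9 (component 9 3981) monomial
       (vcol [hrow [Ind 0, Ind 1, Ind 2], hrow [Ind 3, vcol [Ind 6, Ind 5], vcol [Ind 4, Ind 7], Ind 8]])"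
      using basis unfolding swap .
    show "swap_indets 4 6 monomial = vcol [hrow [Ind 0, Ind 1, Ind 2],
            hrow [Ind 3, vcol [Ind 6, Ind 5], vcol [Ind 4, Ind 7], Ind 8]]" by (rule swap)
    show "\<forall>a\<in>S. \<forall>b\<in>S. \<forall>c\<in>S. \<forall>d\<in>S. \<forall>e\<in>S. \<forall>f\<in>S. \<forall>g\<in>S. \<forall>h\<in>S. \<forall>i\<in>S.
       (a \<circ>\<^sub>H b \<circ>\<^sub>H c) \<bullet>\<^sub>V (d \<circ>\<^sub>H (e \<bullet>\<^sub>V f) \<circ>\<^sub>H (g \<bullet>\<^sub>V h) \<circ>\<^sub>H i) =
       (a \<circ>\<^sub>H b \<circ>\<^sub>H c) \<bullet>\<^sub>V (d \<circ>\<^sub>H (g \<bullet>\<^sub>V f) \<circ>\<^sub>H (e \<bullet>\<^sub>V h) \<circ>\<^sub>H i)"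
      by (intro ballI identity)
    show "bij_betw rot (component 9 3981) (component 9 3984)" "bij_betw rot (component 9 3984) (component 9 3982)"
      "bij_betw rot (component 9 3982) (component 9 3983)" "bij_betw rot (component 9 3983) (component 9 3981)"
      unfolding component_numbers by (fact bij_rot)+
    show "\<forall>(N, m) \<in> {(3981, monomial), (3984, rot monomial), (3982, rot (rot monomial)),
                  (3983, rot (rot (rot monomial)))}.
       component 9 N = type_of ` {m'. (m, m') \<in> (F_edges 9)\<^sup>*} \<and>
       (\<forall>m'. (m, m') \<in> (F_edges 9)\<^sup>* \<longrightarrow>
          basis_produces 9 (component 9 N) m' (swap_indets 4 6 m') \<and>
          (\<forall>\<rho>. \<rho> ` {..<9} \<subseteq> S \<longrightarrow>
             eval hop vop \<rho> m' = eval hop vop \<rho> m \<and>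
             eval hop vop \<rho> m' = eval hop vop \<rho> (swap_indets 4 6 m')))"
    proof (rule ballI)
      fix p :: "nat \<times> nat mono"
      assume "p \<in> {(3981, monomial), (3984, rot monomial), (3982, rot (rot monomial)),
                  (3983, rot (rot (rot monomial)))}"
      then consider "p = (3981, monomial)" | "p = (3984, rot monomial)" | "p = (3982, rot (rot monomial))"
        | "p = (3983, rot (rot (rot monomial)))" by blast
      then show "case p of (N, m) \<Rightarrow> component 9 N = type_of ` {m'. (m, m') \<in> (F_edges 9)\<^sup>*} \<and>
       (\<forall>m'. (m, m') \<in> (F_edges 9)\<^sup>* \<longrightarrow>
          basis_produces 9 (component 9 N) m' (swap_indets 4 6 m') \<and>
          (\<forall>\<rho>. \<rho> ` {..<9} \<subseteq> S \<longrightarrow>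
             eval hop vop \<rho> m' = eval hop vop \<rho> m \<and>
             eval hop vop \<rho> m' = eval hop vop \<rho> (swap_indets 4 6 m')))"
      proof cases
        case 1 show ?thesis unfolding 1 case_prod_conv by (rule P1[OF C1])
      next
        case 2 show ?thesis unfolding 2 case_prod_conv by (rule P4[OF C4])
      next
        case 3 show ?thesis unfolding 3 case_prod_conv by (rule P2[OF C2])
      next
        case 4 show ?thesis unfolding 4 case_prod_conv by (rule P3[OF C3])
      qed
    qed
  qed (unfold reps component_numbers comp2_def comp3_def comp4_def, simp_all only: reach_refl)
qed

end
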